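(* Let $k\ge 1$ and $n\ge 1$ be integers, and let $\mathcal{H}^{i,j}(L)$ denote the Khovanov homology of $L$ with rational coefficients, in homological degree $i$ and quantum degree $j$. (1) If $\gcd(2k+1,n)=1$, then for the weaving knot $W(2k+1,n)$ the non-vanishing Khovanov homology lies on the lines $j = 2i \pm 1$; that is, $\mathcal{H}^{i,j}\bigl(W(2k+1,n)\bigr) \neq 0$ implies $j = 2i+1$ or $j=2i-1$. (2) If $\gcd(2k,n)=1$, then for the weaving knot $W(2k,n)$ the non-vanishing Khovanov homology lies on the lines $j = 2i+n-1\pm 1$; that is, $\mathcal{H}^{i,j}\bigl(W(2k,n)\bigr)\neq 0$ implies $j = 2i+n$ or $j = 2i+n-2$.
   Context: For integers $p \ge 2$, $q \ge 1$, $W(p,q)$ denotes the closure of the braid $(\sigma_1\sigma_2^{-1}\sigma_3\cdots\sigma_{p-1}^{\pm1})^q$ on $p$ strands, where the exponents alternate in sign starting with $+1$ for $\sigma_1$; that is, it is obtained from the standard diagram of the torus link $T(p,q)$ (the closure of $(\sigma_1\sigma_2\cdots\sigma_{p-1})^q$) by making it alternating. It has $\gcd(p,q)$ components and is called the weaving knot of type $(p,q)$ when $\gcd(p,q)=1$. Convention: with all strands of the braid oriented in the same direction, each generator $\sigma_i$ is a positive (right-handed) crossing and $\sigma_i^{-1}$ is a negative crossing. Khovanov homology $\mathcal{H}^{i,j}$ is bigraded and normalized so that $\sum_{i,j}(-1)^iQ^j\dim \mathcal{H}^{i,j}(L) = (Q^{-1}+Q)V_L(Q^2)$, where $V_L$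 is the Jones polynomial, with conventions such that for the right-handed trefoil (all crossings positive) $\sum_{i,j} t^iQ^j\dim\mathcal{H}^{i,j} = Q+Q^3+t^2Q^5+t^3Q^9$. *)

theory Defs
  imports Main "HOL.Rat" "HOL-Library.FuncSet"
begin

section \<open>Oriented link diagrams\<close>

text \<open>
  A diagram is cut into arcs, here called points, which are glued to each other either directly
  (the pairs in \<open>joins\<close>) or at crossings.  A crossing is drawn so that both of its strands run
  upwards; \<open>sw\<close>, \<open>se\<close>, \<open>nw\<close>, \<open>ne\<close> are the points at its four corners.  So the strands run from
  \<open>sw\<close> to \<open>ne\<close> and from \<open>se\<close> to \<open>nw\<close>; the first is the overstrand iff the crossing is positive
  (right-handed).
\<close>

record 'a crossing =
  positive :: bool
  sw :: 'a
  se :: 'a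
  nw :: 'a
  ne :: 'a

record 'a diagram =
  points :: "'a set"
  joins :: "('a \<times> 'a) set"
  crossings :: "'a crossing list"

definition n_crossings :: "'a diagram \<Rightarrow> nat" where
  "n_crossings D = length (crossings D)"

definition n_plus :: "'a diagram \<Rightarrow> nat" where
  "n_plus D = length (filter positive (crossings D))"

definition n_minus :: "'a diagram \<Rightarrow> nat" where
  "n_minus D = length (filter (\<lambda>c. \<not> positive c) (crossings D))"


section \<open>The cube of resolutions\<close>

text \<open>
  The two pairs of points that are connected by the 0-smoothing (\<open>one = False\<close>) or by the
  1-smoothing (\<open>one = True\<close>).  The smoothing that respects the orientation is the 0-smoothing of a
  positive and the 1-smoothing of a negative crossing.
\<close>

definition smoothing :: "'a crossing \<Rightarrow> bool \<Rightarrow> ('a \<times> 'a) \<times> ('a \<times> 'a)" where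
  "smoothing c one =
     (if positive c \<noteq> one then ((sw c, nw c), (se c, ne c)) else ((sw c, se c), (nw c, ne c)))"

text \<open>
  A vertex of the cube is given by the set \<open>S\<close> of the indices of the 1-smoothed crossings.
  A circle of the resolution is represented by the set of the points on it.
\<close>

definition resolution_rel :: "'a diagram \<Rightarrow> nat set \<Rightarrow> ('a \<times> 'a) set" where
  "resolution_rel D S = joins D \<union>
     (\<Union>r<n_crossings D. {fst (smoothing (crossings D ! r) (r \<in> S)),
                         snd (smoothing (crossings D ! r) (r \<in> S))})"

definition circle_of :: "'a diagram \<Rightarrow> nat set \<Rightarrow> 'a \<Rightarrow> 'a set" where
  "circle_of D S x = (resolution_rel D S \<union> (resolution_rel D S)\<inverse>)\<^sup>* `` {x}"

definition circles :: "'a diagram \<Rightarrow> nat set \<Rightarrow> 'a set set" where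
  "circles D S = circle_of D S ` points D"


section \<open>The Khovanov complex over the rationals\<close>

text \<open>
  \<open>VP\<close> and \<open>VM\<close> are the basis vectors \<open>v\<^sub>+\<close> and \<open>v\<^sub>-\<close>, of degrees 1 and -1, of the Frobenius
  algebra \<open>V\<close>.  The functions \<open>m_coeff\<close> and \<open>Delta_coeff\<close> are the structure constants of its
  multiplication and comultiplication: \<open>m_coeff a b c\<close> is the coefficient of \<open>c\<close> in
  \<open>m (a \<otimes> b)\<close>, and \<open>Delta_coeff a b c\<close> is the coefficient of \<open>b \<otimes> c\<close> in \<open>\<Delta> a\<close>.
\<close>

datatype vlabel = VP | VM

fun vdeg :: "vlabel \<Rightarrow> int" where
  "vdeg VP = 1"
| "vdeg VM = -1"

fun m_coeff :: "vlabel \<Rightarrow> vlabel \<Rightarrow> vlabel \<Rightarrow> rat" where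
  "m_coeff VP VP c = of_bool (c = VP)"
| "m_coeff VP VM c = of_bool (c = VM)"
| "m_coeff VM VP c = of_bool (c = VM)"
| "m_coeff VM VM c = 0"

fun Delta_coeff :: "vlabel \<Rightarrow> vlabel \<Rightarrow> vlabel \<Rightarrow> rat" where
  "Delta_coeff VP b c = of_bool (b = VP \<and> c = VM) + of_bool (b = VM \<and> c = VP)"
| "Delta_coeff VM b c = of_bool (b = VM \<and> c = VM)"

text \<open>
  The enhanced states \<open>(S, l)\<close> are the standard basis of the complex: at the vertex \<open>S\<close> of the cube
  the labelling \<open>l\<close> stands for a basis vector of the tensor product of one copy of \<open>V\<close> for each
  circle.
\<close>

type_synonym 'a state = "nat set \<times> ('a set \<Rightarrow> vlabel)"

definition states :: "'a diagram \<Rightarrow> 'a state set" where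
  "states D = {(S, l). S \<subseteq> {..<n_crossings D} \<and> l \<in> circles D S \<rightarrow>\<^sub>E UNIV}"

fun hom_deg :: "'a diagram \<Rightarrow> 'a state \<Rightarrow> int" where
  "hom_deg D (S, l) = int (card S) - int (n_minus D)"

fun quantum_deg :: "'a diagram \<Rightarrow> 'a state \<Rightarrow> int" where
  "quantum_deg D (S, l) =
     (\<Sum>C\<in>circles D S. vdeg (l C)) + int (card S) + int (n_plus D) - 2 * int (n_minus D)"

text \<open>
  The coefficient of \<open>(insert r S, l')\<close> in the image of \<open>(S, l)\<close> under the (unsigned) map along the
  edge of the cube that changes the smoothing of the crossing \<open>r \<notin> S\<close>: the multiplication if two
  circles merge, the comultiplication if a circle splits, tensored with the identity on the other
  circles.  If the diagram is planar, one of the two always happens.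
\<close>

definition edge_coeff ::
    "'a diagram \<Rightarrow> nat set \<Rightarrow> nat \<Rightarrow> ('a set \<Rightarrow> vlabel) \<Rightarrow> ('a set \<Rightarrow> vlabel) \<Rightarrow> rat" where
  "edge_coeff D S r l l' =
    (let S' = insert r S;
         ((p, _), (q, _)) = smoothing (crossings D ! r) False;
         ((p', _), (q', _)) = smoothing (crossings D ! r) True;
         a = circle_of D S p; b = circle_of D S q;
         a' = circle_of D S' p'; b' = circle_of D S' q'
     in of_bool (\<forall>C \<in> circles D S \<inter> circles D S'. l' C = l C) *
        (if a \<noteq> b \<and> a' = b' then m_coeff (l a) (l b) (l' a')
         else if a = b \<and> a' \<noteq> b' then Delta_coeff (l a) (l' a') (l' b')
         else 0))"

text \<open>Matrix entries of the differential, with the usual sign of an edge of the cube.\<close>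

fun incidence :: "'a diagram \<Rightarrow> 'a state \<Rightarrow> 'a state \<Rightarrow> rat" where
  "incidence D (S, l) (S', l') =
     (\<Sum>r | r < n_crossings D \<and> r \<notin> S \<and> S' = insert r S.
        (-1) ^ card {s \<in> S. s < r} * edge_coeff D S r l l')"

type_synonym 'a chain = "'a state \<Rightarrow> rat"

definition differential :: "'a diagram \<Rightarrow> 'a chain \<Rightarrow> 'a chain" where
  "differential D c =
     (\<lambda>y. if y \<in> states D then \<Sum>x\<in>states D. incidence D x y * c x else 0)"

definition chains :: "'a diagram \<Rightarrow> int \<Rightarrow> int \<Rightarrow> 'a chain set" where
  "chains D i j =
     {c. \<forall>x. c x \<noteq> 0 \<longrightarrow> x \<in> states D \<and> hom_deg D x = i \<and> quantum_deg D x = j}"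

definition cycles :: "'a diagram \<Rightarrow> int \<Rightarrow> int \<Rightarrow> 'a chain set" where
  "cycles D i j = {c \<in> chains D i j. differential D c = (\<lambda>_. 0)}"

definition boundaries :: "'a diagram \<Rightarrow> int \<Rightarrow> int \<Rightarrow> 'a chain set" where
  "boundaries D i j = differential D ` chains D (i - 1) j"

definition homologous :: "'a diagram \<Rightarrow> int \<Rightarrow> int \<Rightarrow> ('a chain \<times> 'a chain) set" where
  "homologous D i j =
     {(c, c'). c \<in> cycles D i j \<and> c' \<in> cycles D i j \<and> (\<lambda>x. c x - c' x) \<in> boundaries D i j}"

text \<open>
  The homology in bidegree \<open>(i, j)\<close>, as the set of the homology classes, and its zero element;
  so the homology vanishes iff \<open>khovanov_homology D i j = {khovanov_zero D i j}\<close>.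
\<close>

definition khovanov_homology :: "'a diagram \<Rightarrow> int \<Rightarrow> int \<Rightarrow> 'a chain set set" where
  "khovanov_homology D i j = cycles D i j // homologous D i j"

definition khovanov_zero :: "'a diagram \<Rightarrow> int \<Rightarrow> int \<Rightarrow> 'a chain set" where
  "khovanov_zero D i j = homologous D i j `` {\<lambda>_. 0}"


section \<open>Closed braids and weaving links\<close>

text \<open>
  A letter \<open>(s, True)\<close> of a braid word is the generator \<open>\<sigma>\<^sub>s\<close>, \<open>(s, False)\<close> is its inverse.
  The points of the closure of a braid word \<open>w\<close> on \<open>p\<close> strands are the pairs \<open>(s, t)\<close> of a position
  \<open>s \<in> {1..p}\<close> and a height \<open>t \<in> {0..length w}\<close>.  All strands run upwards; letter \<open>t\<close> of \<open>w\<close> is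
  placed between the heights \<open>t\<close> and \<open>t + 1\<close>.
\<close>

type_synonym braid_word = "(nat \<times> bool) list"

definition braid_closure :: "nat \<Rightarrow> braid_word \<Rightarrow> (nat \<times> nat) diagram" where
  "braid_closure p w =
     \<lparr>points = {1..p} \<times> {0..length w},
      joins =
        {((s, t), (s, t + 1)) | s t.
           s \<in> {1..p} \<and> t < length w \<and> s \<noteq> fst (w ! t) \<and> s \<noteq> fst (w ! t) + 1} \<union>
        {((s, length w), (s, 0)) | s. s \<in> {1..p}},
      crossings =
        map (\<lambda>t. \<lparr>positive = snd (w ! t),
                  sw = (fst (w ! t), t), se = (fst (w ! t) + 1, t),
                  nw = (fst (w ! t), t + 1), ne = (fst (w ! t) + 1, t + 1)\<rparr>)
          [0..<length w]\<rparr>"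

text \<open>The word \<open>(\<sigma>\<^sub>1 \<sigma>\<^sub>2\<inverse> \<sigma>\<^sub>3 \<dots>)\<^sup>q\<close> in the generators \<open>\<sigma>\<^sub>1, \<dots>, \<sigma>\<^sub>p\<^sub>-\<^sub>1\<close>.\<close>

definition weaving_word :: "nat \<Rightarrow> nat \<Rightarrow> braid_word" where
  "weaving_word p q = concat (replicate q (map (\<lambda>s. (s, odd s)) [1..<p]))"

definition weaving :: "nat \<Rightarrow> nat \<Rightarrow> (nat \<times> nat) diagram" where
  "weaving p q = braid_closure p (weaving_word p q)"

end

theory Submission
  imports Defs
begin

text \<open>
  The thinness holds for every connected diagram of Turaev genus zero, on the lines
  \<open>j - 2 i = n_plus - V\<close> and \<open>j - 2 i = n_plus - V + 2\<close>, where \<open>V\<close> is the number of circles of the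
  all-0 resolution.  The proof is an induction over the faces of the cube that are connected as
  partially resolved diagrams.  If both smoothings of some crossing leave the diagram connected, the
  long exact sequence of the pair of opposite faces gives the claim, and only its exactness in the
  middle is needed.  If all crossings are nugatory, one of them has a smoothing that splits off a
  circle without further crossings, and the argument for the first Reidemeister move removes it.
  In the end one circle is left; then the 1-smoothed crossings form a spanning tree of the
  checkerboard graph, so there are \<open>V - 1\<close> of them, which puts the two generators on the two lines.
\<close>

section \<open>Components of a relation\<close>

text \<open>A combinatorial diagram comes without planarity, so even the vanishing of the squared
  differential has to be earned: a priori an edge of the cube might leave the number of circles
  unchanged. The circle count of Turaev genus zero takes the place of planarity. The difference
  \<open>rank\<close> of two component counts grows by at most one per crossing, and the bound on
  the circles at the two extreme vertices leaves no slack, so every step is exactly one. This forces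
  each edge to merge or to split, and it also fixes the number of 1-smoothings at a vertex with a
  single circle. The differential preserves \<open>j\<close> and raises \<open>i\<close> by one, so
  it lowers \<open>j - 2 i\<close> by two. In this single grading, exactness can be treated one
  degree at a time. A crossing with a disconnecting smoothing cannot be handled by the long exact
  sequence, because a disconnected face can carry homology in further degrees; this is why nugatory
  crossings need an argument of their own.\<close>

definition conn :: "('a \<times> 'a) set \<Rightarrow> ('a \<times> 'a) set" where
  "conn R = (R \<union> R\<inverse>)\<^sup>*"

lemma conn_refl [simp, intro]: "(x, x) \<in> conn R"
  by (simp add: conn_def)

lemma conn_sym: "(x, y) \<in> conn R \<Longrightarrow> (y, x) \<in> conn R"
  unfolding conn_def using sym_Un_converse[of R] sym_rtrancl by (metis symD)

lemma conn_trans: "(x, y) \<in> conn R \<Longrightarrow> (y, z) \<in> conn R \<Longrightarrow> (x, z) \<in> conn R"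
  unfolding conn_def by (rule rtrancl_trans)

lemma conn_base: "(x, y) \<in> R \<Longrightarrow> (x, y) \<in> conn R"
  unfolding conn_def by blast

lemma conn_subset: assumes "R \<subseteq> conn R'" shows "conn R \<subseteq> conn R'"
proof -
  have "R \<union> R\<inverse> \<subseteq> conn R'" using assms by (auto intro: conn_sym)
  then have "(R \<union> R\<inverse>)\<^sup>* \<subseteq> (conn R')\<^sup>*" by (rule rtrancl_mono)
  then show ?thesis by (simp add: conn_def)
qed

lemma conn_mono: "R \<subseteq> R' \<Longrightarrow> conn R \<subseteq> conn R'"
  by (rule conn_subset) (auto intro: conn_base)

lemma conn_eqI: "R \<subseteq> conn R' \<Longrightarrow> R' \<subseteq> conn R \<Longrightarrow> conn R = conn R'"
  by (simp add: conn_subset subset_antisym)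

lemma conn_closed:
  assumes "(x, y) \<in> conn R" "x \<in> K" "\<And>u v. (u, v) \<in> R \<Longrightarrow> u \<in> K \<longleftrightarrow> v \<in> K"
  shows "y \<in> K"
  using assms(1) unfolding conn_def
  by (induction rule: rtrancl_induct) (use assms(2,3) in auto)

lemma conn_insert:
  "(x, y) \<in> conn (insert (p, q) R) \<longleftrightarrow>
     (x, y) \<in> conn R \<or>
     ((x, p) \<in> conn R \<or> (x, q) \<in> conn R) \<and> ((y, p) \<in> conn R \<or> (y, q) \<in> conn R)"
  (is "?l \<longleftrightarrow> ?r")
proof
  assume l: ?l
  define K where "K = {y. (x, y) \<in> conn R \<or>
     ((x, p) \<in> conn R \<or> (x, q) \<in> conn R) \<and> ((y, p) \<in> conn R \<or> (y, q) \<in> conn R)}"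
  have "y \<in> K"
  proof (rule conn_closed[OF l])
    show "x \<in> K" by (simp add: K_def)
    fix u v assume "(u, v) \<in> insert (p, q) R"
    then consider "u = p" "v = q" | "(u, v) \<in> conn R" by (auto intro: conn_base)
    then show "u \<in> K \<longleftrightarrow> v \<in> K"
      unfolding K_def by cases (auto, (meson conn_sym conn_trans)+)
  qed
  then show ?r by (simp add: K_def)
next
  assume r: ?r
  have *: "conn R \<subseteq> conn (insert (p, q) R)" by (rule conn_mono) auto
  moreover have "(p, q) \<in> conn (insert (p, q) R)" by (rule conn_base) auto
  ultimately show ?l using r by (meson conn_sym conn_trans subsetD)
qed

lemma conn_class_eq: "conn R `` {x} = conn R `` {y} \<longleftrightarrow> (x, y) \<in> conn R"
  by (auto intro: conn_sym conn_trans)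

lemma conn_class_image: "conn R \<subseteq> conn R' \<Longrightarrow> conn R' `` (conn R `` {x}) = conn R' `` {x}"
  by (auto intro: conn_trans)

definition comps :: "('a \<times> 'a) set \<Rightarrow> 'a set \<Rightarrow> 'a set set" where
  "comps R X = (\<lambda>x. conn R `` {x}) ` X"

lemma comps_image: "conn R \<subseteq> conn R' \<Longrightarrow> comps R' X = (\<lambda>C. conn R' `` C) ` comps R X"
  by (simp add: comps_def image_image conn_class_image)

text \<open>The new pair can only fuse the classes of \<open>p\<close> and \<open>q\<close>, so
  setting the class of \<open>p\<close> aside makes the map on classes injective.\<close>

lemma card_comps_insert:
  assumes "finite X"
  shows "card (comps R X) \<le> card (comps (insert (p, q) R) X) + 1"
proof -
  let ?R' = "insert (p, q) R" and ?P = "conn R `` {p}"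
  have *: "conn R \<subseteq> conn ?R'" by (rule conn_mono) auto
  have fin: "finite (comps R X)" "finite (comps ?R' X)" using assms by (simp_all add: comps_def)
  have "inj_on (\<lambda>C. conn ?R' `` C) (comps R X - {?P})"
  proof (rule inj_onI)
    fix C C' assume "C \<in> comps R X - {?P}" "C' \<in> comps R X - {?P}"
      and eq: "conn ?R' `` C = conn ?R' `` C'"
    moreover from this obtain x y where "C = conn R `` {x}" "C' = conn R `` {y}"
      unfolding comps_def by blast
    ultimately have "C = conn R `` {x}" "C' = conn R `` {y}" "(x, p) \<notin> conn R" "(y, p) \<notin> conn R"
      using conn_class_eq[of R _ p] by simp_all
    moreover from this eq have "(x, y) \<in> conn ?R'" using * by (simp add: conn_class_image conn_class_eq)
    ultimately show "C = C'"
      unfolding conn_insert using conn_class_eq[of R x y] conn_sym conn_trans by metis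
  qed
  moreover have "(\<lambda>C. conn ?R' `` C) ` (comps R X - {?P}) \<subseteq> comps ?R' X"
    using comps_image[OF *] by auto
  ultimately have "card (comps R X - {?P}) \<le> card (comps ?R' X)"
    using fin card_inj_on_le by blast
  then show ?thesis using fin by (simp add: card_Diff_singleton_if split: if_splits)
qed

text \<open>A function constant along \<open>R\<close> has one value per component, so its values
  bound the number of components from below; \<open>circle_code\<close> will be such a
  function.\<close>

lemma card_comps_ge_image:
  assumes "finite X" "\<And>x y. (x, y) \<in> R \<Longrightarrow> f x = f y"
  shows "card (f ` X) \<le> card (comps R X)"
proof -
  have f: "f x = f y" if "(x, y) \<in> conn R" for x y
    using conn_closed[OF that, of "{z. f z = f x}"] assms(2) by auto
  have "f ` X = (\<lambda>C. f (SOME z. z \<in> C)) ` comps R X"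
    unfolding comps_def image_image
  proof (rule image_cong[OF refl])
    fix x
    have "(SOME z. z \<in> conn R `` {x}) \<in> conn R `` {x}" by (rule someI[of _ x]) simp
    then show "f x = f (SOME z. z \<in> conn R `` {x})" using f by blast
  qed
  then show ?thesis using assms(1) by (simp add: card_image_le comps_def)
qed


section \<open>Exactness of based complexes\<close>

definition bdry :: "('b \<Rightarrow> 'b \<Rightarrow> rat) \<Rightarrow> 'b set \<Rightarrow> ('b \<Rightarrow> rat) \<Rightarrow> 'b \<Rightarrow> rat" where
  "bdry d Y c y = (\<Sum>x\<in>Y. d x y * c x)"

definition supported :: "('b \<Rightarrow> int) \<Rightarrow> 'b set \<Rightarrow> int \<Rightarrow> ('b \<Rightarrow> rat) \<Rightarrow> bool" where
  "supported gr Y g c \<longleftrightarrow> (\<forall>x. c x \<noteq> 0 \<longrightarrow> x \<in> Y \<and> gr x = g)"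

text \<open>The matrix lowers the degree by two, so a chain in degree \<open>g\<close> is bounded by
  one in degree \<open>g + 2\<close>. Chains live on \<open>Y\<close> and boundaries are read on
  \<open>Y\<close> only, so that \<open>Y\<close> can be a subquotient carrying the matrix of the
  ambient complex.\<close>

definition exact_at :: "('b \<Rightarrow> 'b \<Rightarrow> rat) \<Rightarrow> ('b \<Rightarrow> int) \<Rightarrow> 'b set \<Rightarrow> int \<Rightarrow> bool" where
  "exact_at d gr Y g \<longleftrightarrow>
     (\<forall>c. supported gr Y g c \<and> (\<forall>y\<in>Y. bdry d Y c y = 0) \<longrightarrow>
       (\<exists>b. supported gr Y (g + 2) b \<and> (\<forall>y\<in>Y. bdry d Y b y = c y)))"

definition graded_complex :: "('b \<Rightarrow> 'b \<Rightarrow> rat) \<Rightarrow> ('b \<Rightarrow> int) \<Rightarrow> 'b set \<Rightarrow> bool" where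
  "graded_complex d gr Y \<longleftrightarrow> finite Y \<and>
     (\<forall>x\<in>Y. \<forall>y\<in>Y. d x y \<noteq> 0 \<longrightarrow> gr y = gr x - 2) \<and>
     (\<forall>x\<in>Y. \<forall>z\<in>Y. (\<Sum>y\<in>Y. d x y * d y z) = 0)"

lemma bdry_bdry:
  assumes "graded_complex d gr Y" "z \<in> Y"
  shows "bdry d Y (bdry d Y c) z = 0"
proof -
  have "bdry d Y (bdry d Y c) z = (\<Sum>y\<in>Y. \<Sum>x\<in>Y. d x y * d y z * c x)"
    by (simp add: bdry_def sum_distrib_left mult_ac)
  also have "\<dots> = (\<Sum>x\<in>Y. \<Sum>y\<in>Y. d x y * d y z * c x)"
    by (rule sum.swap)
  also have "\<dots> = (\<Sum>x\<in>Y. (\<Sum>y\<in>Y. d x y * d y z) * c x)"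
    by (simp add: sum_distrib_right)
  also have "\<dots> = 0"
    using assms by (simp add: graded_complex_def)
  finally show ?thesis .
qed

text \<open>Paths of length two between states of \<open>Z\<close> do not leave \<open>Z\<close>, so
  the sum for the square loses no term. This covers faces and other subquotients of the
  cube.\<close>

lemma graded_complex_convex:
  assumes "graded_complex d gr Y" "Z \<subseteq> Y"
    and conv: "\<And>x y z. x \<in> Z \<Longrightarrow> z \<in> Z \<Longrightarrow> y \<in> Y \<Longrightarrow> d x y \<noteq> 0 \<Longrightarrow> d y z \<noteq> 0 \<Longrightarrow> y \<in> Z"
  shows "graded_complex d gr Z"
  unfolding graded_complex_def
proof (intro conjI ballI impI)
  show "finite Z" using assms(1,2) by (auto simp: graded_complex_def intro: finite_subset)
  fix x z assume xz: "x \<in> Z" "z \<in> Z"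
  show "gr z = gr x - 2" if "d x z \<noteq> 0"
  proof -
    have "\<forall>x\<in>Y. \<forall>y\<in>Y. d x y \<noteq> 0 \<longrightarrow> gr y = gr x - 2" using assms(1) by (simp add: graded_complex_def)
    then show ?thesis using that xz assms(2) by blast
  qed
  have "(\<Sum>y\<in>Z. d x y * d y z) = (\<Sum>y\<in>Y. d x y * d y z)"
  proof (rule sum.mono_neutral_left)
    show "finite Y" using assms(1) by (simp add: graded_complex_def)
    show "\<forall>y\<in>Y - Z. d x y * d y z = 0" using conv[OF xz] by auto
  qed (rule assms(2))
  also have "\<dots> = 0"
    using assms(1) subsetD[OF assms(2)] xz by (simp add: graded_complex_def)
  finally show "(\<Sum>y\<in>Z. d x y * d y z) = 0" .
qed

lemma bdry_Un:
  assumes "finite A" "finite B" "A \<inter> B = {}"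
  shows "bdry d (A \<union> B) c y = bdry d A c y + bdry d B c y"
  unfolding bdry_def using assms by (rule sum.union_disjoint)

lemma bdry_nonzeroE:
  assumes "bdry d Y c y \<noteq> 0" obtains x where "x \<in> Y" "d x y \<noteq> 0" "c x \<noteq> 0"
proof -
  obtain x where "x \<in> Y" "d x y * c x \<noteq> 0"
    using assms unfolding bdry_def by (rule sum.not_neutral_contains_not_neutral)
  then show ?thesis using that by auto
qed

lemma bdry_zero: "(\<And>x. x \<in> Y \<Longrightarrow> d x y = 0 \<or> c x = 0) \<Longrightarrow> bdry d Y c y = 0"
  by (auto simp: bdry_def intro!: sum.neutral)

lemma bdry_add: "bdry d Y (\<lambda>x. b x + c x) y = bdry d Y b y + bdry d Y c y"
  by (simp add: bdry_def algebra_simps sum.distrib)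

lemma bdry_diff: "bdry d Y (\<lambda>x. b x - c x) y = bdry d Y b y - bdry d Y c y"
  by (simp add: bdry_def algebra_simps sum_subtractf)

lemma bdry_cong: "(\<And>x. x \<in> Y \<Longrightarrow> b x = c x) \<Longrightarrow> bdry d Y b y = bdry d Y c y"
  by (simp add: bdry_def)

text \<open>\<open>A\<close> is a subcomplex and \<open>B\<close> the quotient, so this is the
  middle of the long exact sequence: a cycle is first bounded modulo \<open>A\<close>, and what
  remains is a cycle in \<open>A\<close>.\<close>

lemma exact_at_Un:
  assumes cx: "graded_complex d gr (A \<union> B)" and disj: "A \<inter> B = {}"
    and sub: "\<And>x y. x \<in> A \<Longrightarrow> y \<in> B \<Longrightarrow> d x y = 0"
    and A: "exact_at d gr A g" and B: "exact_at d gr B g"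
  shows "exact_at d gr (A \<union> B) g"
  unfolding exact_at_def
proof (intro allI impI, elim conjE)
  fix c assume c: "supported gr (A \<union> B) g c" and cyc: "\<forall>y\<in>A \<union> B. bdry d (A \<union> B) c y = 0"
  have fin: "finite A" "finite B" using cx by (auto simp: graded_complex_def)
  note un = bdry_Un[OF fin disj]
  have subB: "bdry d A b y = 0" if "y \<in> B" for b y
    using sub that by (intro bdry_zero) auto
  define cB where "cB = (\<lambda>x. if x \<in> B then c x else 0)"
  have "supported gr B g cB" using c by (auto simp: supported_def cB_def)
  moreover have "bdry d B cB y = 0" if "y \<in> B" for y
  proof -
    have "bdry d B cB y = bdry d B c y" by (rule bdry_cong) (simp add: cB_def)
    then show ?thesis using cyc that subB[OF that, of c] un[of d c y] by simp
  qed
  ultimately obtain bB where bB: "supported gr B (g + 2) bB" "\<And>y. y \<in> B \<Longrightarrow> bdry d B bB y = cB y"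
    using B unfolding exact_at_def by blast
  \<comment> \<open>The chain \<open>bB\<close> may also have boundary in \<open>A\<close>; this
    correction is part of what is left to bound there.\<close>
  define cA where "cA = (\<lambda>y. if y \<in> A then c y - bdry d B bB y else 0)"
  have full: "cA y = c y - bdry d (A \<union> B) bB y" if "y \<in> A \<union> B" for y
  proof -
    have "bdry d A bB y = 0" by (rule bdry_zero) (use bB(1) disj in \<open>auto simp: supported_def\<close>)
    then show ?thesis using that disj bB(2)[of y] by (auto simp: cA_def cB_def un)
  qed
  have "supported gr A g cA"
    unfolding supported_def
  proof (intro allI impI)
    fix y assume y: "cA y \<noteq> 0"
    then have yA: "y \<in> A" by (auto simp: cA_def split: if_splits)
    consider "c y \<noteq> 0" | "bdry d B bB y \<noteq> 0" using y yA unfolding cA_def by fastforce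
    then have "gr y = g"
    proof cases
      case 1 then show ?thesis using c by (auto simp: supported_def)
    next
      case 2
      then obtain x where x: "x \<in> B" "d x y \<noteq> 0" "bB x \<noteq> 0" by (rule bdry_nonzeroE)
      then have "gr x = g + 2" using bB by (auto simp: supported_def)
      moreover have "gr y = gr x - 2" using cx x yA by (auto simp: graded_complex_def)
      ultimately show ?thesis by simp
    qed
    then show "y \<in> A \<and> gr y = g" using yA by simp
  qed
  moreover have "bdry d A cA y = 0" if "y \<in> A" for y
  proof -
    have "bdry d B cA y = 0" using disj by (intro bdry_zero) (auto simp: cA_def)
    then have "bdry d A cA y = bdry d (A \<union> B) cA y" by (simp add: un)
    also have "\<dots> = bdry d (A \<union> B) (\<lambda>y. c y - bdry d (A \<union> B) bB y) y"
      by (rule bdry_cong) (simp add: full)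
    also have "\<dots> = 0"
      using bdry_bdry[OF cx, of y bB] cyc that by (simp add: bdry_diff)
    finally show ?thesis .
  qed
  ultimately obtain bA where bA: "supported gr A (g + 2) bA" "\<And>y. y \<in> A \<Longrightarrow> bdry d A bA y = cA y"
    using A unfolding exact_at_def by blast
  have "bdry d (A \<union> B) (\<lambda>x. bA x + bB x) y = c y" if y: "y \<in> A \<union> B" for y
  proof -
    have "bdry d B bA y = 0" using disj bA(1) by (intro bdry_zero) (auto simp: supported_def)
    moreover have "bdry d A bA y = cA y"
      using y bA(2) subB disj by (auto simp: cA_def)
    ultimately show ?thesis using full[OF y] by (simp add: bdry_add un[of d bA])
  qed
  moreover have "supported gr (A \<union> B) (g + 2) (\<lambda>x. bA x + bB x)"
    using bA(1) bB(1) unfolding supported_def by (metis Un_iff add_0)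
  ultimately show "\<exists>b. supported gr (A \<union> B) (g + 2) b \<and> (\<forall>y\<in>A \<union> B. bdry d (A \<union> B) b y = c y)"
    by blast
qed

text \<open>Rescaled by the weights \<open>w\<close>, the bijection \<open>\<phi>\<close> is an
  isomorphism of complexes up to the constant \<open>k\<close>. The weights absorb the nonzero
  entries of a matching, and \<open>k = - 1\<close> allows for its anticommuting with the
  differentials.\<close>

lemma exact_at_transfer:
  assumes bij: "bij_betw \<phi> A B"
    and w: "\<And>x. x \<in> A \<Longrightarrow> w x \<noteq> 0" and k: "k \<noteq> 0"
    and d: "\<And>x y. x \<in> A \<Longrightarrow> y \<in> A \<Longrightarrow> d x y * w y = k * w x * d (\<phi> x) (\<phi> y)"
    and gr: "\<And>x. x \<in> A \<Longrightarrow> gr (\<phi> x) = gr x + h"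
    and A: "exact_at d gr A g"
  shows "exact_at d gr B (g + h)"
  unfolding exact_at_def
proof (intro allI impI, elim conjE)
  fix c assume c: "supported gr B (g + h) c" and cyc: "\<forall>y\<in>B. bdry d B c y = 0"
  let ?i = "inv_into A \<phi>"
  have inj: "inj_on \<phi> A" and im: "\<phi> ` A = B" using bij by (auto simp: bij_betw_def)
  have *: "bdry d B b (\<phi> y) = w y / k * bdry d A (\<lambda>x. if x \<in> A then b (\<phi> x) / w x else 0) y"
    if y: "y \<in> A" for b y
  proof -
    have "bdry d B b (\<phi> y) = (\<Sum>x\<in>A. d (\<phi> x) (\<phi> y) * b (\<phi> x))"
      unfolding bdry_def using sum.reindex_bij_betw[OF bij, of "\<lambda>x. d x (\<phi> y) * b x"] by simp
    also have "\<dots> = (\<Sum>x\<in>A. w y / k * (d x y * (b (\<phi> x) / w x)))"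
    proof (rule sum.cong[OF refl])
      fix x assume x: "x \<in> A"
      show "d (\<phi> x) (\<phi> y) * b (\<phi> x) = w y / k * (d x y * (b (\<phi> x) / w x))"
        using d[OF x y] w[OF x] k by (simp add: field_simps)
    qed
    also have "\<dots> = w y / k * bdry d A (\<lambda>x. if x \<in> A then b (\<phi> x) / w x else 0) y"
      by (simp add: bdry_def sum_distrib_left)
    finally show ?thesis .
  qed
  define c' where "c' = (\<lambda>x. if x \<in> A then c (\<phi> x) / w x else 0)"
  have "supported gr A g c'"
    unfolding supported_def
  proof (intro allI impI)
    fix x assume "c' x \<noteq> 0"
    then have "x \<in> A" "c (\<phi> x) \<noteq> 0" by (auto simp: c'_def split: if_splits)
    then show "x \<in> A \<and> gr x = g" using c gr[of x] by (auto simp: supported_def)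
  qed
  moreover have "bdry d A c' y = 0" if "y \<in> A" for y
    using *[OF that, of c] cyc im that w[OF that] k by (auto simp: c'_def)
  ultimately obtain b' where b': "supported gr A (g + 2) b'" "\<And>y. y \<in> A \<Longrightarrow> bdry d A b' y = c' y"
    using A unfolding exact_at_def by blast
  define b where "b = (\<lambda>y. if y \<in> B then k * w (?i y) * b' (?i y) else 0)"
  have "supported gr B (g + h + 2) b"
    unfolding supported_def
  proof (intro allI impI)
    fix y assume "b y \<noteq> 0"
    then have y: "y \<in> B" "b' (?i y) \<noteq> 0" by (auto simp: b_def split: if_splits)
    then obtain x where x: "x \<in> A" "y = \<phi> x" using im by blast
    then have "b' x \<noteq> 0" using y inj by simp
    then show "y \<in> B \<and> gr y = g + h + 2" using b'(1) gr[OF x(1)] x y by (auto simp: supported_def)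
  qed
  moreover have "bdry d B b y = c y" if y: "y \<in> B" for y
  proof -
    obtain x where x: "x \<in> A" "y = \<phi> x" using y im by blast
    have "bdry d A (\<lambda>x. if x \<in> A then b (\<phi> x) / w x else 0) x = bdry d A (\<lambda>x. k * b' x) x"
      by (rule bdry_cong) (use im inj w in \<open>auto simp: b_def\<close>)
    also have "\<dots> = k * bdry d A b' x" by (simp add: bdry_def sum_distrib_left mult.left_commute)
    also have "\<dots> = k * c' x" using b'(2)[OF x(1)] by simp
    finally show ?thesis using *[OF x(1), of b] x w[OF x(1)] k by (simp add: c'_def)
  qed
  ultimately show "\<exists>b. supported gr B (g + h + 2) b \<and> (\<forall>y\<in>B. bdry d B b y = c y)" by blast
qed

text \<open>The complex is the mapping cone of its block from \<open>A\<close> to \<open>B\<close>,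
  and this block is a bijection up to nonzero scalars. \<open>B\<close> is the subcomplex and
  \<open>A\<close> the quotient.\<close>

locale acyclic_matching =
  fixes d :: "'b \<Rightarrow> 'b \<Rightarrow> rat" and gr :: "'b \<Rightarrow> int" and A B :: "'b set" and \<phi> :: "'b \<Rightarrow> 'b"
  assumes cx: "graded_complex d gr (A \<union> B)" and disj: "A \<inter> B = {}"
    and sub: "\<And>x y. x \<in> B \<Longrightarrow> y \<in> A \<Longrightarrow> d x y = 0"
    and bij: "bij_betw \<phi> A B"
    and d_iff: "\<And>x y. x \<in> A \<Longrightarrow> y \<in> B \<Longrightarrow> d x y \<noteq> 0 \<longleftrightarrow> y = \<phi> x"
begin

lemma fin: "finite A" "finite B"
  using cx by (auto simp: graded_complex_def)

lemma im: "x \<in> A \<Longrightarrow> \<phi> x \<in> B"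
  using bij by (auto simp: bij_betw_def)

lemma phi_eq: "x \<in> A \<Longrightarrow> y \<in> A \<Longrightarrow> \<phi> x = \<phi> y \<longleftrightarrow> x = y"
  using bij by (auto simp: bij_betw_def inj_on_def)

lemma d_off: "x \<in> A \<Longrightarrow> y \<in> A \<Longrightarrow> x \<noteq> y \<Longrightarrow> d x (\<phi> y) = 0"
  using d_iff[of x "\<phi> y"] im phi_eq by fastforce

lemma gr_phi: "x \<in> A \<Longrightarrow> gr (\<phi> x) = gr x - 2"
  using cx im[of x] d_iff[of x "\<phi> x"] by (auto simp: graded_complex_def)

lemma exact_total: "exact_at d gr (A \<union> B) g"
  unfolding exact_at_def
proof (intro allI impI, elim conjE)
  fix c assume c: "supported gr (A \<union> B) g c" and cyc: "\<forall>y\<in>A \<union> B. bdry d (A \<union> B) c y = 0"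
  note un = bdry_Un[OF fin disj]
  have f: "bdry d A e (\<phi> x) = d x (\<phi> x) * e x" if x: "x \<in> A" for e x
  proof -
    have "bdry d A e (\<phi> x) = (\<Sum>y\<in>A. if y = x then d x (\<phi> x) * e x else 0)"
      unfolding bdry_def by (rule sum.cong) (use d_off x in auto)
    then show ?thesis using x fin by simp
  qed
  \<comment> \<open>The inverse of the block from \<open>A\<close> to \<open>B\<close>, applied to
    \<open>c\<close>.\<close>
  define b where "b = (\<lambda>x. if x \<in> A then c (\<phi> x) / d x (\<phi> x) else 0)"
  have bB: "bdry d B b y = 0" for y using disj by (intro bdry_zero) (auto simp: b_def)
  have sb: "supported gr (A \<union> B) (g + 2) b"
    unfolding supported_def
  proof (intro allI impI)
    fix x assume "b x \<noteq> 0"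
    then have "x \<in> A" "c (\<phi> x) \<noteq> 0" by (auto simp: b_def split: if_splits)
    then show "x \<in> A \<union> B \<and> gr x = g + 2" using c gr_phi[of x] by (auto simp: supported_def)
  qed
  have onB: "bdry d (A \<union> B) b y = c y" if "y \<in> B" for y
  proof -
    obtain x where x: "x \<in> A" "y = \<phi> x" using bij \<open>y \<in> B\<close> by (auto simp: bij_betw_def)
    then have "d x (\<phi> x) \<noteq> 0" using d_iff im by auto
    then have "bdry d A b y = c y" using f[OF x(1), of b] x by (simp add: b_def)
    then show ?thesis by (simp add: un bB)
  qed
  define e where "e = (\<lambda>y. c y - bdry d (A \<union> B) b y)"
  \<comment> \<open>\<open>e\<close> is a cycle vanishing on \<open>B\<close>, so its boundary at
    \<open>\<phi> x\<close> consists of the single term with \<open>e x\<close>.\<close>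
  have "e x = 0" if x: "x \<in> A" for x
  proof -
    have "bdry d (A \<union> B) e (\<phi> x) = 0"
      using bdry_bdry[OF cx, of "\<phi> x" b] cyc im[OF x] by (simp add: e_def bdry_diff)
    moreover have "bdry d B e (\<phi> x) = 0" by (rule bdry_zero) (simp add: e_def onB)
    ultimately have "d x (\<phi> x) * e x = 0" by (simp add: un f[OF x])
    then show ?thesis using d_iff[of x "\<phi> x"] im x by auto
  qed
  then have "bdry d (A \<union> B) b y = c y" if "y \<in> A \<union> B" for y
    using that onB by (auto simp: e_def)
  then show "\<exists>b. supported gr (A \<union> B) (g + 2) b \<and> (\<forall>y\<in>A \<union> B. bdry d (A \<union> B) b y = c y)"
    using sb by blast
qed

text \<open>The component from \<open>A\<close> to \<open>B\<close> of the vanishing square. Thus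
  the block is itself a chain map up to sign, and exactness passes between \<open>A\<close> and
  \<open>B\<close>.\<close>

lemma d_phi:
  assumes x: "x \<in> A" and y: "y \<in> A"
  shows "d x y * d y (\<phi> y) = - 1 * d x (\<phi> x) * d (\<phi> x) (\<phi> y)"
proof -
  have "(\<Sum>z\<in>A \<union> B. d x z * d z (\<phi> y)) = 0"
    using cx x im[OF y] by (simp add: graded_complex_def)
  moreover have "(\<Sum>z\<in>A. d x z * d z (\<phi> y)) = (\<Sum>z\<in>A. if z = y then d x y * d y (\<phi> y) else 0)"
    by (rule sum.cong) (use d_off y in auto)
  moreover have "(\<Sum>z\<in>B. d x z * d z (\<phi> y)) = (\<Sum>z\<in>B. if z = \<phi> x then d x (\<phi> x) * d (\<phi> x) (\<phi> y) else 0)"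
    by (rule sum.cong) (use d_iff x in auto)
  ultimately show ?thesis
    using x y im fin disj by (simp add: sum.union_disjoint)
qed

lemma exact_target:
  assumes "exact_at d gr A (g + 2)" shows "exact_at d gr B g"
proof -
  have "exact_at d gr B (g + 2 + - 2)"
  proof (rule exact_at_transfer[OF bij _ _ d_phi _ assms])
    show "d x (\<phi> x) \<noteq> 0" if "x \<in> A" for x using d_iff im that by blast
  qed (simp_all add: gr_phi)
  then show ?thesis by simp
qed

lemma exact_source:
  assumes "exact_at d gr B g" shows "exact_at d gr A (g + 2)"
proof -
  let ?i = "inv_into A \<phi>"
  have i: "?i y \<in> A" "\<phi> (?i y) = y" if "y \<in> B" for y
    using bij that by (auto simp: bij_betw_def inv_into_into f_inv_into_f)
  show ?thesis
  proof (rule exact_at_transfer[OF bij_betw_inv_into[OF bij] _ _ _ _ assms,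
        where w = "\<lambda>y. 1 / d (?i y) y" and k = "- 1"])
    fix x y assume x: "x \<in> B" and y: "y \<in> B"
    show "1 / d (?i x) x \<noteq> 0" using d_iff[OF i(1)[OF x] x] i(2)[OF x] by simp
    have nz: "d (?i x) x \<noteq> 0" "d (?i y) y \<noteq> 0"
      using d_iff[OF i(1)[OF x] x] i(2)[OF x] d_iff[OF i(1)[OF y] y] i(2)[OF y] by auto
    show "d x y * (1 / d (?i y) y) = - 1 * (1 / d (?i x) x) * d (?i x) (?i y)"
      using d_phi[OF i(1)[OF x] i(1)[OF y]] i(2)[OF x] i(2)[OF y] nz by (simp add: field_simps)
    show "gr (?i x) = gr x + 2" using gr_phi[OF i(1)[OF x]] i(2)[OF x] by simp
  qed simp
qed

end


section \<open>Resolutions of link diagrams\<close>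

text \<open>The two degree conditions make every point the start of exactly one strand piece and the
  end of exactly one. There are no loose ends, and this feeds the parity count in
  \<open>even_corners\<close>.\<close>

locale link_diagram =
  fixes D :: "'a diagram"
  assumes finite_points: "finite (points D)"
    and joins_points: "joins D \<subseteq> points D \<times> points D"
    and corners_points: "c \<in> set (crossings D) \<Longrightarrow> {sw c, se c, nw c, ne c} \<subseteq> points D"
    and out_degree: "x \<in> points D \<Longrightarrow> card {y. (x, y) \<in> joins D} +
      (\<Sum>r<n_crossings D. of_bool (sw (crossings D ! r) = x) + of_bool (se (crossings D ! r) = x)) = 1"
    and in_degree: "x \<in> points D \<Longrightarrow> card {y. (y, x) \<in> joins D} +
      (\<Sum>r<n_crossings D. of_bool (nw (crossings D ! r) = x) + of_bool (ne (crossings D ! r) = x)) = 1"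
begin

abbreviation "E \<equiv> {..<n_crossings D}"

definition south :: "nat \<Rightarrow> 'a" where
  "south r = sw (crossings D ! r)"

definition north :: "nat \<Rightarrow> 'a" where
  "north r = ne (crossings D ! r)"

text \<open>Uniformly in the sign of the crossing and in the smoothing \<open>b\<close>, the two arcs of the smoothing
  start at \<open>south r\<close> and at \<open>far r b\<close>; the former ends at \<open>far r (\<not> b)\<close>.\<close>

definition far :: "nat \<Rightarrow> bool \<Rightarrow> 'a" where
  "far r b = (if positive (crossings D ! r) = b then nw (crossings D ! r) else se (crossings D ! r))"

definition arcs :: "nat \<Rightarrow> bool \<Rightarrow> ('a \<times> 'a) set" where
  "arcs r b = {(south r, far r (\<not> b)), (far r b, north r)}"

definition corners :: "nat \<Rightarrow> 'a set" where
  "corners r = {south r, north r, far r True, far r False}"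

text \<open>Partially resolved diagrams: \<open>\<sigma> r\<close> is the set of the smoothings still allowed at \<open>r\<close>, and \<open>UNIV\<close>
  means that \<open>r\<close> is left as a crossing.\<close>

definition Rel :: "(nat \<Rightarrow> bool set) \<Rightarrow> ('a \<times> 'a) set" where
  "Rel \<sigma> = joins D \<union> (\<Union>r\<in>E. \<Union>b\<in>\<sigma> r. arcs r b)"

abbreviation Con :: "(nat \<Rightarrow> bool set) \<Rightarrow> ('a \<times> 'a) set" where
  "Con \<sigma> \<equiv> conn (Rel \<sigma>)"

text \<open>For \<open>A \<subseteq> B\<close> one set literal yields all three cases:
  \<open>{True}\<close> on \<open>A\<close>, \<open>{False}\<close> off \<open>B\<close>, and
  \<open>UNIV\<close> on \<open>B - A\<close>. So the crossings of \<open>B - A\<close> are the free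
  directions of a face of the cube.\<close>

definition face :: "nat set \<Rightarrow> nat set \<Rightarrow> nat \<Rightarrow> bool set" where
  "face A B r = {r \<in> A, r \<in> B}"

abbreviation vertex :: "nat set \<Rightarrow> nat \<Rightarrow> bool set" where
  "vertex S \<equiv> face S S"

lemma vertex_eq: "vertex S r = {r \<in> S}"
  by (simp add: face_def)

lemma far_in_corners: "far r b \<in> corners r"
  by (cases b) (simp_all add: corners_def)

lemma corners_subset: "r \<in> E \<Longrightarrow> corners r \<subseteq> points D"
  using corners_points[of "crossings D ! r"]
  by (auto simp: corners_def south_def north_def far_def n_crossings_def)

lemma smoothing_arcs: "{fst (smoothing (crossings D ! r) b), snd (smoothing (crossings D ! r) b)} = arcs r b"
  by (auto simp: smoothing_def arcs_def south_def north_def far_def)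

lemma resolution_rel_eq: "resolution_rel D S = Rel (vertex S)"
  unfolding resolution_rel_def Rel_def smoothing_arcs vertex_eq by auto

lemma circle_of_eq: "circle_of D S x = Con (vertex S) `` {x}"
  by (simp add: circle_of_def conn_def resolution_rel_eq)

lemma circle_of_eq_iff: "circle_of D S x = circle_of D S y \<longleftrightarrow> (x, y) \<in> Con (vertex S)"
  by (simp add: circle_of_eq conn_class_eq)

lemma circles_eq: "circles D S = comps (Rel (vertex S)) (points D)"
  by (simp add: circles_def comps_def circle_of_eq)

lemma Rel_points: "Rel \<sigma> \<subseteq> points D \<times> points D"
proof -
  have "arcs r b \<subseteq> points D \<times> points D" if "r \<in> E" for r b
    using corners_subset[OF that] far_in_corners[of r b] far_in_corners[of r "\<not> b"]
    by (auto simp: arcs_def corners_def)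
  then show ?thesis unfolding Rel_def using joins_points by blast
qed

lemma Con_points: "(x, y) \<in> Con \<sigma> \<Longrightarrow> x \<in> points D \<Longrightarrow> y \<in> points D"
  by (erule conn_closed) (use Rel_points in auto)

lemma finite_circles: "finite (circles D S)"
  by (simp add: circles_def finite_points)

lemma Rel_mono: "(\<And>r. r \<in> E \<Longrightarrow> \<sigma> r \<subseteq> \<tau> r) \<Longrightarrow> Rel \<sigma> \<subseteq> Rel \<tau>"
  unfolding Rel_def by blast

lemma Con_mono: "(\<And>r. r \<in> E \<Longrightarrow> \<sigma> r \<subseteq> \<tau> r) \<Longrightarrow> Con \<sigma> \<subseteq> Con \<tau>"
  by (intro conn_mono Rel_mono)

lemma arcs_Rel: "r \<in> E \<Longrightarrow> b \<in> \<sigma> r \<Longrightarrow> arcs r b \<subseteq> Rel \<sigma>"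
  unfolding Rel_def by blast

lemma Rel_upd:
  "r \<in> E \<Longrightarrow> Rel (\<sigma>(r := T)) = Rel (\<sigma>(r := {})) \<union> (\<Union>b\<in>T. arcs r b)"
proof -
  assume r: "r \<in> E"
  have *: "Rel \<tau> = (\<Union>b\<in>\<tau> r. arcs r b) \<union> (joins D \<union> (\<Union>r'\<in>E - {r}. \<Union>b\<in>\<tau> r'. arcs r' b))" for \<tau>
    unfolding Rel_def using r by blast
  show ?thesis unfolding *[of "\<sigma>(r := T)"] *[of "\<sigma>(r := {})"] by auto
qed

text \<open>A handshake argument: every point has degree two, a join has both ends in
  \<open>K\<close> or none, and at every other crossing an allowed smoothing pairs the corners.
  Everything but \<open>r\<close> contributes an even number, hence so does
  \<open>r\<close>.\<close>

lemma even_corners: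
  assumes K: "K \<subseteq> points D" and closed: "\<And>x y. (x, y) \<in> Rel \<sigma> \<Longrightarrow> x \<in> K \<longleftrightarrow> y \<in> K"
    and r: "r \<in> E" and full: "\<And>r'. r' \<in> E \<Longrightarrow> r' \<noteq> r \<Longrightarrow> \<sigma> r' \<noteq> {}"
  shows "even (of_bool (south r \<in> K) + of_bool (north r \<in> K) + of_bool (far r True \<in> K) +
    of_bool (far r False \<in> K) :: nat)"
proof -
  define k :: "nat \<Rightarrow> nat" where "k = (\<lambda>r. of_bool (south r \<in> K) + of_bool (north r \<in> K) +
     of_bool (far r True \<in> K) + of_bool (far r False \<in> K))"
  have finK: "finite K" using K finite_points by (rule finite_subset)
  have finJ: "finite (joins D)"
    using joins_points finite_points by (meson finite_SigmaI finite_subset)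
  have count: "(\<Sum>x\<in>K. of_bool (z = x)) = (of_bool (z \<in> K) :: nat)" for z
    using finK by (simp only: of_bool_def sum.delta')
  have jo: "(\<Sum>x\<in>K. card {y. (x, y) \<in> joins D}) = card {e \<in> joins D. fst e \<in> K}"
  proof -
    have "{e \<in> joins D. fst e \<in> K} = (SIGMA x:K. {y. (x, y) \<in> joins D})" by auto
    moreover have "finite {y. (x, y) \<in> joins D}" for x
      by (rule finite_subset[OF _ finite_imageI[OF finJ, of snd]]) force
    ultimately show ?thesis using finK by simp
  qed
  have ji: "(\<Sum>x\<in>K. card {y. (y, x) \<in> joins D}) = card {e \<in> joins D. snd e \<in> K}"
  proof -
    have "bij_betw prod.swap (SIGMA x:K. {y. (y, x) \<in> joins D}) {e \<in> joins D. snd e \<in> K}"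
      by (rule bij_betw_byWitness[of _ prod.swap]) auto
    then have "card (SIGMA x:K. {y. (y, x) \<in> joins D}) = card {e \<in> joins D. snd e \<in> K}"
      by (rule bij_betw_same_card)
    moreover have "finite {y. (y, x) \<in> joins D}" for x
      by (rule finite_subset[OF _ finite_imageI[OF finJ, of fst]]) force
    ultimately show ?thesis using finK by simp
  qed
  have jj: "card {e \<in> joins D. fst e \<in> K} = card {e \<in> joins D. snd e \<in> K}"
  proof -
    have "joins D \<subseteq> Rel \<sigma>" by (auto simp: Rel_def)
    then have "fst e \<in> K \<longleftrightarrow> snd e \<in> K" if "e \<in> joins D" for e
      using closed[of "fst e" "snd e"] that by auto
    then have "{e \<in> joins D. fst e \<in> K} = {e \<in> joins D. snd e \<in> K}" by blast
    then show ?thesis by simp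
  qed
  have "2 * card K = (\<Sum>x\<in>K. card {y. (x, y) \<in> joins D} +
      (\<Sum>r\<in>E. of_bool (sw (crossings D ! r) = x) + of_bool (se (crossings D ! r) = x)) +
      (card {y. (y, x) \<in> joins D} +
      (\<Sum>r\<in>E. of_bool (nw (crossings D ! r) = x) + of_bool (ne (crossings D ! r) = x))))"
    (is "_ = sum ?deg K")
  proof -
    have "?deg x = 2" if "x \<in> K" for x
      using out_degree[OF subsetD[OF K that]] in_degree[OF subsetD[OF K that]] by linarith
    then have "sum ?deg K = (\<Sum>x\<in>K. 2)" by (rule sum.cong[OF refl])
    then show ?thesis by simp
  qed
  also have "\<dots> = 2 * card {e \<in> joins D. fst e \<in> K} +
      (\<Sum>x\<in>K. \<Sum>r\<in>E. of_bool (south r = x) + of_bool (north r = x) + of_bool (far r True = x) + of_bool (far r False = x))"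
  proof -
    \<comment> \<open>\<open>far r True\<close> and \<open>far r False\<close> are the corners
      \<open>nw\<close> and \<open>se\<close> in some order.\<close>
    have far: "of_bool (far r True = x) + of_bool (far r False = x) =
        (of_bool (nw (crossings D ! r) = x) + of_bool (se (crossings D ! r) = x) :: nat)" for r x
      by (simp add: far_def)
    show ?thesis
      unfolding add.assoc far unfolding sum.distrib jo ji
      by (simp add: jj south_def north_def del: sum_of_bool_eq)
  qed
  also have "\<dots> = 2 * card {e \<in> joins D. fst e \<in> K} + (\<Sum>r\<in>E. k r)"
    unfolding k_def sum.distrib sum.swap[of _ E K] count by (rule refl)
  finally have "2 * card K = 2 * card {e \<in> joins D. fst e \<in> K} + (\<Sum>r\<in>E. k r)" .
  then have "even (2 * card {e \<in> joins D. fst e \<in> K} + (\<Sum>r\<in>E. k r))" by (metis dvd_triv_left)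
  then have "even (\<Sum>r\<in>E. k r)" by simp
  moreover have "(\<Sum>r\<in>E. k r) = k r + (\<Sum>r'\<in>E - {r}. k r')" using r by (simp add: sum.remove)
  moreover have "even (\<Sum>r'\<in>E - {r}. k r')"
  proof (rule dvd_sum)
    fix r' assume r': "r' \<in> E - {r}"
    then have "\<sigma> r' \<noteq> {}" using full by simp
    then obtain b where "b \<in> \<sigma> r'" by blast
    then have "arcs r' b \<subseteq> Rel \<sigma>" using r' by (intro arcs_Rel) auto
    then have "south r' \<in> K \<longleftrightarrow> far r' (\<not> b) \<in> K" "far r' b \<in> K \<longleftrightarrow> north r' \<in> K"
      using closed[of "south r'" "far r' (\<not> b)"] closed[of "far r' b" "north r'"]
      by (simp_all add: arcs_def)
    then show "even (k r')" by (cases b) (auto simp: k_def)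
  qed
  ultimately show ?thesis by (simp add: k_def)
qed

text \<open>If the smoothing \<open>b\<close> puts the two arcs of \<open>r\<close> on different components, then each of them is
  already closed up by the rest of the diagram: a component containing just one loose end of \<open>r\<close>
  would violate parity.\<close>

lemma far_connected:
  assumes r: "r \<in> E" and full: "\<And>r'. r' \<in> E \<Longrightarrow> r' \<noteq> r \<Longrightarrow> \<sigma> r' \<noteq> {}"
    and sep: "(south r, far r b) \<notin> Con (\<sigma>(r := {b}))"
  shows "(south r, far r (\<not> b)) \<in> Con (\<sigma>(r := {}))" "(far r b, north r) \<in> Con (\<sigma>(r := {}))"
proof -
  let ?\<tau> = "\<sigma>(r := {})"
  have le: "Con ?\<tau> \<subseteq> Con (\<sigma>(r := {b}))" by (rule Con_mono) auto
  have arc: "(far r b, north r) \<in> Con (\<sigma>(r := {b}))" "(south r, far r (\<not> b)) \<in> Con (\<sigma>(r := {b}))"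
    using arcs_Rel[OF r, of b "\<sigma>(r := {b})"] by (auto simp: arcs_def intro: conn_base)
  have ev: "even (of_bool ((x, south r) \<in> Con ?\<tau>) + of_bool ((x, north r) \<in> Con ?\<tau>) +
      of_bool ((x, far r True) \<in> Con ?\<tau>) + of_bool ((x, far r False) \<in> Con ?\<tau>) :: nat)"
    if "x \<in> points D" for x
  proof -
    have "even (of_bool (south r \<in> Con ?\<tau> `` {x}) + of_bool (north r \<in> Con ?\<tau> `` {x}) +
      of_bool (far r True \<in> Con ?\<tau> `` {x}) + of_bool (far r False \<in> Con ?\<tau> `` {x}) :: nat)"
    proof (rule even_corners[OF _ _ r])
      show "Con ?\<tau> `` {x} \<subseteq> points D" using Con_points that by blast
      show "u \<in> Con ?\<tau> `` {x} \<longleftrightarrow> v \<in> Con ?\<tau> `` {x}" if "(u, v) \<in> Rel ?\<tau>" for u v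
        using conn_base[OF that] by (auto intro: conn_trans conn_sym)
    qed (use full in auto)
    then show ?thesis by simp
  qed
  have p: "south r \<in> points D" "far r b \<in> points D"
    using corners_subset[OF r] far_in_corners[of r b] by (auto simp: corners_def)
  \<comment> \<open>By parity the component of \<open>south r\<close> contains a further corner, and
    separation rules out all but \<open>far r (\<not> b)\<close>. Seen from \<open>far r b\<close>,
    only \<open>north r\<close> is left.\<close>
  have 1: "(south r, far r b) \<notin> Con ?\<tau>" "(far r b, south r) \<notin> Con ?\<tau>"
    using sep le conn_sym[of "far r b" "south r"] by blast+
  have 2: "(south r, north r) \<notin> Con ?\<tau>"
    using sep le conn_trans[OF _ conn_sym[OF arc(1)]] by blast
  have 3: "(far r b, far r (\<not> b)) \<notin> Con ?\<tau>"
    using sep le conn_trans[OF arc(2) conn_sym] by blast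
  show "(south r, far r (\<not> b)) \<in> Con ?\<tau>" using ev[OF p(1)] 1 2 by (cases b) auto
  show "(far r b, north r) \<in> Con ?\<tau>" using ev[OF p(2)] 1 3 by (cases b) auto
qed

text \<open>By \<open>far_connected\<close> the ends of the old arcs stay connected without
  \<open>r\<close>, so exchanging the smoothing only adds a connection between the two
  components.\<close>

lemma Con_switch:
  assumes r: "r \<in> E" and full: "\<And>r'. r' \<in> E \<Longrightarrow> r' \<noteq> r \<Longrightarrow> \<sigma> r' \<noteq> {}"
    and sep: "(south r, far r b) \<notin> Con (\<sigma>(r := {b}))"
  shows "Con (\<sigma>(r := {\<not> b})) = conn (insert (south r, far r b) (Rel (\<sigma>(r := {b}))))" (is "_ = conn ?R")
proof (rule conn_eqI)
  have le: "Con (\<sigma>(r := {})) \<subseteq> Con (\<sigma>(r := {\<not> b}))" "Con (\<sigma>(r := {})) \<subseteq> conn ?R"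
  proof -
    show "Con (\<sigma>(r := {})) \<subseteq> Con (\<sigma>(r := {\<not> b}))" by (rule Con_mono) auto
    show "Con (\<sigma>(r := {})) \<subseteq> conn ?R"
      using Rel_upd[OF r, of \<sigma> "{b}"] by (intro conn_mono) auto
  qed
  have sub: "Rel (\<sigma>(r := {})) \<subseteq> Con (\<sigma>(r := {}))" by (auto intro: conn_base)
  note fc = far_connected[OF r full sep]
  have base: "(south r, far r b) \<in> conn ?R" by (rule conn_base) simp
  have base2: "(south r, far r b) \<in> Con (\<sigma>(r := {\<not> b}))"
    using arcs_Rel[OF r, of "\<not> b" "\<sigma>(r := {\<not> b})"] by (auto simp: arcs_def intro: conn_base)
  have "(far r (\<not> b), north r) \<in> conn ?R"
    using conn_trans[OF conn_trans[OF conn_sym base]] subsetD[OF le(2) fc(1)] subsetD[OF le(2) fc(2)]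
    by blast
  then have "arcs r (\<not> b) \<subseteq> conn ?R" using base by (simp add: arcs_def)
  then show "Rel (\<sigma>(r := {\<not> b})) \<subseteq> conn ?R"
    using le(2) sub by (subst Rel_upd[OF r]) auto
  have "arcs r b \<subseteq> Con (\<sigma>(r := {\<not> b}))" using fc le(1) by (auto simp: arcs_def)
  then show "?R \<subseteq> Con (\<sigma>(r := {\<not> b}))"
    using base2 le(1) sub by (subst Rel_upd[OF r]) auto
qed

text \<open>The two smoothings cannot both put their arcs on different components; this is one half
  of the dichotomy between merging and splitting.\<close>

lemma switch_connected:
  assumes "r \<in> E" "\<And>r'. r' \<in> E \<Longrightarrow> r' \<noteq> r \<Longrightarrow> \<sigma> r' \<noteq> {}"
    and "(south r, far r b) \<notin> Con (\<sigma>(r := {b}))"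
  shows "(south r, far r (\<not> b)) \<in> Con (\<sigma>(r := {\<not> b}))"
proof -
  have "Con (\<sigma>(r := {})) \<subseteq> Con (\<sigma>(r := {\<not> b}))" by (rule Con_mono) auto
  then show ?thesis using far_connected(1)[OF assms] by blast
qed

lemma vertex_upd: "(vertex S)(r := {b}) = vertex (if b then insert r S else S - {r})"
  by (auto simp: face_def fun_eq_iff)

section \<open>Component counts of partially resolved diagrams\<close>

definition ncomp :: "(nat \<Rightarrow> bool set) \<Rightarrow> int" where
  "ncomp \<sigma> = int (card (comps (Rel \<sigma>) (points D)))"

text \<open>An unresolved crossing connects all four corners, which is the same as smoothing it and
  gluing the two arcs together. Free crossings thus act as the edges of a graph.\<close>

lemma Con_free:
  assumes r: "r \<in> E"
  shows "Con (\<sigma>(r := UNIV)) = conn (insert (south r, far r b) (Rel (\<sigma>(r := {b}))))" (is "_ = conn ?R")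
proof (rule conn_eqI)
  have R: "Rel (\<sigma>(r := UNIV)) = Rel (\<sigma>(r := {b})) \<union> arcs r (\<not> b)"
    unfolding Rel_upd[OF r, of _ UNIV] Rel_upd[OF r, of _ "{b}"] by (cases b) (auto simp: UNIV_bool)
  have sub: "Rel (\<sigma>(r := {b})) \<subseteq> conn ?R" by (auto intro: conn_base)
  have "(south r, far r b) \<in> conn ?R" by (rule conn_base) simp
  moreover have "(far r b, north r) \<in> conn ?R" "(south r, far r (\<not> b)) \<in> conn ?R"
    using arcs_Rel[OF r, of b "\<sigma>(r := {b})"] sub by (auto simp: arcs_def)
  ultimately have "arcs r (\<not> b) \<subseteq> conn ?R"
    by (auto simp: arcs_def intro: conn_trans conn_sym)
  then show "Rel (\<sigma>(r := UNIV)) \<subseteq> conn ?R" using R sub by auto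
  show "?R \<subseteq> Con (\<sigma>(r := UNIV))" using R by (auto simp: arcs_def intro: conn_base)
qed

lemma ncomp_free:
  assumes "r \<in> E"
  shows "ncomp (\<sigma>(r := {b})) \<le> ncomp (\<sigma>(r := UNIV)) + 1"
    and "(south r, far r b) \<in> Con (\<sigma>(r := {b})) \<Longrightarrow> ncomp (\<sigma>(r := UNIV)) = ncomp (\<sigma>(r := {b}))"
proof -
  have eq: "comps (Rel (\<sigma>(r := UNIV))) (points D) =
      comps (insert (south r, far r b) (Rel (\<sigma>(r := {b})))) (points D)"
    by (simp add: comps_def Con_free[OF assms, of \<sigma> b])
  show "ncomp (\<sigma>(r := {b})) \<le> ncomp (\<sigma>(r := UNIV)) + 1"
    using card_comps_insert[OF finite_points, of "Rel (\<sigma>(r := {b}))" "south r" "far r b"]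
    unfolding ncomp_def eq by linarith
  assume "(south r, far r b) \<in> Con (\<sigma>(r := {b}))"
  then have "conn (insert (south r, far r b) (Rel (\<sigma>(r := {b})))) = Con (\<sigma>(r := {b}))"
    by (intro conn_eqI) (auto intro: conn_base)
  then show "ncomp (\<sigma>(r := UNIV)) = ncomp (\<sigma>(r := {b}))"
    unfolding ncomp_def eq by (simp add: comps_def)
qed

end

text \<open>The last condition says that the Turaev genus is zero, as for every connected alternating
  diagram; it then holds with equality.\<close>

locale alternating_diagram = link_diagram +
  assumes connected: "x \<in> points D \<Longrightarrow> y \<in> points D \<Longrightarrow> (x, y) \<in> Con (face {} E)"
    and turaev: "n_crossings D + 2 \<le> card (circles D {}) + card (circles D E)"
begin

lemma points_nonempty: "points D \<noteq> {}"
  using turaev by (auto simp: circles_def)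

lemma ncomp_one:
  assumes "\<And>x y. x \<in> points D \<Longrightarrow> y \<in> points D \<Longrightarrow> (x, y) \<in> Con \<sigma>"
  shows "ncomp \<sigma> = 1"
proof -
  obtain x where x: "x \<in> points D" using points_nonempty by auto
  then have "comps (Rel \<sigma>) (points D) = {Con \<sigma> `` {x}}"
    using assms unfolding comps_def by (auto simp: image_iff intro: conn_trans conn_sym)
  then show ?thesis by (simp add: ncomp_def)
qed

text \<open>For the checkerboard graph \<open>G\<close> with the circles of the vertex \<open>{}\<close> as vertices and the crossings
  as edges, \<open>ncomp (face {} S)\<close> counts the components of the spanning subgraph \<open>S\<close>, and
  \<open>ncomp (face S E)\<close> those of the complementary subgraph of the dual graph.\<close>

definition rank :: "nat set \<Rightarrow> int" where
  "rank S = ncomp (face S E) - ncomp (face {} S)"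

lemma face_free:
  assumes "r \<in> E" "r \<notin> S"
  shows "face {} (insert r S) = (face {} S)(r := UNIV)" "face {} S = (face {} S)(r := {False})"
    "face S E = (face S E)(r := UNIV)" "face (insert r S) E = (face S E)(r := {True})"
  using assms by (auto simp: face_def fun_eq_iff UNIV_bool)

text \<open>Inserting \<open>r\<close> lowers \<open>ncomp (face {} S)\<close> only if the
  0-smoothed arcs are separated, and raises \<open>ncomp (face S E)\<close> only if the 1-smoothed
  arcs are, each time by at most one. By \<open>switch_connected\<close> the two cannot occur
  together.\<close>

lemma rank_insert:
  assumes r: "r \<in> E" "r \<notin> S" and S: "S \<subseteq> E"
  shows "rank (insert r S) \<le> rank S + 1"
    and "rank (insert r S) = rank S + 1 \<Longrightarrow>
      (south r, far r False) \<notin> Con (vertex S) \<or> (south r, far r True) \<notin> Con (vertex (insert r S))"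
proof -
  note f = face_free[OF r]
  have le0: "Con (vertex S) \<subseteq> Con (face {} S)" by (rule Con_mono) (auto simp: face_def)
  have le1: "Con (vertex (insert r S)) \<subseteq> Con (face (insert r S) E)"
    by (rule Con_mono) (auto simp: face_def)
  have c0: "ncomp (face {} S) \<le> ncomp (face {} (insert r S)) + 1"
    using ncomp_free(1)[OF r(1), where \<sigma> = "face {} S" and b = False] f by simp
  have c0': "ncomp (face {} S) = ncomp (face {} (insert r S))"
    if "(south r, far r False) \<in> Con (vertex S)"
    using ncomp_free(2)[OF r(1), where \<sigma> = "face {} S" and b = False] f that le0 by auto
  have c1: "ncomp (face (insert r S) E) \<le> ncomp (face S E) + 1"
    using ncomp_free(1)[OF r(1), where \<sigma> = "face S E" and b = True] f by simp
  have c1': "ncomp (face (insert r S) E) = ncomp (face S E)"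
    if "(south r, far r True) \<in> Con (vertex (insert r S))"
    using ncomp_free(2)[OF r(1), where \<sigma> = "face S E" and b = True] f that le1 by auto
  have "(south r, far r False) \<in> Con (vertex S) \<or> (south r, far r True) \<in> Con (vertex (insert r S))"
    using switch_connected[OF r(1), of "vertex S" False] r(2) by (auto simp: vertex_upd face_def)
  then show "rank (insert r S) \<le> rank S + 1" using c0 c0' c1 c1' by (auto simp: rank_def)
  show "(south r, far r False) \<notin> Con (vertex S) \<or> (south r, far r True) \<notin> Con (vertex (insert r S))"
    if "rank (insert r S) = rank S + 1"
    using that c0' c1' by (auto simp: rank_def)
qed

lemma rank_growth:
  assumes "S \<subseteq> S'" "S' \<subseteq> E"
  shows "rank S' \<le> rank S + int (card (S' - S))"
proof -
  have "rank (S \<union> F) \<le> rank S + int (card F)" if "finite F" "F \<inter> S = {}" "S \<union> F \<subseteq> E" for F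
    using that
  proof (induction F rule: finite_induct)
    case (insert r F)
    then have "rank (insert r (S \<union> F)) \<le> rank (S \<union> F) + 1"
      by (intro rank_insert(1)) auto
    then show ?case using insert by simp
  qed simp
  moreover have "finite (S' - S)" "S \<union> (S' - S) = S'"
    using assms finite_subset by blast+
  ultimately show ?thesis using assms(2) by (metis Diff_disjoint inf_commute)
qed

abbreviation "V \<equiv> int (card (circles D {}))"

lemma ncomp_vertex: "ncomp (vertex S) = int (card (circles D S))"
  by (simp add: ncomp_def circles_eq)

text \<open>\<open>rank\<close> starts at \<open>1 - V\<close>, the Turaev bound puts it at
  \<open>n_crossings D + 1 - V\<close> or more on \<open>E\<close>, and each crossing adds at most
  one; so each adds exactly one.\<close>

lemma rank_eq:
  assumes "S \<subseteq> E" shows "rank S = int (card S) + 1 - V"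
proof -
  have 1: "ncomp (face {} E) = 1" using connected by (rule ncomp_one)
  have "rank E \<ge> int (n_crossings D) + 1 - V"
    using turaev 1 by (simp add: rank_def ncomp_vertex)
  moreover have "rank {} = 1 - V" using 1 by (simp add: rank_def ncomp_vertex)
  moreover have "rank S \<le> rank {} + int (card S)" using rank_growth[of "{}" S] assms by simp
  moreover have "rank E \<le> rank S + int (card (E - S))" using rank_growth[of S E] assms by simp
  moreover have "card (E - S) = n_crossings D - card S" "card S \<le> n_crossings D"
    using assms card_Diff_subset[of S E] card_mono[of E S] finite_subset[OF assms] by auto
  ultimately show ?thesis by auto
qed

text \<open>As \<open>rank\<close> grows by exactly one, \<open>rank_insert\<close> yields a
  separation at one end of the edge, and \<open>switch_connected\<close> excludes it at both. This
  is the consequence of planarity that the complex needs.\<close>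

lemma merge_or_split:
  assumes "S \<subseteq> E" "r \<in> E" "r \<notin> S"
  shows "(south r, far r False) \<notin> Con (vertex S) \<longleftrightarrow> (south r, far r True) \<in> Con (vertex (insert r S))"
proof -
  have "rank (insert r S) = rank S + 1"
    using rank_eq assms finite_subset[OF assms(1)] by simp
  then show ?thesis
    using rank_insert(2)[of r S] assms switch_connected[of r "vertex S" False]
    by (auto simp: vertex_upd face_def)
qed

text \<open>With one circle, both the subgraph \<open>S\<close> and its dual complement are
  connected, so \<open>rank S\<close> is zero.\<close>

lemma single_circle:
  assumes "S \<subseteq> E" "\<And>x y. x \<in> points D \<Longrightarrow> y \<in> points D \<Longrightarrow> (x, y) \<in> Con (vertex S)"
  shows "int (card S) = V - 1"
proof -
  have "Con (vertex S) \<subseteq> Con (face {} S)" "Con (vertex S) \<subseteq> Con (face S E)"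
    using assms(1) by (auto intro!: Con_mono simp: face_def)
  then have "ncomp (face {} S) = 1" "ncomp (face S E) = 1"
    using assms(2) by (auto intro!: ncomp_one)
  then show ?thesis using rank_eq[OF assms(1)] by (simp add: rank_def)
qed

end


section \<open>The Khovanov differential\<close>

lemma m_coeff_degree: "m_coeff a b c \<noteq> 0 \<Longrightarrow> vdeg c = vdeg a + vdeg b - 1"
  by (cases a; cases b; cases c) auto

lemma Delta_coeff_degree: "Delta_coeff a b c \<noteq> 0 \<Longrightarrow> vdeg b + vdeg c = vdeg a - 1"
  by (cases a; cases b; cases c) auto

definition edge_sign :: "nat set \<Rightarrow> nat \<Rightarrow> rat" where
  "edge_sign S r = (- 1) ^ card {s \<in> S. s < r}"

lemma edge_sign_nonzero: "edge_sign S r \<noteq> 0"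
  by (simp add: edge_sign_def)

text \<open>Inserting the smaller index flips the sign at the larger one; inserting the larger one
  changes nothing.\<close>

lemma edge_sign_anticommute:
  assumes "finite S" "r \<notin> S" "s \<notin> S" "r \<noteq> s"
  shows "edge_sign S r * edge_sign (insert r S) s = - (edge_sign S s * edge_sign (insert s S) r)"
proof -
  have *: "edge_sign (insert r S) s = - edge_sign S s" "edge_sign (insert s S) r = edge_sign S r"
    if "finite S" "r \<notin> S" "r < s" for r s :: nat
  proof -
    have "{t \<in> insert r S. t < s} = insert r {t \<in> S. t < s}" "{t \<in> insert s S. t < r} = {t \<in> S. t < r}"
      using that by auto
    then show "edge_sign (insert r S) s = - edge_sign S s" "edge_sign (insert s S) r = edge_sign S r"
      using that by (simp_all add: edge_sign_def)
  qed
  show ?thesis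
    using *[of r s] *[of s r] assms by (cases r s rule: linorder_cases) auto
qed

context link_diagram
begin

abbreviation circ :: "nat set \<Rightarrow> 'a \<Rightarrow> 'a set" where
  "circ S x \<equiv> circle_of D S x"

abbreviation labels :: "nat set \<Rightarrow> ('a set \<Rightarrow> vlabel) set" where
  "labels S \<equiv> circles D S \<rightarrow>\<^sub>E UNIV"

abbreviation merging :: "nat set \<Rightarrow> nat \<Rightarrow> bool" where
  "merging S r \<equiv> circ S (south r) \<noteq> circ S (far r False)"

lemma self_in_circ: "x \<in> circ S x"
  by (simp add: circle_of_eq)

lemma circ_in_circles: "x \<in> points D \<Longrightarrow> circ S x \<in> circles D S"
  by (simp add: circles_def)

lemma circ_eqI: "x \<in> C \<Longrightarrow> C \<in> circles D S \<Longrightarrow> circ S x = C"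
  unfolding circles_def by (auto simp: circle_of_eq conn_class_eq intro: conn_sym conn_trans)

lemma circles_disjoint: "C \<in> circles D S \<Longrightarrow> C' \<in> circles D S \<Longrightarrow> x \<in> C \<Longrightarrow> x \<in> C' \<Longrightarrow> C = C'"
  using circ_eqI by metis

lemma circles_nonempty: "C \<in> circles D S \<Longrightarrow> C \<noteq> {}"
  unfolding circles_def using self_in_circ by blast

lemma corner_points:
  assumes "r \<in> E" shows "south r \<in> points D" "far r b \<in> points D" "north r \<in> points D"
  using corners_subset[OF assms] far_in_corners[of r b] by (auto simp: corners_def)

text \<open>No direction in the cube is built in: a split along an edge is \<open>merge\<close> from
  its upper to its lower vertex, so both cases share one description of the circles.\<close>

definition merge :: "nat set \<Rightarrow> nat set \<Rightarrow> 'a set \<Rightarrow> 'a set \<Rightarrow> bool" where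
  "merge T T' a b \<longleftrightarrow> a \<in> circles D T \<and> b \<in> circles D T \<and> a \<noteq> b \<and>
     circles D T' = insert (a \<union> b) (circles D T - {a, b}) \<and>
     (\<forall>x. circ T' x = (if x \<in> a \<union> b then a \<union> b else circ T x))"

lemma mergeD:
  assumes "merge T T' a b"
  shows "a \<in> circles D T" "b \<in> circles D T" "a \<noteq> b"
    and "circles D T' = insert (a \<union> b) (circles D T - {a, b})"
    and "circ T' x = (if x \<in> a \<union> b then a \<union> b else circ T x)"
  using assms by (simp_all add: merge_def)

lemma merge_union_notin:
  assumes "merge T T' a b" shows "a \<union> b \<notin> circles D T"
proof
  assume *: "a \<union> b \<in> circles D T"
  obtain x where "x \<in> a" using mergeD(1)[OF assms] circles_nonempty by blast
  then have "a = a \<union> b" using circles_disjoint[OF mergeD(1)[OF assms] *] by simp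
  moreover obtain y where "y \<in> b" using mergeD(2)[OF assms] circles_nonempty by blast
  then have "b = a \<union> b" using circles_disjoint[OF mergeD(2)[OF assms] *] by simp
  ultimately show False using mergeD(3)[OF assms] by simp
qed

text \<open>The union is a new circle, so the circles common to both vertices are the untouched
  ones; these are the circles in the compatibility condition of \<open>edge_coeff\<close>.\<close>

lemma merge_common: "merge T T' a b \<Longrightarrow> circles D T \<inter> circles D T' = circles D T - {a, b}"
  using merge_union_notin[of T T' a b] mergeD(4)[of T T' a b] by auto

lemma merge_card:
  assumes "merge T T' a b" shows "card (circles D T) = card (circles D T') + 1"
proof -
  have "{a, b} \<subseteq> circles D T" "card {a, b} = 2" using mergeD[OF assms] by auto
  then have "card (circles D T - {a, b}) = card (circles D T) - 2" "card (circles D T) \<ge> 2"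
    using card_Diff_subset[of "{a, b}" "circles D T"] card_mono[OF finite_circles, of "{a, b}" T] by auto
  then show ?thesis
    unfolding mergeD(4)[OF assms] using merge_union_notin[OF assms] finite_circles[of T] by simp
qed

lemma merge_switch:
  assumes r: "r \<in> E" and T': "T' = (if r \<in> T then T - {r} else insert r T)"
    and sep: "circ T (south r) \<noteq> circ T (far r (r \<in> T))"
  shows "merge T T' (circ T (south r)) (circ T (far r (r \<in> T)))"
proof -
  let ?b = "r \<in> T" and ?a = "circ T (south r)" and ?c = "circ T (far r (r \<in> T))"
  have "vertex T = (vertex T)(r := {?b})" "vertex T' = (vertex T)(r := {\<not> ?b})"
    by (auto simp: T' face_def fun_eq_iff)
  then have "Con (vertex T') = conn (insert (south r, far r ?b) (Rel (vertex T)))"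
    using Con_switch[OF r, of "vertex T" ?b] sep by (simp add: face_def circle_of_eq_iff)
  then have *: "(x, y) \<in> Con (vertex T') \<longleftrightarrow>
      (x, y) \<in> Con (vertex T) \<or> x \<in> ?a \<union> ?c \<and> y \<in> ?a \<union> ?c" for x y
    by (auto simp: conn_insert circle_of_eq intro: conn_sym)
  have circ: "circ T' x = (if x \<in> ?a \<union> ?c then ?a \<union> ?c else circ T x)" for x
  proof (cases "x \<in> ?a \<union> ?c")
    case True
    then have "y \<in> ?a \<union> ?c" if "(x, y) \<in> Con (vertex T)" for y
      using that by (auto simp: circle_of_eq intro: conn_trans)
    then show ?thesis using True * by (auto simp: circle_of_eq[of T'])
  next
    case False
    then show ?thesis using * by (auto simp: circle_of_eq[of T'] circle_of_eq[of T x])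
  qed
  have p: "south r \<in> points D" "far r ?b \<in> points D" using corner_points[OF r] by auto
  have "circles D T' = insert (?a \<union> ?c) (circles D T - {?a, ?c})"
  proof (intro set_eqI iffI)
    fix C assume "C \<in> circles D T'"
    then obtain x where x: "x \<in> points D" "C = circ T' x" by (auto simp: circles_def)
    show "C \<in> insert (?a \<union> ?c) (circles D T - {?a, ?c})"
      using x circ[of x] self_in_circ[of x T] circ_in_circles[OF x(1), of T] by auto
  next
    fix C assume C: "C \<in> insert (?a \<union> ?c) (circles D T - {?a, ?c})"
    show "C \<in> circles D T'"
    proof (cases "C = ?a \<union> ?c")
      case True
      then show ?thesis using circ[of "south r"] self_in_circ[of "south r" T] circ_in_circles[OF p(1), of T'] by simp
    next
      case False
      then obtain x where x: "x \<in> points D" "C = circ T x" "C \<noteq> ?a" "C \<noteq> ?c"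
        using C by (auto simp: circles_def)
      then have "x \<notin> ?a \<union> ?c" using circ_eqI circ_in_circles p by blast
      then show ?thesis using x circ[of x] circ_in_circles[OF x(1), of T'] by simp
    qed
  qed
  then show ?thesis
    unfolding merge_def by (intro conjI allI circ_in_circles p sep circ)
qed

section \<open>Matrix entries along an edge of the cube\<close>

lemma incidence_insert:
  assumes "r \<in> E" "r \<notin> S"
  shows "incidence D (S, l) (insert r S, l') = edge_sign S r * edge_coeff D S r l l'"
proof -
  have "{r'. r' < n_crossings D \<and> r' \<notin> S \<and> insert r S = insert r' S} = {r}"
    using assms by auto
  then show ?thesis by (simp add: edge_sign_def)
qed

lemma incidence_nonzeroE:
  assumes "incidence D (S, l) (S', l') \<noteq> 0"
  obtains r where "r \<in> E" "r \<notin> S" "S' = insert r S" "edge_coeff D S r l l' \<noteq> 0"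
proof -
  have "{r. r < n_crossings D \<and> r \<notin> S \<and> S' = insert r S} \<noteq> {}"
  proof
    assume "{r. r < n_crossings D \<and> r \<notin> S \<and> S' = insert r S} = {}"
    then have "incidence D (S, l) (S', l') = 0" by (simp only: incidence.simps sum.empty)
    then show False using assms by contradiction
  qed
  then obtain r where r: "r < n_crossings D" "r \<notin> S" "S' = insert r S" by blast
  then have "edge_coeff D S r l l' \<noteq> 0" using assms incidence_insert[of r S] by auto
  then show ?thesis using that r by auto
qed

text \<open>For either sign and either smoothing the two arcs start at \<open>south r\<close> and at
  \<open>far r b\<close>, so the sign of the crossing disappears from the coefficient.\<close>

lemma edge_coeff_eq:
  "edge_coeff D S r l l' =
    of_bool (\<forall>C\<in>circles D S \<inter> circles D (insert r S). l' C = l C) *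
    (if merging S r \<and> circ (insert r S) (south r) = circ (insert r S) (far r True)
     then m_coeff (l (circ S (south r))) (l (circ S (far r False))) (l' (circ (insert r S) (south r)))
     else if \<not> merging S r \<and> circ (insert r S) (south r) \<noteq> circ (insert r S) (far r True)
     then Delta_coeff (l (circ S (south r))) (l' (circ (insert r S) (south r))) (l' (circ (insert r S) (far r True)))
     else 0)"
  by (simp add: edge_coeff_def smoothing_def south_def far_def Let_def)

end

context alternating_diagram
begin

lemma edge_cases:
  assumes "S \<subseteq> E" "r \<in> E" "r \<notin> S"
  obtains (merge) "merging S r" "circ (insert r S) (south r) = circ (insert r S) (far r True)"
      "merge S (insert r S) (circ S (south r)) (circ S (far r False))"
    | (split) "\<not> merging S r" "circ (insert r S) (south r) \<noteq> circ (insert r S) (far r True)"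
      "merge (insert r S) S (circ (insert r S) (south r)) (circ (insert r S) (far r True))"
proof (cases "merging S r")
  case True
  then show ?thesis
    using that(1) merge_or_split[OF assms] merge_switch[of r "insert r S" S] assms
    by (auto simp: circle_of_eq_iff)
next
  case False
  then show ?thesis
    using that(2) merge_or_split[OF assms] merge_switch[of r S "insert r S"] assms
    by (auto simp: circle_of_eq_iff)
qed

lemma edge_coeff_merge:
  assumes S: "S \<subseteq> E" "r \<in> E" "r \<notin> S" and m: "merging S r"
    and ab: "a = circ S (south r)" "b = circ S (far r False)"
  shows "edge_coeff D S r l l' =
    of_bool (\<forall>C\<in>circles D S - {a, b}. l' C = l C) * m_coeff (l a) (l b) (l' (a \<union> b))"
  using S
proof (cases rule: edge_cases)
  case merge
  have "circ (insert r S) (south r) = a \<union> b"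
    using mergeD(5)[OF merge(3), of "south r"] self_in_circ[of "south r" S] by (simp add: ab)
  then show ?thesis using merge merge_common[OF merge(3)] by (simp add: edge_coeff_eq ab)
qed (use m in simp)

lemma edge_coeff_split:
  assumes S: "S \<subseteq> E" "r \<in> E" "r \<notin> S" and m: "\<not> merging S r"
    and ab: "a = circ (insert r S) (south r)" "b = circ (insert r S) (far r True)"
  shows "edge_coeff D S r l l' =
    of_bool (\<forall>C\<in>circles D (insert r S) - {a, b}. l' C = l C) * Delta_coeff (l (a \<union> b)) (l' a) (l' b)"
  using S
proof (cases rule: edge_cases)
  case split
  have "circ S (south r) = a \<union> b"
    using mergeD(5)[OF split(3), of "south r"] self_in_circ[of "south r" "insert r S"] by (simp add: ab)
  then show ?thesis using split merge_common[OF split(3)] by (simp add: edge_coeff_eq ab Int_commute)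
qed (use m in simp)

lemma edge_coeff_degree:
  assumes S: "S \<subseteq> E" "r \<in> E" "r \<notin> S" and nz: "edge_coeff D S r l l' \<noteq> 0"
  shows "(\<Sum>C\<in>circles D (insert r S). vdeg (l' C)) = (\<Sum>C\<in>circles D S. vdeg (l C)) - 1"
proof -
  have two: "(\<Sum>C\<in>circles D T. vdeg (f C)) = (\<Sum>C\<in>circles D T - {a, b}. vdeg (f C)) + vdeg (f a) + vdeg (f b)"
    and one: "(\<Sum>C\<in>circles D T'. vdeg (f C)) = (\<Sum>C\<in>circles D T - {a, b}. vdeg (f C)) + vdeg (f (a \<union> b))"
    if "merge T T' a b" for T T' a b f
  proof -
    have ab: "{a, b} \<subseteq> circles D T" "a \<noteq> b" and T': "circles D T' = insert (a \<union> b) (circles D T - {a, b})"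
      using mergeD[OF that] by simp_all
    show "(\<Sum>C\<in>circles D T. vdeg (f C)) = (\<Sum>C\<in>circles D T - {a, b}. vdeg (f C)) + vdeg (f a) + vdeg (f b)"
      using ab sum.subset_diff[OF ab(1) finite_circles, of "\<lambda>C. vdeg (f C)"] by simp
    show "(\<Sum>C\<in>circles D T'. vdeg (f C)) = (\<Sum>C\<in>circles D T - {a, b}. vdeg (f C)) + vdeg (f (a \<union> b))"
      unfolding T' using merge_union_notin[OF that] finite_circles[of T] by simp
  qed
  show ?thesis using S
  proof (cases rule: edge_cases)
    case merge
    let ?a = "circ S (south r)" and ?b = "circ S (far r False)"
    have *: "\<forall>C\<in>circles D S - {?a, ?b}. l' C = l C" "m_coeff (l ?a) (l ?b) (l' (?a \<union> ?b)) \<noteq> 0"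
      using nz unfolding edge_coeff_merge[OF S merge(1) refl refl] by (auto split: if_splits)
    have "(\<Sum>C\<in>circles D S - {?a, ?b}. vdeg (l' C)) = (\<Sum>C\<in>circles D S - {?a, ?b}. vdeg (l C))"
      using *(1) by (intro sum.cong) auto
    then show ?thesis
      using two[OF merge(3), of l] one[OF merge(3), of l'] m_coeff_degree[OF *(2)] by linarith
  next
    case split
    let ?a = "circ (insert r S) (south r)" and ?b = "circ (insert r S) (far r True)"
    have *: "\<forall>C\<in>circles D (insert r S) - {?a, ?b}. l' C = l C"
      "Delta_coeff (l (?a \<union> ?b)) (l' ?a) (l' ?b) \<noteq> 0"
      using nz unfolding edge_coeff_split[OF S split(1) refl refl] by (auto split: if_splits)
    have "(\<Sum>C\<in>circles D (insert r S) - {?a, ?b}. vdeg (l' C)) = (\<Sum>C\<in>circles D (insert r S) - {?a, ?b}. vdeg (l C))"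
      using *(1) by (intro sum.cong) auto
    then show ?thesis
      using two[OF split(3), of l'] one[OF split(3), of l] Delta_coeff_degree[OF *(2)] by linarith
  qed
qed

text \<open>The label of an untouched circle is carried along, so lowering it before the edge or
  after it is the same. In coordinates, lowering in the target means reading the coefficient at the
  raised label.\<close>

lemma shift_common:
  "C \<in> K \<Longrightarrow> of_bool (l C = VP) * of_bool (\<forall>C'\<in>K. l' C' = (l(C := VM)) C') =
    (of_bool (l' C = VM) * of_bool (\<forall>C'\<in>K. (l'(C := VP)) C' = l C') :: rat)"
  by (cases "l C"; cases "l' C") (auto split: if_splits)

text \<open>The edge maps commute with the multiplication by \<open>x\<close> at every point of the diagram, that is
  with the operator turning the label of the circle through that point from \<open>VP\<close> into \<open>VM\<close>.
  So they are determined by their values on the state with all labels \<open>VP\<close>.\<close>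

lemma edge_coeff_shift:
  assumes S: "S \<subseteq> E" "r \<in> E" "r \<notin> S" and x: "x \<in> points D"
  shows "of_bool (l (circ S x) = VP) * edge_coeff D S r (l(circ S x := VM)) l' =
    of_bool (l' (circ (insert r S) x) = VM) * edge_coeff D S r l (l'(circ (insert r S) x := VP))"
  using S
proof (cases rule: edge_cases)
  case merge
  define a b where ab: "a = circ S (south r)" "b = circ S (far r False)"
  note coeff = edge_coeff_merge[OF S merge(1) ab]
  have mg: "merge S (insert r S) a b" using merge(3) by (simp add: ab)
  have in_ab: "a \<in> circles D S" "b \<in> circles D S" "a \<noteq> b" and
    cx: "circ (insert r S) x = (if x \<in> a \<union> b then a \<union> b else circ S x)"
    using mergeD[OF mg] by simp_all
  have u: "a \<union> b \<notin> circles D S" using mg by (rule merge_union_notin)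
  show ?thesis
  proof (cases "x \<in> a \<union> b")
    case True
    then have C: "circ S x = a \<or> circ S x = b" using circ_eqI in_ab by blast
    have 1: "(\<forall>C\<in>circles D S - {a, b}. l' C = (l(circ S x := VM)) C) \<longleftrightarrow> (\<forall>C\<in>circles D S - {a, b}. l' C = l C)"
      using C by auto
    have 2: "(\<forall>C\<in>circles D S - {a, b}. (l'(a \<union> b := VP)) C = l C) \<longleftrightarrow> (\<forall>C\<in>circles D S - {a, b}. l' C = l C)"
      using u by auto
    \<comment> \<open>Multiplying either factor of a product by \<open>VM\<close> multiplies the
      product by \<open>VM\<close>.\<close>
    have 3: "of_bool (l (circ S x) = VP) * m_coeff ((l(circ S x := VM)) a) ((l(circ S x := VM)) b) (l' (a \<union> b)) =
        of_bool (l' (a \<union> b) = VM) * m_coeff (l a) (l b) ((l'(a \<union> b := VP)) (a \<union> b))"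
      using C in_ab(3) by (cases "l a"; cases "l b"; cases "l' (a \<union> b)") auto
    show ?thesis unfolding coeff 1 using True 2 3 by (simp add: cx)
  next
    case False
    then have C: "circ S x \<noteq> a" "circ S x \<noteq> b" "circ S x \<noteq> a \<union> b" using self_in_circ[of x S] by auto
    then have K: "circ S x \<in> circles D S - {a, b}" using circ_in_circles[OF x] by simp
    show ?thesis unfolding coeff using shift_common[OF K, of l l'] C False
      by (simp add: cx flip: mult.assoc)
  qed
next
  case split
  define a b where ab: "a = circ (insert r S) (south r)" "b = circ (insert r S) (far r True)"
  note coeff = edge_coeff_split[OF S split(1) ab]
  have mg: "merge (insert r S) S a b" using split(3) by (simp add: ab)
  have in_ab: "a \<in> circles D (insert r S)" "b \<in> circles D (insert r S)" "a \<noteq> b" and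
    cx: "circ S x = (if x \<in> a \<union> b then a \<union> b else circ (insert r S) x)"
    using mergeD[OF mg] by simp_all
  have u: "a \<union> b \<notin> circles D (insert r S)" using mg by (rule merge_union_notin)
  show ?thesis
  proof (cases "x \<in> a \<union> b")
    case True
    let ?C = "circ (insert r S) x"
    have C: "?C = a \<or> ?C = b" using True circ_eqI in_ab by blast
    have 1: "(\<forall>C\<in>circles D (insert r S) - {a, b}. l' C = (l(a \<union> b := VM)) C) \<longleftrightarrow>
        (\<forall>C\<in>circles D (insert r S) - {a, b}. l' C = l C)"
      using u by auto
    have 2: "(\<forall>C\<in>circles D (insert r S) - {a, b}. (l'(?C := VP)) C = l C) \<longleftrightarrow>
        (\<forall>C\<in>circles D (insert r S) - {a, b}. l' C = l C)"
      using C by auto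
    \<comment> \<open>Comultiplication intertwines multiplication by \<open>VM\<close> with its
      action on either tensor factor.\<close>
    have 3: "of_bool (l (a \<union> b) = VP) * Delta_coeff ((l(a \<union> b := VM)) (a \<union> b)) (l' a) (l' b) =
        of_bool (l' ?C = VM) * Delta_coeff (l (a \<union> b)) ((l'(?C := VP)) a) ((l'(?C := VP)) b)"
      using C in_ab(3) by (cases "l (a \<union> b)"; cases "l' a"; cases "l' b") auto
    show ?thesis unfolding coeff 2 using True 1 3 by (simp add: cx)
  next
    case False
    let ?C = "circ (insert r S) x"
    have C: "?C \<noteq> a" "?C \<noteq> b" "?C \<noteq> a \<union> b" using False self_in_circ[of x "insert r S"] by auto
    then have K: "?C \<in> circles D (insert r S) - {a, b}" using circ_in_circles[OF x] by simp
    show ?thesis unfolding coeff using shift_common[OF K, of l l'] C False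
      by (simp add: cx flip: mult.assoc)
  qed
qed

section \<open>Edge maps as operators on the unit\<close>

definition all_plus :: "nat set \<Rightarrow> 'a set \<Rightarrow> vlabel" where
  "all_plus S = (\<lambda>C\<in>circles D S. VP)"

definition unit_coeff :: "nat set \<Rightarrow> ('a set \<Rightarrow> vlabel) \<Rightarrow> rat" where
  "unit_coeff S l = of_bool (l = all_plus S)"

text \<open>Multiplication by \<open>VM\<close> on the circle through \<open>x\<close>, for a vector
  given by its coordinates \<open>h\<close>.\<close>

definition shift :: "nat set \<Rightarrow> 'a \<Rightarrow> (('a set \<Rightarrow> vlabel) \<Rightarrow> rat) \<Rightarrow> ('a set \<Rightarrow> vlabel) \<Rightarrow> rat" where
  "shift S x h l = of_bool (l (circ S x) = VM) * h (l(circ S x := VP))"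

text \<open>A merge sends the unit to the unit, and a split sends it to the sum of the two ways of
  lowering one of the new circles. Naming circles by points keeps this operator meaningful at every
  later vertex.\<close>

definition split_op where
  "split_op m S r h = (if m then h else (\<lambda>l. shift S (south r) h l + shift S (far r True) h l))"

lemma finite_labels: "finite (labels S)"
proof -
  have "(UNIV :: vlabel set) = {VP, VM}" using vlabel.exhaust by auto
  then have "finite (UNIV :: vlabel set)" by (metis finite.emptyI finite.insertI)
  then show ?thesis using finite_circles by (intro finite_PiE) auto
qed

lemma labels_upd: "l \<in> labels S \<Longrightarrow> C \<in> circles D S \<Longrightarrow> l(C := v) \<in> labels S"
  by (auto simp: PiE_iff extensional_def)

lemma all_plus_labels: "all_plus S \<in> labels S"
  by (simp add: all_plus_def)

lemma labels_eqI: "l \<in> labels S \<Longrightarrow> l' \<in> labels S \<Longrightarrow> (\<And>C. C \<in> circles D S \<Longrightarrow> l C = l' C) \<Longrightarrow> l = l'"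
  by (rule PiE_ext)

lemma all_plus_iff: "l \<in> labels S \<Longrightarrow> l = all_plus S \<longleftrightarrow> (\<forall>C\<in>circles D S. l C = VP)"
  using labels_eqI[OF _ all_plus_labels, of l S] by (auto simp: all_plus_def)

lemma edge_coeff_all_plus:
  assumes S: "S \<subseteq> E" "r \<in> E" "r \<notin> S" and l: "l \<in> labels (insert r S)"
  shows "edge_coeff D S r (all_plus S) l = split_op (merging S r) (insert r S) r (unit_coeff (insert r S)) l"
  using S
proof (cases rule: edge_cases)
  case merge
  define a b where ab: "a = circ S (south r)" "b = circ S (far r False)"
  note coeff = edge_coeff_merge[OF S merge(1) ab]
  have mg: "a \<in> circles D S" "b \<in> circles D S" "circles D (insert r S) = insert (a \<union> b) (circles D S - {a, b})"
    using mergeD[OF merge(3)] by (simp_all add: ab)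
  have "l = all_plus (insert r S) \<longleftrightarrow> (\<forall>C\<in>circles D S - {a, b}. l C = VP) \<and> l (a \<union> b) = VP"
    unfolding all_plus_iff[OF l] mg(3) by blast
  then show ?thesis using merge(1) mg
    by (auto simp: coeff split_op_def unit_coeff_def all_plus_def)
next
  case split
  define a b where ab: "a = circ (insert r S) (south r)" "b = circ (insert r S) (far r True)"
  note coeff = edge_coeff_split[OF S split(1) ab]
  have mg: "a \<in> circles D (insert r S)" "b \<in> circles D (insert r S)" "a \<noteq> b"
    "circles D S = insert (a \<union> b) (circles D (insert r S) - {a, b})"
    using mergeD[OF split(3)] by (simp_all add: ab)
  let ?K = "\<forall>C\<in>circles D (insert r S) - {a, b}. l C = VP"
  have *: "l(C := VP) = all_plus (insert r S) \<longleftrightarrow>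
     (\<forall>C'\<in>circles D (insert r S). (l(C := VP)) C' = VP)" if "C \<in> circles D (insert r S)" for C
    using all_plus_iff[OF labels_upd[OF l that]] .
  have 1: "l(a := VP) = all_plus (insert r S) \<longleftrightarrow> ?K \<and> l b = VP"
    unfolding *[OF mg(1)] using mg(2,3) by auto
  have 2: "l(b := VP) = all_plus (insert r S) \<longleftrightarrow> ?K \<and> l a = VP"
    unfolding *[OF mg(2)] using mg(1,3) by auto
  have 3: "(\<forall>C\<in>circles D (insert r S) - {a, b}. l C = all_plus S C) \<longleftrightarrow> ?K" "all_plus S (a \<union> b) = VP"
    using mg(4) by (auto simp: all_plus_def)
  show ?thesis using split(1) mg
    by (cases "l a"; cases "l b")
      (auto simp: coeff split_op_def unit_coeff_def shift_def 1 2 3 simp flip: ab)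
qed

section \<open>Composites of two edges\<close>

definition path_coeff where
  "path_coeff S r s l l' =
     (\<Sum>k\<in>labels (insert r S). edge_coeff D S r l k * edge_coeff D (insert r S) s k l')"

text \<open>Toggling the label of \<open>C\<close> reindexes the sum, which moves multiplication by
  \<open>VM\<close> from one factor of a composite to the other.\<close>

lemma sum_labels_shift:
  assumes C: "C \<in> circles D S"
  shows "(\<Sum>k\<in>labels S. of_bool (k C = VM) * f (k(C := VP)) k) = (\<Sum>k\<in>labels S. of_bool (k C = VP) * (f k (k(C := VM)) :: rat))"
proof -
  let ?M = "{k \<in> labels S. k C = VM}" and ?P = "{k \<in> labels S. k C = VP}"
  have "(\<Sum>k\<in>labels S. of_bool (k C = VM) * f (k(C := VP)) k) = (\<Sum>k\<in>?M. f (k(C := VP)) k)"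
    by (rule sum.mono_neutral_cong_right) (auto simp: finite_labels)
  also have "\<dots> = (\<Sum>k\<in>?P. f k (k(C := VM)))"
    by (rule sum.reindex_bij_witness[of _ "\<lambda>k. k(C := VM)" "\<lambda>k. k(C := VP)"])
      (use C in \<open>auto simp: labels_upd\<close>, (metis fun_upd_triv)+)
  also have "\<dots> = (\<Sum>k\<in>labels S. of_bool (k C = VP) * f k (k(C := VM)))"
    by (rule sum.mono_neutral_cong_left) (auto simp: finite_labels)
  finally show ?thesis .
qed

lemma path_coeff_shift:
  assumes S: "S \<subseteq> E" "r \<in> E" "r \<notin> S" "s \<in> E" "s \<notin> insert r S" and x: "x \<in> points D"
  shows "of_bool (l (circ S x) = VP) * path_coeff S r s (l(circ S x := VM)) l' =
    of_bool (l' (circ (insert s (insert r S)) x) = VM) * path_coeff S r s l (l'(circ (insert s (insert r S)) x := VP))"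
proof -
  let ?R = "insert r S" and ?U = "insert s (insert r S)"
  have R: "?R \<subseteq> E" using S by auto
  let ?e = "edge_coeff D S r" and ?f = "edge_coeff D ?R s"
  note e = edge_coeff_shift[OF S(1-3) x] and f = edge_coeff_shift[OF R S(4,5) x]
  have "of_bool (l (circ S x) = VP) * path_coeff S r s (l(circ S x := VM)) l' =
      (\<Sum>k\<in>labels ?R. of_bool (k (circ ?R x) = VM) * (?e l (k(circ ?R x := VP)) * ?f k l'))"
    unfolding path_coeff_def sum_distrib_left mult.assoc[symmetric] e ..
  also have "\<dots> = (\<Sum>k\<in>labels ?R. of_bool (k (circ ?R x) = VP) * (?e l k * ?f (k(circ ?R x := VM)) l'))"
    by (rule sum_labels_shift[OF circ_in_circles[OF x], where f = "\<lambda>k k'. ?e l k * ?f k' l'"])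
  also have "\<dots> = (\<Sum>k\<in>labels ?R. ?e l k * (of_bool (k (circ ?R x) = VP) * ?f (k(circ ?R x := VM)) l'))"
    by (simp add: mult.left_commute)
  also have "\<dots> = of_bool (l' (circ ?U x) = VM) * path_coeff S r s l (l'(circ ?U x := VP))"
    unfolding f path_coeff_def sum_distrib_left by (simp add: mult.left_commute)
  finally show ?thesis .
qed

text \<open>The first edge yields the unit or a sum of point actions on it; the second edge commutes
  with these actions, which carries the whole operator to \<open>U\<close>.\<close>

lemma path_coeff_all_plus:
  assumes S: "S \<subseteq> E" "r \<in> E" "r \<notin> S" "s \<in> E" "s \<notin> insert r S"
    and U: "U = insert s (insert r S)" and l: "l \<in> labels U"
  shows "path_coeff S r s (all_plus S) l =
    split_op (merging S r) U r (split_op (merging (insert r S) s) U s (unit_coeff U)) l"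
proof -
  let ?R = "insert r S" and ?f = "edge_coeff D (insert r S) s"
  have R: "?R \<subseteq> E" using S by auto
  let ?g = "split_op (merging ?R s) U s (unit_coeff U)"
  have f: "?f (all_plus ?R) k = ?g k" if "k \<in> labels U" for k
    using edge_coeff_all_plus[OF R S(4,5)] that U by simp
  have pick: "(\<Sum>k\<in>labels ?R. of_bool (k = k0) * ?f k l) = ?f k0 l" if "k0 \<in> labels ?R" for k0
  proof -
    have "(\<Sum>k\<in>labels ?R. of_bool (k = k0) * ?f k l) = (\<Sum>k\<in>labels ?R. if k = k0 then ?f k0 l else 0)"
      by (rule sum.cong) auto
    then show ?thesis using that finite_labels by simp
  qed
  have sh: "(\<Sum>k\<in>labels ?R. shift ?R x (unit_coeff ?R) k * ?f k l) = shift U x ?g l" if x: "x \<in> points D" for x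
  proof -
    let ?C = "circ ?R x" and ?C' = "circ U x"
    have C: "?C \<in> circles D ?R" "?C' \<in> circles D U" using circ_in_circles[OF x] by auto
    have 1: "all_plus ?R ?C = VP" using C by (simp add: all_plus_def)
    have "(\<Sum>k\<in>labels ?R. shift ?R x (unit_coeff ?R) k * ?f k l) =
        (\<Sum>k\<in>labels ?R. of_bool (k = (all_plus ?R)(?C := VM)) * ?f k l)"
    proof (rule sum.cong[OF refl])
      fix k
      have "k ?C = VM \<and> k(?C := VP) = all_plus ?R \<longleftrightarrow> k = (all_plus ?R)(?C := VM)"
        using 1 by (metis fun_upd_same fun_upd_triv fun_upd_upd)
      then show "shift ?R x (unit_coeff ?R) k * ?f k l = of_bool (k = (all_plus ?R)(?C := VM)) * ?f k l"
        by (auto simp: shift_def unit_coeff_def)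
    qed
    also have "\<dots> = ?f ((all_plus ?R)(?C := VM)) l"
      by (rule pick) (simp add: labels_upd all_plus_labels C)
    also have "\<dots> = of_bool (l ?C' = VM) * ?f (all_plus ?R) (l(?C' := VP))"
      using edge_coeff_shift[OF R S(4,5) x, of "all_plus ?R" l] 1 by (simp add: U)
    also have "\<dots> = shift U x ?g l"
      using f[OF labels_upd[OF l C(2)], of VP] by (simp add: shift_def)
    finally show ?thesis .
  qed
  show ?thesis
  proof (cases "merging S r")
    case True
    have "path_coeff S r s (all_plus S) l = (\<Sum>k\<in>labels ?R. of_bool (k = all_plus ?R) * ?f k l)"
      unfolding path_coeff_def using edge_coeff_all_plus[OF S(1-3)] True
      by (intro sum.cong) (auto simp: split_op_def unit_coeff_def)
    also have "\<dots> = ?g l" using pick[OF all_plus_labels] f[OF l] by simp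
    finally show ?thesis using True by (simp add: split_op_def[of True])
  next
    case False
    have "path_coeff S r s (all_plus S) l = (\<Sum>k\<in>labels ?R. shift ?R (south r) (unit_coeff ?R) k * ?f k l +
        shift ?R (far r True) (unit_coeff ?R) k * ?f k l)"
      unfolding path_coeff_def using edge_coeff_all_plus[OF S(1-3)] False
      by (intro sum.cong) (auto simp: split_op_def algebra_simps)
    also have "\<dots> = shift U (south r) ?g l + shift U (far r True) ?g l"
      using sh corner_points[OF S(2)] by (simp add: sum.distrib)
    finally show ?thesis using False by (simp add: split_op_def[of False])
  qed
qed

lemma shift_commute: "shift U x (shift U y h) l = shift U y (shift U x h) l"
proof (cases "circ U x = circ U y")
  case False
  then show ?thesis by (simp add: shift_def fun_upd_twist)
qed (simp add: shift_def)

lemma card_circles_insert: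
  assumes "S \<subseteq> E" "r \<in> E" "r \<notin> S"
  shows "int (card (circles D (insert r S))) = int (card (circles D S)) + (if merging S r then - 1 else 1)"
  using assms by (cases rule: edge_cases) (auto dest: merge_card)

text \<open>Both composites are operators at the same vertex \<open>U\<close>. If each crossing has
  the same type in both orders, the operators commute. Otherwise both paths merge and then split, or
  split and then merge; then the two crossings touch the same circles of \<open>U\<close>, and the
  sum in \<open>split_op\<close> depends only on these.\<close>

lemma split_op_commute:
  assumes S: "S \<subseteq> E" and r: "r \<in> E" "r \<notin> S" and s: "s \<in> E" "s \<notin> S" and rs: "r \<noteq> s"
    and U: "U = insert s (insert r S)"
  shows "split_op (merging S r) U r (split_op (merging (insert r S) s) U s h) l =
    split_op (merging S s) U s (split_op (merging (insert s S) r) U r h) l"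
proof -
  let ?R = "insert r S" and ?S = "insert s S"
  have RS: "?R \<subseteq> E" "?S \<subseteq> E" "s \<notin> ?R" "r \<notin> ?S" using S r s rs by auto
  have U': "U = insert r ?S" using U by auto
  \<comment> \<open>Both paths have the same total change in the number of circles; this leaves
    equal patterns along the paths, or a fixed type for each crossing.\<close>
  have eq: "(merging S r \<longleftrightarrow> merging S s) \<and> (merging ?R s \<longleftrightarrow> merging ?S r) \<or>
      (merging S r \<longleftrightarrow> merging ?S r) \<and> (merging S s \<longleftrightarrow> merging ?R s)"
    using card_circles_insert[OF S r] card_circles_insert[OF RS(1) s(1) RS(3)]
      card_circles_insert[OF S s] card_circles_insert[OF RS(2) r(1) RS(4)] U U'
    by (auto split: if_splits)
  have same: "split_op False U r h l = split_op False U s h l"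
    if "circ U (south r) = circ U (south s) \<and> circ U (far r True) = circ U (far s True) \<or>
      circ U (south r) = circ U (far s True) \<and> circ U (far r True) = circ U (south s)"
    using that by (auto simp: split_op_def shift_def)
  have tr: "split_op True U t h = h" for t h
    by (simp add: split_op_def)
  consider (par) "merging S r \<longleftrightarrow> merging ?S r" "merging S s \<longleftrightarrow> merging ?R s"
    | (ms) "merging S r" "merging S s" "\<not> merging ?R s" "\<not> merging ?S r"
    | (sm) "\<not> merging S r" "\<not> merging S s" "merging ?R s" "merging ?S r"
    using eq by auto
  then show ?thesis
  proof cases
    case par
    have add: "shift U x (\<lambda>l. f l + g l) l = shift U x f l + shift U x g l" for x f g l
      by (simp add: shift_def)
    have "split_op m U r (split_op m' U s h) l = split_op m' U s (split_op m U r h) l" for m m'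
      by (cases m; cases m') (simp_all add: split_op_def add add_ac
          shift_commute[of U "south r" "south s"] shift_commute[of U "far r True" "south s"]
          shift_commute[of U "south r" "far s True"] shift_commute[of U "far r True" "far s True"])
    then show ?thesis using par by simp
  next
    case ms
    define a b where ab: "a = circ U (south s)" "b = circ U (far s True)"
    have mg: "merge U ?R a b"
      using RS(1) s(1) RS(3) by (cases rule: edge_cases) (use ms U in \<open>auto simp: ab\<close>)
    have cR: "circ ?R x = (if x \<in> a \<union> b then a \<union> b else circ U x)" for x
      using mg by (rule mergeD(5))
    have R: "circ ?R (south r) = circ ?R (far r True)"
      using S r by (cases rule: edge_cases) (use ms in auto)
    have ne: "circ U (south r) \<noteq> circ U (far r True)"
      using RS(2) r(1) RS(4) by (cases rule: edge_cases) (use ms U' in auto)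
    \<comment> \<open>The two points lie on different circles of \<open>U\<close> but on one circle
      of \<open>?R\<close>, and only \<open>a\<close> and \<open>b\<close> are fused there.\<close>
    have "south r \<in> a \<union> b" "far r True \<in> a \<union> b"
      using R ne cR[of "south r"] cR[of "far r True"] self_in_circ[of "south r" U] self_in_circ[of "far r True" U]
      by (auto split: if_splits)
    then have "circ U (south r) \<in> {a, b}" "circ U (far r True) \<in> {a, b}"
      using circ_eqI mergeD(1,2)[OF mg] by blast+
    then show ?thesis using ms same ne by (auto simp: ab tr)
  next
    case sm
    define a b where ab: "a = circ ?R (south s)" "b = circ ?R (far s False)"
    have mg: "merge ?R U a b" and s': "circ U (south s) = circ U (far s True)"
      using RS(1) s(1) RS(3) by (cases rule: edge_cases; use sm U in \<open>auto simp: ab\<close>)+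
    have cU: "circ U x = (if x \<in> a \<union> b then a \<union> b else circ ?R x)" for x
      using mg by (rule mergeD(5))
    have ne: "circ ?R (south r) \<noteq> circ ?R (far r True)"
      using S r by (cases rule: edge_cases) (use sm in auto)
    have r': "circ U (south r) = circ U (far r True)"
      using RS(2) r(1) RS(4) by (cases rule: edge_cases) (use sm U' in auto)
    \<comment> \<open>Only \<open>a\<close> and \<open>b\<close> are fused on the way to
      \<open>U\<close>, so the new coincidence at \<open>U\<close> places \<open>south r\<close> on
      one of them.\<close>
    have "south r \<in> a \<union> b"
      using r' ne cU[of "south r"] cU[of "far r True"] self_in_circ[of "south r" ?R] self_in_circ[of "far r True" ?R]
      by (auto split: if_splits)
    moreover have "south s \<in> a \<union> b" using self_in_circ[of "south s" ?R] by (simp add: ab)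
    ultimately have "circ U (south r) = circ U (south s)" using cU by simp
    then show ?thesis using sm same r' s' by (simp add: tr)
  qed
qed

text \<open>Induction on the number of \<open>VM\<close> labels: \<open>path_coeff_shift\<close>
  pulls one of them out of both composites, until only the unit is left.\<close>

lemma path_coeff_commute:
  assumes S: "S \<subseteq> E" and r: "r \<in> E" "r \<notin> S" and s: "s \<in> E" "s \<notin> S" and rs: "r \<noteq> s"
    and l: "l \<in> labels S" and l': "l' \<in> labels (insert s (insert r S))"
  shows "path_coeff S r s l l' = path_coeff S s r l l'"
  using l l'
proof (induction "card {C \<in> circles D S. l C = VM}" arbitrary: l l')
  case 0
  have "{C \<in> circles D S. l C = VM} = {}" using 0(1) finite_circles[of S] by simp
  then have "l C = VP" if "C \<in> circles D S" for C using that by (cases "l C") auto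
  then have l: "l = all_plus S" using all_plus_iff[OF 0(2)] by simp
  have 1: "insert s (insert r S) = insert r (insert s S)" by auto
  have 2: "s \<notin> insert r S" "r \<notin> insert s S" using r s rs by auto
  show ?case
    unfolding l path_coeff_all_plus[OF S r s(1) 2(1) refl 0(3)] path_coeff_all_plus[OF S s r(1) 2(2) 1 0(3)]
    by (rule split_op_commute[OF S r s rs refl])
next
  case (Suc n)
  then have "{C \<in> circles D S. l C = VM} \<noteq> {}" by force
  then obtain C where C: "C \<in> circles D S" "l C = VM" by blast
  then obtain x where x: "x \<in> points D" "C = circ S x" by (auto simp: circles_def)
  let ?U = "insert s (insert r S)" and ?k = "l(C := VP)"
  have U: "?U = insert r (insert s S)" by auto
  have "{C' \<in> circles D S. ?k C' = VM} = {C' \<in> circles D S. l C' = VM} - {C}" by auto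
  then have n: "n = card {C' \<in> circles D S. ?k C' = VM}" using Suc(2) C finite_circles by simp
  have k: "?k \<in> labels S" "?k(C := VM) = l" "?k C = VP"
    using labels_upd[OF Suc(3) C(1)] C by auto
  have "path_coeff S r s l l' = of_bool (l' (circ ?U x) = VM) * path_coeff S r s ?k (l'(circ ?U x := VP))"
    using path_coeff_shift[OF S r s(1) _ x(1), of ?k l'] k rs s x by simp
  moreover have "path_coeff S s r l l' = of_bool (l' (circ ?U x) = VM) * path_coeff S s r ?k (l'(circ ?U x := VP))"
    using path_coeff_shift[OF S s r(1) _ x(1), of ?k l'] k rs r x unfolding U by simp
  moreover have "path_coeff S r s ?k (l'(circ ?U x := VP)) = path_coeff S s r ?k (l'(circ ?U x := VP))"
    using Suc(1)[OF n k(1) labels_upd[OF Suc(4) circ_in_circles[OF x(1)]]] .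
  ultimately show ?case by simp
qed

section \<open>The differential squares to zero\<close>

lemma states_iff: "(S, l) \<in> states D \<longleftrightarrow> S \<subseteq> E \<and> l \<in> labels S"
  by (simp add: states_def)

lemma states_Sigma: "states D = Sigma (Pow E) labels"
  by (auto simp: states_def)

lemma finite_states: "finite (states D)"
  unfolding states_Sigma by (simp add: finite_labels)

lemma incidence_square:
  assumes x: "x \<in> states D" and z: "z \<in> states D"
  shows "(\<Sum>y\<in>states D. incidence D x y * incidence D y z) = 0"
proof -
  obtain S l where Sl: "x = (S, l)" "S \<subseteq> E" "l \<in> labels S" using x by (cases x) (auto simp: states_iff)
  obtain U k where Uk: "z = (U, k)" "U \<subseteq> E" "k \<in> labels U" using z by (cases z) (auto simp: states_iff)
  define N where "N = (\<lambda>T. \<Sum>t\<in>labels T. incidence D (S, l) (T, t) * incidence D (T, t) (U, k))"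
  have eq: "(\<Sum>y\<in>states D. incidence D x y * incidence D y z) = (\<Sum>T\<in>Pow E. N T)"
    unfolding states_Sigma N_def Sl(1) Uk(1) by (subst sum.Sigma) (auto simp: finite_labels intro!: sum.cong)
  have N0: "\<exists>r s. r \<in> E \<and> r \<notin> S \<and> s \<in> E \<and> s \<notin> insert r S \<and> T = insert r S \<and> U = insert s (insert r S)"
    if nz: "N T \<noteq> 0" for T
  proof -
    obtain t where "incidence D (S, l) (T, t) * incidence D (T, t) (U, k) \<noteq> 0"
      using nz unfolding N_def by (rule sum.not_neutral_contains_not_neutral)
    then have t: "incidence D (S, l) (T, t) \<noteq> 0" "incidence D (T, t) (U, k) \<noteq> 0"
      by (auto simp del: incidence.simps)
    obtain r where r: "r \<in> E" "r \<notin> S" "T = insert r S" using t(1) by (rule incidence_nonzeroE)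
    obtain s where "s \<in> E" "s \<notin> T" "U = insert s T" using t(2) by (rule incidence_nonzeroE)
    then show ?thesis using r by blast
  qed
  show ?thesis
  proof (cases "\<exists>T. N T \<noteq> 0")
    case False
    then show ?thesis unfolding eq by simp
  next
    case True
    then obtain r s where rs: "r \<in> E" "r \<notin> S" "s \<in> E" "s \<notin> S" "r \<noteq> s" "U = insert s (insert r S)"
      using N0 by blast
    have U': "U = insert r (insert s S)" using rs by auto
    \<comment> \<open>Only the two vertices strictly between \<open>S\<close> and \<open>U\<close>
      contribute. Their composites agree and their signs are opposite.\<close>
    have "T = insert r S \<or> T = insert s S" if nz: "N T \<noteq> 0" for T
    proof -
      obtain r' s' where r': "r' \<notin> S" "T = insert r' S" "U = insert s' (insert r' S)"
        using N0[OF nz] by blast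
      then have "r' \<in> insert s (insert r S)" using rs(6) by blast
      then show ?thesis using r' by auto
    qed
    then have "(\<Sum>T\<in>Pow E. N T) = (\<Sum>T\<in>{insert r S, insert s S}. N T)"
      using Sl(2) rs by (intro sum.mono_neutral_right) auto
    also have "\<dots> = N (insert r S) + N (insert s S)"
    proof -
      have "insert r S \<noteq> insert s S" using rs by blast
      then show ?thesis by simp
    qed
    also have "N (insert r S) = edge_sign S r * edge_sign (insert r S) s * path_coeff S r s l k"
      unfolding N_def path_coeff_def sum_distrib_left rs(6)
      using rs by (intro sum.cong) (auto simp: incidence_insert simp del: incidence.simps)
    also have "N (insert s S) = edge_sign S s * edge_sign (insert s S) r * path_coeff S s r l k"
      unfolding N_def path_coeff_def sum_distrib_left U'
      using rs by (intro sum.cong) (auto simp: incidence_insert simp del: incidence.simps)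
    also have "path_coeff S s r l k = path_coeff S r s l k"
      using path_coeff_commute[OF Sl(2) rs(1-5) Sl(3)] Uk(3) rs(6) by simp
    also have "edge_sign S r * edge_sign (insert r S) s = - (edge_sign S s * edge_sign (insert s S) r)"
      using rs Sl(2) by (intro edge_sign_anticommute) (auto intro: finite_subset)
    finally show ?thesis unfolding eq by simp
  qed
qed

text \<open>\<open>quantum_deg\<close> minus twice \<open>hom_deg\<close>, up to the constant
  \<open>n_plus D\<close>. Along an edge the label sum drops by one and the cardinality grows by
  one, which makes the step of two.\<close>

fun delta :: "'a state \<Rightarrow> int" where
  "delta (S, l) = (\<Sum>C\<in>circles D S. vdeg (l C)) - int (card S)"

lemma graded_complex_states: "graded_complex (incidence D) delta (states D)"
  unfolding graded_complex_def
proof (intro conjI ballI impI)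
  fix x y assume xy: "x \<in> states D" "y \<in> states D" and nz: "incidence D x y \<noteq> 0"
  obtain S l T t where Sl: "x = (S, l)" "y = (T, t)" by (cases x; cases y) auto
  then obtain r where r: "r \<in> E" "r \<notin> S" "T = insert r S" "edge_coeff D S r l t \<noteq> 0"
    using nz by (auto elim: incidence_nonzeroE simp del: incidence.simps)
  moreover have "S \<subseteq> E" using xy Sl by (simp add: states_iff)
  moreover have "finite S" using \<open>S \<subseteq> E\<close> finite_subset by blast
  ultimately show "delta y = delta x - 2"
    using edge_coeff_degree[of S r l t] by (simp add: Sl)
qed (simp_all add: finite_states incidence_square)

end


section \<open>Thinness for Turaev genus zero\<close>

lemma m_coeff_commute: "m_coeff a b c = m_coeff b a c"
  by (cases a; cases b) auto

lemma Delta_coeff_commute: "Delta_coeff a b c = Delta_coeff a c b"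
  by (cases a) auto

lemma m_coeff_VP: "m_coeff VP a c \<noteq> 0 \<longleftrightarrow> c = a"
  by (cases a; cases c) auto

lemma Delta_coeff_VM: "Delta_coeff a VM c \<noteq> 0 \<longleftrightarrow> c = a"
  by (cases a; cases c) auto

lemma of_bool_mult_nonzero: "of_bool P * (q :: rat) \<noteq> 0 \<longleftrightarrow> P \<and> q \<noteq> 0"
  by simp

context alternating_diagram
begin

section \<open>Faces of the cube as subquotients\<close>

definition face_states :: "nat set \<Rightarrow> nat set \<Rightarrow> 'a state set" where
  "face_states A B = {(S, l). (S, l) \<in> states D \<and> A \<subseteq> S \<and> S \<subseteq> B}"

abbreviation exact :: "'a state set \<Rightarrow> int \<Rightarrow> bool" where
  "exact \<equiv> exact_at (incidence D) delta"

lemma graded_subcomplex: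
  assumes "Z \<subseteq> states D"
    and "\<And>S l T t U k. (S, l) \<in> Z \<Longrightarrow> (U, k) \<in> Z \<Longrightarrow> (T, t) \<in> states D \<Longrightarrow>
      incidence D (S, l) (T, t) \<noteq> 0 \<Longrightarrow> incidence D (T, t) (U, k) \<noteq> 0 \<Longrightarrow> (T, t) \<in> Z"
  shows "graded_complex (incidence D) delta Z"
proof (rule graded_complex_convex[OF graded_complex_states assms(1)])
  show "y \<in> Z" if "x \<in> Z" "z \<in> Z" "y \<in> states D" "incidence D x y \<noteq> 0" "incidence D y z \<noteq> 0" for x y z
    using assms(2)[of "fst x" "snd x" "fst z" "snd z" "fst y" "snd y"] that
    unfolding prod.collapse by blast
qed

lemma incidence_subset: "incidence D (S, l) (T, t) \<noteq> 0 \<Longrightarrow> S \<subseteq> T"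
  by (erule incidence_nonzeroE) auto

lemma graded_face: "graded_complex (incidence D) delta (face_states A B)"
proof (rule graded_subcomplex)
  fix S l T t U k assume "(S, l) \<in> face_states A B" "(U, k) \<in> face_states A B" "(T, t) \<in> states D"
    "incidence D (S, l) (T, t) \<noteq> 0" "incidence D (T, t) (U, k) \<noteq> 0"
  then show "(T, t) \<in> face_states A B"
    using incidence_subset[of S l T t] incidence_subset[of T t U k]
    unfolding face_states_def by (auto simp del: incidence.simps)
qed (auto simp: face_states_def)

text \<open>The differential only adds 1-smoothings, so the half with \<open>r\<close> 1-smoothed is
  the subcomplex.\<close>

lemma exact_face_split:
  assumes "A \<subseteq> B" "r \<in> B" "r \<notin> A"
    and "exact (face_states (insert r A) B) g" "exact (face_states A (B - {r})) g"
  shows "exact (face_states A B) g"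
proof -
  have eq: "face_states A B = face_states (insert r A) B \<union> face_states A (B - {r})"
    using assms(2) by (auto simp: face_states_def)
  show ?thesis unfolding eq
  proof (rule exact_at_Un[OF _ _ _ assms(4,5)])
    show "graded_complex (incidence D) delta (face_states (insert r A) B \<union> face_states A (B - {r}))"
      unfolding eq[symmetric] by (rule graded_face)
    show "incidence D x y = 0" if "x \<in> face_states (insert r A) B" "y \<in> face_states A (B - {r})" for x y
      using that incidence_subset[of "fst x" "snd x" "fst y" "snd y"]
      by (cases x; cases y) (auto simp: face_states_def simp del: incidence.simps)
  qed (auto simp: face_states_def)
qed

end

text \<open>\<open>r\<close> is the only free crossing on \<open>K\<close>, and exactly one of its
  two arcs lies on \<open>K\<close>, as at a kink. The Boolean \<open>b\<close> covers both kinds of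
  kink: \<open>K\<close> is present after the edge at \<open>r\<close> if \<open>b\<close> holds,
  and before it otherwise.\<close>

locale leaf = alternating_diagram +
  fixes A B :: "nat set" and r :: nat and b :: bool and K :: "'a set"
  assumes B_subset: "B \<subseteq> E" and r_free: "r \<in> B" "r \<notin> A"
    and K_circle: "\<And>S. A \<subseteq> S \<Longrightarrow> S \<subseteq> B \<Longrightarrow> (r \<in> S) = b \<Longrightarrow> K \<in> circles D S"
    and K_isolated: "\<And>r'. r' \<in> B - A \<Longrightarrow> r' \<noteq> r \<Longrightarrow> K \<inter> corners r' = {}"
    and K_corner: "south r \<in> K \<longleftrightarrow> far r b \<notin> K"
begin

section \<open>Cancellation at a leaf\<close>

definition in_part :: "bool \<Rightarrow> nat set \<Rightarrow> bool" where
  "in_part b' S \<longleftrightarrow> A \<subseteq> S \<and> S \<subseteq> B \<and> (r \<in> S) = b'"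

definition part :: "bool \<Rightarrow> 'a state set" where
  "part b' = {(S, l). S \<subseteq> E \<and> l \<in> labels S \<and> in_part b' S}"

definition labelled_part :: "vlabel \<Rightarrow> 'a state set" where
  "labelled_part v = {(S, l). S \<subseteq> E \<and> l \<in> labels S \<and> in_part b S \<and> l K = v}"

definition toggle :: "nat set \<Rightarrow> nat set" where
  "toggle S = (if r \<in> S then S - {r} else insert r S)"

definition neighbour :: "nat set \<Rightarrow> 'a set" where
  "neighbour S = (if south r \<in> K then circ S (far r b) else circ S (south r))"

text \<open>The label for which the edge at \<open>r\<close> is invertible: merging with a circle
  labelled \<open>VP\<close> is the identity on the neighbour, and so is the component of a split
  with \<open>VM\<close> on \<open>K\<close>.\<close>

definition cancelled :: vlabel where
  "cancelled = (if b then VM else VP)"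

lemma r_E: "r \<in> E"
  using r_free B_subset by auto

lemma toggle_toggle [simp]: "toggle (toggle S) = S"
  by (auto simp: toggle_def)

lemma in_part_toggle: "in_part b' S \<Longrightarrow> in_part (\<not> b') (toggle S)"
  using r_free by (auto simp: in_part_def toggle_def)

lemma in_part_E: "in_part b' S \<Longrightarrow> S \<subseteq> E"
  using B_subset by (auto simp: in_part_def)

lemma merge_sym: "merge T T' a c \<Longrightarrow> merge T T' c a"
  unfolding merge_def by (simp add: Un_commute insert_commute) blast

lemma K_in_circles: "in_part b S \<Longrightarrow> K \<in> circles D S"
  using K_circle by (simp add: in_part_def)

lemma circ_ends:
  assumes "in_part b S"
  shows "circ S (south r) = K \<and> circ S (far r b) = neighbour S \<or> circ S (south r) = neighbour S \<and> circ S (far r b) = K"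
    and "circ S (south r) \<noteq> circ S (far r b)"
proof -
  have K: "x \<in> K \<longleftrightarrow> circ S x = K" for x
    using circ_eqI[OF _ K_in_circles[OF assms]] self_in_circ[of x S] by auto
  show "circ S (south r) = K \<and> circ S (far r b) = neighbour S \<or> circ S (south r) = neighbour S \<and> circ S (far r b) = K"
    using K_corner K by (auto simp: neighbour_def)
  show "circ S (south r) \<noteq> circ S (far r b)"
    using K_corner K[of "south r"] K[of "far r b"] by auto
qed

lemma merge_K:
  assumes "in_part b S"
  shows "merge S (toggle S) K (neighbour S)"
proof -
  have "(r \<in> S) = b" using assms by (simp add: in_part_def)
  then have "merge S (toggle S) (circ S (south r)) (circ S (far r b))"
    using merge_switch[OF r_E, of "toggle S" S] circ_ends(2)[OF assms] by (simp add: toggle_def)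
  then show ?thesis using circ_ends(1)[OF assms] merge_sym by metis
qed

text \<open>Forgets \<open>K\<close> and passes the label of its neighbour to the fused circle. It
  always leads away from the smoothing with the leaf, hence against the differential if
  \<open>b\<close> holds.\<close>

definition collapse :: "'a state \<Rightarrow> 'a state" where
  "collapse = (\<lambda>(S, l). (toggle S,
     \<lambda>C\<in>circles D (toggle S). if C = K \<union> neighbour S then l (neighbour S) else l C))"

lemma collapse_iff:
  assumes S: "in_part b S" and t: "t \<in> labels (toggle S)"
  shows "(toggle S, t) = collapse (S, l) \<longleftrightarrow>
    (\<forall>C\<in>circles D S - {K, neighbour S}. t C = l C) \<and> t (K \<union> neighbour S) = l (neighbour S)"
proof -
  let ?l = "\<lambda>C\<in>circles D (toggle S). if C = K \<union> neighbour S then l (neighbour S) else l C"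
  note T = mergeD(4)[OF merge_K[OF S]] and u = merge_union_notin[OF merge_K[OF S]]
  have "?l \<in> labels (toggle S)" by simp
  then have "t = ?l \<longleftrightarrow> (\<forall>C\<in>circles D (toggle S). t C = ?l C)"
    using labels_eqI[OF t] by metis
  also have "\<dots> \<longleftrightarrow> t (K \<union> neighbour S) = ?l (K \<union> neighbour S) \<and>
      (\<forall>C\<in>circles D S - {K, neighbour S}. t C = ?l C)"
  proof -
    have "(\<forall>C\<in>circles D (toggle S). P C) \<longleftrightarrow> P (K \<union> neighbour S) \<and> (\<forall>C\<in>circles D S - {K, neighbour S}. P C)" for P
      by (simp only: T ball_simps(7))
    then show ?thesis .
  qed
  also have "?l (K \<union> neighbour S) = l (neighbour S)" using T by simp
  also have "(\<forall>C\<in>circles D S - {K, neighbour S}. t C = ?l C) \<longleftrightarrow> (\<forall>C\<in>circles D S - {K, neighbour S}. t C = l C)"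
  proof (rule ball_cong[OF refl])
    fix C assume C: "C \<in> circles D S - {K, neighbour S}"
    then have "C \<in> circles D (toggle S)" "C \<noteq> K \<union> neighbour S" using T u by blast+
    then show "t C = ?l C \<longleftrightarrow> t C = l C" by simp
  qed
  finally have "t = ?l \<longleftrightarrow> (\<forall>C\<in>circles D S - {K, neighbour S}. t C = l C) \<and>
      t (K \<union> neighbour S) = l (neighbour S)"
    by blast
  then show ?thesis by (simp add: collapse_def)
qed

text \<open>With the cancelled label on \<open>K\<close>, the coefficient reduces to
  \<open>m_coeff_VP\<close> or \<open>Delta_coeff_VM\<close>, so its nonzero entries link each state
  to its collapse.\<close>

lemma edge_collapse:
  assumes S: "in_part b S" and l: "l K = cancelled" and t: "t \<in> labels (toggle S)"
  shows "(if b then edge_coeff D (toggle S) r t l else edge_coeff D S r l t) \<noteq> 0 \<longleftrightarrow>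
    (toggle S, t) = collapse (S, l)"
proof (cases b)
  case True
  let ?T = "toggle S"
  have T: "?T \<subseteq> E" "r \<in> E" "r \<notin> ?T" "insert r ?T = S"
    using S True in_part_E r_E by (auto simp: toggle_def in_part_def)
  have ends: "circ S (south r) = K \<and> circ S (far r True) = neighbour S \<or> circ S (south r) = neighbour S \<and> circ S (far r True) = K"
    using circ_ends(1)[OF S] True by simp
  have nm: "\<not> merging ?T r"
    using T(1-3) by (cases rule: edge_cases) (use circ_ends(2)[OF S] True T(4) in auto)
  have e: "edge_coeff D ?T r t l = of_bool (\<forall>C\<in>circles D S - {K, neighbour S}. l C = t C) *
      Delta_coeff (t (K \<union> neighbour S)) (l K) (l (neighbour S))"
    using edge_coeff_split[OF T(1-3) nm refl refl, of t l] ends unfolding T(4)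
    by (elim disjE) (auto simp: Delta_coeff_commute Un_commute insert_commute)
  have lK: "l K = VM" using l unfolding cancelled_def by (simp add: True)
  have "edge_coeff D ?T r t l \<noteq> 0 \<longleftrightarrow> (toggle S, t) = collapse (S, l)"
    unfolding collapse_iff[OF S t] e of_bool_mult_nonzero lK Delta_coeff_VM by metis
  then show ?thesis using True by simp
next
  case False
  let ?T = "toggle S"
  have T: "S \<subseteq> E" "r \<in> E" "r \<notin> S" "insert r S = ?T"
    using S False in_part_E r_E by (auto simp: toggle_def in_part_def)
  have ends: "circ S (south r) = K \<and> circ S (far r False) = neighbour S \<or> circ S (south r) = neighbour S \<and> circ S (far r False) = K"
    using circ_ends(1)[OF S] False by simp
  have m: "merging S r" using circ_ends(2)[OF S] False by simp
  have e: "edge_coeff D S r l t = of_bool (\<forall>C\<in>circles D S - {K, neighbour S}. t C = l C) *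
      m_coeff (l K) (l (neighbour S)) (t (K \<union> neighbour S))"
    using edge_coeff_merge[OF T(1-3) m refl refl, of l t] ends
    by (elim disjE) (auto simp: m_coeff_commute Un_commute insert_commute)
  have lK: "l K = VP" using l unfolding cancelled_def by (simp add: False)
  have "edge_coeff D S r l t \<noteq> 0 \<longleftrightarrow> (toggle S, t) = collapse (S, l)"
    unfolding collapse_iff[OF S t] e of_bool_mult_nonzero lK m_coeff_VP ..
  then show ?thesis using False by simp
qed

lemma collapse_in_part: "x \<in> labelled_part v \<Longrightarrow> collapse x \<in> part (\<not> b)"
  using in_part_toggle[of b] in_part_E[OF in_part_toggle[of b]]
  by (auto simp: labelled_part_def part_def collapse_def)

lemma incidence_collapse:
  assumes x: "x \<in> labelled_part cancelled" and y: "y \<in> part (\<not> b)"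
  shows "(if b then incidence D y x else incidence D x y) \<noteq> 0 \<longleftrightarrow> y = collapse x"
proof -
  obtain S l where Sl: "x = (S, l)" "in_part b S" "l \<in> labels S" "l K = cancelled"
    using x by (auto simp: labelled_part_def)
  obtain T t where Tt: "y = (T, t)" "in_part (\<not> b) T" "t \<in> labels T"
    using y by (auto simp: part_def)
  show ?thesis
  proof (cases "T = toggle S")
    case True
    have "(if b then incidence D y x else incidence D x y) =
        (if b then edge_sign T r * edge_coeff D T r t l else edge_sign S r * edge_coeff D S r l t)"
      using Sl(2) Tt(2) incidence_insert[OF r_E, of T t l] incidence_insert[OF r_E, of S l t] True
      by (auto simp: Sl(1) Tt(1) in_part_def toggle_def insert_absorb simp del: incidence.simps)
    then show ?thesis
      using edge_collapse[where l = l and t = t, OF Sl(2,4)] Tt(3) True edge_sign_nonzero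
      by (auto simp: Sl(1) Tt(1) split: if_splits)
  next
    case False
    have "T \<noteq> insert r' S" if "\<not> b" for r' using False Sl(2) Tt(2) that by (auto simp: in_part_def toggle_def)
    moreover have "S \<noteq> insert r' T" if "b" for r' using False Sl(2) Tt(2) that by (auto simp: in_part_def toggle_def)
    ultimately have "(if b then incidence D y x else incidence D x y) = 0"
      unfolding Sl(1) Tt(1) by (metis incidence_nonzeroE)
    then show ?thesis using False by (auto simp: Sl(1) Tt(1) collapse_def)
  qed
qed

lemma bij_collapse: "bij_betw collapse (labelled_part cancelled) (part (\<not> b))"
  unfolding bij_betw_def
proof (intro conjI inj_onI subset_antisym subsetI)
  fix x x' assume x: "x \<in> labelled_part cancelled" "x' \<in> labelled_part cancelled" and eq: "collapse x = collapse x'"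
  obtain S l where Sl: "x = (S, l)" "in_part b S" "l \<in> labels S" "l K = cancelled"
    using x by (auto simp: labelled_part_def)
  obtain S' l' where Sl': "x' = (S', l')" "l' \<in> labels S'" "l' K = cancelled"
    using x by (auto simp: labelled_part_def)
  have "toggle S = toggle S'" using eq by (simp add: Sl Sl' collapse_def)
  then have S': "S' = S" by (metis toggle_toggle)
  obtain t where t: "collapse x = (toggle S, t)" by (simp add: Sl collapse_def)
  then have "t \<in> labels (toggle S)" using collapse_in_part[OF x(1)] by (simp add: part_def)
  note iff = collapse_iff[OF Sl(2) this]
  have 1: "(\<forall>C\<in>circles D S - {K, neighbour S}. t C = l C) \<and> t (K \<union> neighbour S) = l (neighbour S)"
    using iff[of l] t Sl by simp
  have 2: "(\<forall>C\<in>circles D S - {K, neighbour S}. t C = l' C) \<and> t (K \<union> neighbour S) = l' (neighbour S)"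
    using iff[of l'] t eq Sl' S' by simp
  have "l C = l' C" if "C \<in> circles D S" for C
    using 1 2 that Sl(4) Sl'(3) by (cases "C = K"; cases "C = neighbour S") auto
  then have "l = l'" using Sl(3) Sl'(2) S' by (intro labels_eqI[of l S l']) auto
  then show "x = x'" using Sl Sl' S' by simp
next
  fix y assume "y \<in> collapse ` labelled_part cancelled"
  then show "y \<in> part (\<not> b)" using collapse_in_part by auto
next
  fix y assume "y \<in> part (\<not> b)"
  then obtain T t where Tt: "y = (T, t)" "in_part (\<not> b) T" "t \<in> labels T" by (auto simp: part_def)
  define S where "S = toggle T"
  have S: "in_part b S" "toggle S = T" using in_part_toggle[OF Tt(2)] by (auto simp: S_def)
  define l where "l = (\<lambda>C\<in>circles D S. if C = K then cancelled
    else if C = neighbour S then t (K \<union> neighbour S) else t C)"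
  have mg: "K \<in> circles D S" "neighbour S \<in> circles D S" "K \<noteq> neighbour S"
    using mergeD[OF merge_K[OF S(1)]] by auto
  have "(toggle S, t) = collapse (S, l)"
    using collapse_iff[OF S(1), of t l] Tt(3) S(2) mg by (auto simp: l_def)
  moreover have "(S, l) \<in> labelled_part cancelled"
    using S(1) in_part_E mg by (auto simp: labelled_part_def l_def)
  ultimately show "y \<in> collapse ` labelled_part cancelled"
    using Tt(1) S(2) by (metis imageI)
qed

text \<open>\<open>K\<close> is a circle at both ends of such an edge, hence untouched by it. So the
  part with the leaf is the direct sum of two complexes, one for each label of
  \<open>K\<close>.\<close>

lemma label_preserved:
  assumes "(S, l) \<in> part b" "(T, t) \<in> part b" "incidence D (S, l) (T, t) \<noteq> 0"
  shows "t K = l K"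
proof -
  obtain r' where r': "r' \<in> E" "r' \<notin> S" "T = insert r' S" "edge_coeff D S r' l t \<noteq> 0"
    using assms(3) by (rule incidence_nonzeroE)
  then have "\<forall>C\<in>circles D S \<inter> circles D T. t C = l C"
    unfolding edge_coeff_eq by (auto split: if_splits)
  then show ?thesis using K_in_circles assms(1,2) by (auto simp: part_def)
qed

lemma part_incidence:
  assumes "(S, l) \<in> part b1" "(T, t) \<in> part b2" "incidence D (S, l) (T, t) \<noteq> 0"
  shows "b1 \<longrightarrow> b2"
  using incidence_subset[OF assms(3)] assms(1,2) by (auto simp: part_def in_part_def)

lemma part_between:
  assumes "(S, l) \<in> part b1" "(U, k) \<in> part b2" "(T, t) \<in> states D"
    "incidence D (S, l) (T, t) \<noteq> 0" "incidence D (T, t) (U, k) \<noteq> 0"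
  shows "(T, t) \<in> part (r \<in> T)"
  using incidence_subset[OF assms(4)] incidence_subset[OF assms(5)] assms(1,2,3)
  by (auto simp: part_def in_part_def states_iff)

lemma labelled_subset: "labelled_part v \<subseteq> part b"
  by (auto simp: labelled_part_def part_def)

lemma labelled_iff: "(S, l) \<in> labelled_part v \<longleftrightarrow> (S, l) \<in> part b \<and> l K = v"
  by (auto simp: labelled_part_def part_def)

lemma part_states: "part b' \<subseteq> states D"
  by (auto simp: part_def states_iff)

lemma graded_labelled_Un: "graded_complex (incidence D) delta (labelled_part v \<union> part (\<not> b))"
proof (rule graded_subcomplex)
  show "labelled_part v \<union> part (\<not> b) \<subseteq> states D" using labelled_subset part_states by blast
  fix S l T t U k
  assume S: "(S, l) \<in> labelled_part v \<union> part (\<not> b)" and U: "(U, k) \<in> labelled_part v \<union> part (\<not> b)"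
    and T: "(T, t) \<in> states D" and d: "incidence D (S, l) (T, t) \<noteq> 0" "incidence D (T, t) (U, k) \<noteq> 0"
  obtain b1 b2 where b: "(S, l) \<in> part b1" "(U, k) \<in> part b2" using S U labelled_subset by blast
  have T': "(T, t) \<in> part (r \<in> T)" using part_between[OF b T d] .
  show "(T, t) \<in> labelled_part v \<union> part (\<not> b)"
  proof (cases "(r \<in> T) = b")
    case False
    then have "(r \<in> T) = (\<not> b)" by blast
    then show ?thesis using T' by simp
  next
    case True
    note Tb = T'[unfolded True]
    \<comment> \<open>An intermediate state with the leaf has a neighbour with the leaf on the path,
      the later one if \<open>b\<close> holds and the earlier one otherwise; the label of
      \<open>K\<close> is the same there.\<close>
    have "t K = v"
    proof (cases b)
      case True
      then have "(U, k) \<in> part b" using part_incidence[OF Tb b(2) d(2)] b(2) by simp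
      moreover from this have "(U, k) \<notin> part (\<not> b)" by (auto simp: part_def in_part_def)
      ultimately show ?thesis using label_preserved[OF Tb _ d(2)] U by (auto simp: labelled_iff)
    next
      case False
      then have "(S, l) \<in> part b" using part_incidence[OF b(1) Tb d(1)] b(1) by simp
      moreover from this have "(S, l) \<notin> part (\<not> b)" by (auto simp: part_def in_part_def)
      ultimately show ?thesis using label_preserved[OF _ Tb d(1)] S by (auto simp: labelled_iff)
    qed
    then show ?thesis using Tb by (simp add: labelled_iff)
  qed
qed

lemma labelled_disjoint: "labelled_part v \<inter> part (\<not> b) = {}"
  by (auto simp: labelled_part_def part_def in_part_def)

text \<open>No free crossing other than \<open>r\<close> meets \<open>K\<close>, so its label is a
  spectator; the two labelled parts are isomorphic up to a shift.\<close>

lemma edge_coeff_relabel: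
  assumes S: "in_part b S" "in_part b (insert r' S)" "r' \<notin> S" and eq: "t K = l K"
  shows "edge_coeff D S r' (l(K := v)) (t(K := v)) = edge_coeff D S r' l t"
proof -
  have "r' \<in> B - A" "r' \<noteq> r" using S by (auto simp: in_part_def)
  then have "K \<inter> corners r' = {}" by (rule K_isolated)
  then have "circ T x \<noteq> K" if "x \<in> corners r'" for x T using that self_in_circ[of x T] by blast
  then have *: "circ T (south r') \<noteq> K" "circ T (far r' c) \<noteq> K" for T c
    using far_in_corners by (auto simp: corners_def)
  have "(\<forall>C\<in>circles D S \<inter> circles D (insert r' S). (t(K := v)) C = (l(K := v)) C) \<longleftrightarrow>
      (\<forall>C\<in>circles D S \<inter> circles D (insert r' S). t C = l C)"
    using eq by auto
  then show ?thesis unfolding edge_coeff_eq using * by (simp del: fun_upd_apply add: fun_upd_other)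
qed

lemma incidence_relabel:
  assumes "(S, l) \<in> labelled_part v" "(T, t) \<in> labelled_part v"
  shows "incidence D (S, l(K := w)) (T, t(K := w)) = incidence D (S, l) (T, t)"
proof (cases "\<exists>r'. r' \<in> E \<and> r' \<notin> S \<and> T = insert r' S")
  case True
  then obtain r' where r': "r' \<in> E" "r' \<notin> S" "T = insert r' S" by blast
  have p: "in_part b S" "in_part b (insert r' S)" "t K = l K"
    using assms r' by (auto simp: labelled_part_def)
  show ?thesis
    unfolding r'(3) incidence_insert[OF r'(1,2)] edge_coeff_relabel[where l = l and t = t, OF p(1,2) r'(2) p(3)] ..
next
  case False
  then show ?thesis by (metis incidence_nonzeroE)
qed

lemma bij_relabel: "bij_betw (\<lambda>(S, l). (S, l(K := w))) (labelled_part v) (labelled_part w)"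
  by (rule bij_betw_byWitness[of _ "\<lambda>(S, l). (S, l(K := v))"])
    (auto simp: labelled_part_def labels_upd K_in_circles)

lemma exact_relabel:
  assumes "exact (labelled_part v) g"
  shows "exact (labelled_part w) (g + (vdeg w - vdeg v))"
proof (rule exact_at_transfer[OF bij_relabel _ _ _ _ assms, where w = "\<lambda>_. 1" and k = 1])
  fix x y assume xy: "x \<in> labelled_part v" "y \<in> labelled_part v"
  then show "incidence D x y * 1 = 1 * 1 * incidence D (case x of (S, l) \<Rightarrow> (S, l(K := w))) (case y of (S, l) \<Rightarrow> (S, l(K := w)))"
    using incidence_relabel[of "fst x" "snd x" v "fst y" "snd y" w]
    by (cases x; cases y) (simp del: incidence.simps)
  obtain S l where Sl: "x = (S, l)" "K \<in> circles D S" "l K = v"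
    using xy K_in_circles by (auto simp: labelled_part_def)
  show "delta (case x of (S, l) \<Rightarrow> (S, l(K := w))) = delta x + (vdeg w - vdeg v)"
    using Sl finite_circles[of S] by (simp add: sum.remove[of _ K])
qed simp_all

lemma face_states_eq: "face_states A B = part (\<not> b) \<union> (labelled_part VP \<union> labelled_part VM)"
proof -
  have "v = VP \<or> v = VM" for v by (cases v) auto
  then show ?thesis
    using in_part_E by (auto simp: face_states_def part_def labelled_part_def in_part_def states_iff)
qed

text \<open>As in the invariance under the first Reidemeister move: the states labelled \<open>cancelled\<close> on the
  leaf circle \<open>K\<close> cancel against those of the other smoothing, which leaves the remaining labelling
  of \<open>K\<close>.\<close>

lemma exact_face_leaf:
  assumes ex: "exact (part (\<not> b)) g"
  shows "exact (face_states A B) g"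
proof (cases b)
  case True
  have c: "cancelled = VM" unfolding cancelled_def by (simp add: True)
  let ?i = "inv_into (labelled_part VM) collapse"
  have bij: "bij_betw ?i (part (\<not> b)) (labelled_part VM)"
    using bij_betw_inv_into[OF bij_collapse] by (simp add: c)
  interpret acyclic_matching "incidence D" delta "part (\<not> b)" "labelled_part VM" ?i
  proof
    show "graded_complex (incidence D) delta (part (\<not> b) \<union> labelled_part VM)"
      using graded_labelled_Un[of VM] by (simp add: Un_commute)
    show "part (\<not> b) \<inter> labelled_part VM = {}" using labelled_disjoint by auto
    show "incidence D x y = 0" if "x \<in> labelled_part VM" "y \<in> part (\<not> b)" for x y
      using part_incidence[of "fst x" "snd x" b "fst y" "snd y" "\<not> b"] that labelled_subset True
      by (cases x; cases y) (auto simp del: incidence.simps)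
    show "incidence D x y \<noteq> 0 \<longleftrightarrow> y = ?i x" if x: "x \<in> part (\<not> b)" and y: "y \<in> labelled_part VM" for x y
    proof -
      have "y = ?i x \<longleftrightarrow> x = collapse y"
        using x y bij_collapse c by (metis bij_betw_def f_inv_into_f inv_into_f_f)
      then show ?thesis using incidence_collapse[of y x] x y c True by simp
    qed
  qed (rule bij)
  \<comment> \<open>The matching lowers the degree by two, and relabelling \<open>K\<close> from
    \<open>VM\<close> to \<open>VP\<close> raises it again.\<close>
  have "exact (labelled_part VM) (g - 2)" using exact_target[of "g - 2"] ex by simp
  then have P: "exact (labelled_part VP) g" using exact_relabel[of VM "g - 2" VP] by simp
  have eq: "face_states A B = labelled_part VP \<union> (part (\<not> b) \<union> labelled_part VM)"
    unfolding face_states_eq by auto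
  show ?thesis unfolding eq
  proof (rule exact_at_Un[OF graded_face[of A B, unfolded eq] _ _ P exact_total])
    show "labelled_part VP \<inter> (part (\<not> b) \<union> labelled_part VM) = {}"
      using labelled_disjoint by (auto simp: labelled_part_def)
    fix x y assume xy: "x \<in> labelled_part VP" "y \<in> part (\<not> b) \<union> labelled_part VM"
    obtain S l where x: "x = (S, l)" "(S, l) \<in> part b" "l K = VP"
      using xy by (cases x) (auto simp: labelled_iff)
    obtain T t where y: "y = (T, t)" by (cases y) auto
    show "incidence D x y = 0"
    proof (rule ccontr)
      assume nz: "incidence D x y \<noteq> 0"
      have "(T, t) \<notin> part (\<not> b)" using part_incidence[OF x(2), of T t "\<not> b"] nz True x y by blast
      then have "(T, t) \<in> part b" "t K = VM" using xy y by (auto simp: labelled_iff)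
      then show False using label_preserved[OF x(2), of T t] nz x y by (simp del: incidence.simps)
    qed
  qed
next
  case False
  have c: "cancelled = VP" unfolding cancelled_def by (simp add: False)
  interpret acyclic_matching "incidence D" delta "labelled_part VP" "part (\<not> b)" collapse
  proof
    show "graded_complex (incidence D) delta (labelled_part VP \<union> part (\<not> b))"
      by (rule graded_labelled_Un)
    show "labelled_part VP \<inter> part (\<not> b) = {}" by (rule labelled_disjoint)
    show "incidence D x y = 0" if "x \<in> part (\<not> b)" "y \<in> labelled_part VP" for x y
      using part_incidence[of "fst x" "snd x" "\<not> b" "fst y" "snd y" b] that labelled_subset False
      by (cases x; cases y) (auto simp del: incidence.simps)
    show "bij_betw collapse (labelled_part VP) (part (\<not> b))" using bij_collapse c by simp
    show "incidence D x y \<noteq> 0 \<longleftrightarrow> y = collapse x" if "x \<in> labelled_part VP" "y \<in> part (\<not> b)" for x y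
      using incidence_collapse[of x y] that c False by simp
  qed
  \<comment> \<open>Here the matching raises the degree by two, and relabelling \<open>K\<close>
    from \<open>VP\<close> to \<open>VM\<close> lowers it again.\<close>
  have "exact (labelled_part VP) (g + 2)" using exact_source ex .
  then have M: "exact (labelled_part VM) g" using exact_relabel[of VP "g + 2" VM] by simp
  have eq: "face_states A B = (labelled_part VP \<union> part (\<not> b)) \<union> labelled_part VM"
    unfolding face_states_eq by auto
  show ?thesis unfolding eq
  proof (rule exact_at_Un[OF graded_face[of A B, unfolded eq] _ _ exact_total M])
    show "(labelled_part VP \<union> part (\<not> b)) \<inter> labelled_part VM = {}"
      using labelled_disjoint by (auto simp: labelled_part_def)
    fix x y assume xy: "x \<in> labelled_part VP \<union> part (\<not> b)" "y \<in> labelled_part VM"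
    obtain S l where x: "x = (S, l)" by (cases x) auto
    obtain T t where y: "y = (T, t)" "(T, t) \<in> part b" "t K = VM"
      using xy by (cases y) (auto simp: labelled_iff)
    show "incidence D x y = 0"
    proof (rule ccontr)
      assume nz: "incidence D x y \<noteq> 0"
      have "(S, l) \<notin> part (\<not> b)" using part_incidence[OF _ y(2), of S l "\<not> b"] nz False x y by blast
      then have "(S, l) \<in> part b" "l K = VP" using xy x by (auto simp: labelled_iff)
      then show False using label_preserved[OF _ y(2), of S l] nz x y by (simp del: incidence.simps)
    qed
  qed
qed

end

context alternating_diagram
begin

section \<open>Existence of leaves and induction over the faces\<close>

definition conn_face :: "(nat \<Rightarrow> bool set) \<Rightarrow> bool" where
  "conn_face \<sigma> \<longleftrightarrow> (\<forall>x\<in>points D. \<forall>y\<in>points D. (x, y) \<in> Con \<sigma>)"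

lemma face_upd: "r \<in> B \<Longrightarrow> r \<notin> A \<Longrightarrow> (face A B)(r := {b}) = (if b then face (insert r A) B else face A (B - {r}))"
  by (auto simp: face_def fun_eq_iff)

text \<open>Otherwise gluing the two arcs of \<open>r\<close> would not lead out of
  \<open>K\<close>, and \<open>K\<close> would be everything by connectedness.\<close>

lemma component_corner:
  assumes conn: "conn_face \<sigma>" and r: "r \<in> E" "\<sigma> r = UNIV"
    and x: "x \<in> points D" and K: "K = Con (\<sigma>(r := {b})) `` {x}" "K \<noteq> points D"
  shows "south r \<in> K \<longleftrightarrow> far r b \<notin> K"
proof (rule ccontr)
  assume neg: "\<not> ?thesis"
  let ?\<tau> = "\<sigma>(r := {b})"
  have closed: "u \<in> K \<longleftrightarrow> v \<in> K" if "(u, v) \<in> Con ?\<tau>" for u v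
    using that unfolding K(1) by (auto intro: conn_trans conn_sym)
  have fc: "Con \<sigma> = conn (insert (south r, far r b) (Rel ?\<tau>))"
    using Con_free[OF r(1), of \<sigma> b] r(2) by (metis fun_upd_triv)
  have "y \<in> K" if y: "y \<in> points D" for y
  proof (rule conn_closed)
    show "(x, y) \<in> conn (insert (south r, far r b) (Rel ?\<tau>))"
      using conn x y fc unfolding conn_face_def by blast
    show "x \<in> K" using K by simp
    show "u \<in> K \<longleftrightarrow> v \<in> K" if "(u, v) \<in> insert (south r, far r b) (Rel ?\<tau>)" for u v
      using that closed[of u v] neg conn_base[of u v "Rel ?\<tau>"] by blast
  qed
  moreover have "K \<subseteq> points D" using Con_points x unfolding K(1) by blast
  ultimately show False using K(2) by blast
qed

text \<open>Among the components cut off by a smoothing of a free crossing, one of least size is a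
  leaf: another free crossing on it would cut off a smaller one, on its side away from
  \<open>r\<close>.\<close>

lemma exists_leaf:
  assumes AB: "A \<subseteq> B" "B \<subseteq> E" "A \<noteq> B" and conn: "conn_face (face A B)"
    and nug: "\<And>r. r \<in> B - A \<Longrightarrow> \<exists>b. \<not> conn_face ((face A B)(r := {b}))"
  obtains r b K where "leaf D A B r b K" "conn_face ((face A B)(r := {\<not> b}))"
proof -
  let ?\<sigma> = "face A B"
  have free: "?\<sigma> r = UNIV" if "r \<in> B - A" for r using that by (auto simp: face_def)
  define Q where "Q = (\<lambda>(r, b, x). r \<in> B - A \<and> x \<in> points D \<and> Con (?\<sigma>(r := {b})) `` {x} \<noteq> points D)"
  define size where "size = (\<lambda>(r, b, x). card (Con (?\<sigma>(r := {b})) `` {x}))"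
  have sep: "\<exists>x\<in>points D. \<exists>y\<in>points D. (x, y) \<notin> Con (?\<sigma>(r := {b}))" if "\<not> conn_face (?\<sigma>(r := {b}))" for r b
    using that by (auto simp: conn_face_def)
  obtain r0 where r0: "r0 \<in> B - A" using AB by blast
  obtain b0 where "\<not> conn_face (?\<sigma>(r0 := {b0}))" using nug[OF r0] by blast
  then obtain x0 y0 where "x0 \<in> points D" "y0 \<in> points D" "(x0, y0) \<notin> Con (?\<sigma>(r0 := {b0}))"
    using sep by blast
  then have "Q (r0, b0, x0)" using r0 unfolding Q_def by auto
  then obtain m where "Q m" and min: "\<And>m'. Q m' \<Longrightarrow> size m \<le> size m'"
    using ex_has_least_nat[of Q _ size] by blast
  then obtain r b x where rbx: "m = (r, b, x)" "r \<in> B - A" "x \<in> points D" "Con (?\<sigma>(r := {b})) `` {x} \<noteq> points D"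
    by (cases m) (auto simp: Q_def)
  define K where "K = Con (?\<sigma>(r := {b})) `` {x}"
  let ?\<tau> = "?\<sigma>(r := {b})"
  have rE: "r \<in> E" using rbx AB by auto
  have Kx: "x \<in> K" by (simp add: K_def)
  have KD: "K \<subseteq> points D" using Con_points rbx(3) unfolding K_def by blast
  have closed: "v \<in> K" if "(u, v) \<in> Rel ?\<tau>" "u \<in> K" for u v
    using that conn_base[OF that(1)] unfolding K_def by (auto intro: conn_trans)
  have closed': "u \<in> K" if "(u, v) \<in> Rel ?\<tau>" "v \<in> K" for u v
    using that conn_base[OF that(1)] unfolding K_def by (auto intro: conn_trans conn_sym)
  have corner: "south r \<in> K \<longleftrightarrow> far r b \<notin> K"
    using component_corner[OF conn rE free[OF rbx(2)] rbx(3) K_def] rbx(4) by (simp add: K_def)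
  have iso: "K \<inter> corners r' = {}" if r': "r' \<in> B - A" "r' \<noteq> r" for r'
  proof (rule ccontr)
    assume ne: "K \<inter> corners r' \<noteq> {}"
    have r'E: "r' \<in> E" using r' AB by auto
    have arcs': "arcs r' c \<subseteq> Rel ?\<tau>" for c
      using r' free[OF r'(1)] by (intro arcs_Rel[OF r'E]) simp
    have edges: "(south r', far r' c) \<in> Rel ?\<tau>" "(far r' c, north r') \<in> Rel ?\<tau>" for c
      using arcs'[of "\<not> c"] arcs'[of c] by (auto simp: arcs_def)
    \<comment> \<open>\<open>r'\<close> is unresolved in \<open>?\<tau>\<close>, so \<open>K\<close>
      contains all of its corners or none.\<close>
    have all': "corners r' \<subseteq> K"
    proof -
      obtain z where z: "z \<in> corners r'" "z \<in> K" using ne by blast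
      have "south r' \<in> K"
        using z closed'[OF edges(1)] closed'[OF edges(2)] unfolding corners_def by blast
      then show ?thesis using closed[OF edges(1)] closed[OF edges(2)] unfolding corners_def by blast
    qed
    obtain b' where "\<not> conn_face (?\<sigma>(r' := {b'}))" using nug[OF r'(1)] by blast
    then obtain x1 y1 where xy: "x1 \<in> points D" "y1 \<in> points D" "(x1, y1) \<notin> Con (?\<sigma>(r' := {b'}))"
      using sep by blast
    let ?\<tau>' = "?\<sigma>(r' := {b'})"
    \<comment> \<open>Of the several components one avoids \<open>south r\<close>; as
      \<open>r\<close> is unresolved in \<open>?\<tau>'\<close>, it avoids all corners of
      \<open>r\<close>.\<close>
    have "\<exists>z\<in>points D. (z, south r) \<notin> Con ?\<tau>'"
      using xy conn_trans[OF _ conn_sym] by metis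
    then obtain z where z: "z \<in> points D" "(z, south r) \<notin> Con ?\<tau>'" by blast
    define K' where "K' = Con ?\<tau>' `` {z}"
    have K'D: "K' \<subseteq> points D" using Con_points z(1) unfolding K'_def by blast
    have sr: "south r \<notin> K'" using z by (simp add: K'_def)
    have "south r \<in> points D" using corner_points[OF rE] by simp
    then have K'ne: "K' \<noteq> points D" using sr by auto
    have closedK': "u \<in> K' \<longleftrightarrow> v \<in> K'" if "(u, v) \<in> Rel ?\<tau>'" for u v
      using conn_base[OF that] unfolding K'_def by (auto intro: conn_trans conn_sym)
    have arcs: "arcs r c \<subseteq> Rel ?\<tau>'" for c
      using r'(2) free[OF rbx(2)] by (intro arcs_Rel[OF rE]) simp
    have off: "far r c \<notin> K'" "north r \<notin> K'" for c
      using closedK'[of "south r" "far r c"] closedK'[of "far r c" "north r"] arcs[of c] arcs[of "\<not> c"] sr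
      by (auto simp: arcs_def)
    then have noc: "corners r \<inter> K' = {}" using sr by (auto simp: corners_def)
    have "south r' \<in> K' \<longleftrightarrow> far r' b' \<notin> K'"
      using component_corner[OF conn r'E free[OF r'(1)] z(1) K'_def K'ne] .
    then obtain z' where z': "z' \<in> corners r'" "z' \<in> K'"
      using far_in_corners[of r' b'] by (auto simp: corners_def)
    have sub: "Rel ?\<tau>' \<subseteq> Rel ?\<tau> \<union> (\<Union>c. arcs r c)"
    proof -
      have "Rel ?\<tau>' \<subseteq> Rel ?\<sigma>"
        using free[OF r'(1)] by (intro Rel_mono) (auto simp: fun_upd_def)
      also have "Rel ?\<sigma> = Rel (?\<sigma>(r := UNIV))" using free[OF rbx(2)] by (metis fun_upd_triv)
      also have "\<dots> \<subseteq> Rel ?\<tau> \<union> (\<Union>c. arcs r c)"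
        unfolding Rel_upd[OF rE, of _ UNIV] Rel_upd[OF rE, of _ "{b}"] by blast
      finally show ?thesis .
    qed
    \<comment> \<open>Away from the arcs of \<open>r\<close>, the connections of
      \<open>?\<tau>'\<close> are among those of \<open>?\<tau>\<close>, so \<open>K'\<close> cannot
      leave \<open>K\<close>.\<close>
    have "y \<in> K \<inter> K'" if "y \<in> K'" for y
    proof (rule conn_closed)
      show "(z', y) \<in> Con ?\<tau>'"
        using z'(2) that unfolding K'_def by (auto intro: conn_trans conn_sym)
      show "z' \<in> K \<inter> K'" using z' all' by blast
      fix u v assume uv: "(u, v) \<in> Rel ?\<tau>'"
      have K': "u \<in> K' \<longleftrightarrow> v \<in> K'" using closedK'[OF uv] .
      show "u \<in> K \<inter> K' \<longleftrightarrow> v \<in> K \<inter> K'"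
      proof (cases "u \<in> K'")
        case True
        have "(u, v) \<notin> arcs r c" for c
          using True sr off(1) by (auto simp: arcs_def)
        then have "(u, v) \<in> Rel ?\<tau>" using sub uv by blast
        then show ?thesis using K' closed closed' by blast
      qed (use K' in blast)
    qed
    then have "K' \<subseteq> K" by blast
    moreover have "K \<inter> corners r \<noteq> {}"
      using corner far_in_corners[of r b] by (auto simp: corners_def)
    ultimately have "K' \<subset> K" using noc by blast
    then have "card K' < card K" using KD finite_points by (meson finite_subset psubset_card_mono)
    moreover have "Q (r', b', z)" using r' z K'ne by (simp add: Q_def K'_def)
    then have "card K \<le> card K'" using min[of "(r', b', z)"] by (simp add: size_def rbx(1) K_def K'_def)
    ultimately show False by simp
  qed
  \<comment> \<open>Inside \<open>K\<close> nothing is left to resolve, so its connections are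
    present at every vertex of the face with this smoothing of \<open>r\<close>.\<close>
  have circle: "K \<in> circles D S" if S: "A \<subseteq> S" "S \<subseteq> B" "(r \<in> S) = b" for S
  proof -
    have "circ S x = K"
    proof (intro subset_antisym subsetI)
      have "Con (vertex S) \<subseteq> Con ?\<tau>" using S by (intro Con_mono) (auto simp: face_def)
      then show "y \<in> K" if "y \<in> circ S x" for y using that by (auto simp: circle_of_eq K_def)
      fix y assume "y \<in> K"
      have "y \<in> {w \<in> K. (x, w) \<in> Con (vertex S)}"
      proof (rule conn_closed)
        show "(x, y) \<in> Con ?\<tau>" using \<open>y \<in> K\<close> by (simp add: K_def)
        show "x \<in> {w \<in> K. (x, w) \<in> Con (vertex S)}" using Kx by simp
        fix u v assume uv: "(u, v) \<in> Rel ?\<tau>"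
        have K: "u \<in> K \<longleftrightarrow> v \<in> K" using closed[OF uv] closed'[OF uv] by blast
        show "u \<in> {w \<in> K. (x, w) \<in> Con (vertex S)} \<longleftrightarrow> v \<in> {w \<in> K. (x, w) \<in> Con (vertex S)}"
        proof (cases "u \<in> K")
          case True
          have "(u, v) \<in> Rel (vertex S)"
          proof (cases "(u, v) \<in> joins D")
            case True
            then show ?thesis by (simp add: Rel_def)
          next
            case False
            then obtain q c where q: "q \<in> E" "c \<in> ?\<tau> q" "(u, v) \<in> arcs q c"
              using uv unfolding Rel_def by blast
            have "u \<in> corners q" using q(3) far_in_corners[of q] by (auto simp: arcs_def corners_def)
            then have "q = r \<or> q \<notin> B - A" using iso \<open>u \<in> K\<close> by blast
            then have "c \<in> vertex S q" using q(2) S by (auto simp: face_def split: if_splits)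
            then show ?thesis using q arcs_Rel[OF q(1)] by blast
          qed
          then have "(u, v) \<in> Con (vertex S)" by (rule conn_base)
          then show ?thesis using K by (auto intro: conn_trans conn_sym)
        qed (use K in simp)
      qed
      then show "y \<in> circ S x" by (simp add: circle_of_eq)
    qed
    then show ?thesis using circ_in_circles[OF rbx(3), of S] by simp
  qed
  have "leaf D A B r b K"
    using rbx(2) circle iso corner AB(2) by unfold_locales auto
  \<comment> \<open>Switching a separating smoothing amounts to gluing its arcs, which gives the
    same components as the unresolved crossing.\<close>
  moreover have "conn_face (?\<sigma>(r := {\<not> b}))"
  proof -
    have "(south r, far r b) \<notin> Con ?\<tau>"
    proof
      assume c: "(south r, far r b) \<in> Con ?\<tau>"
      then have "south r \<in> K \<longleftrightarrow> far r b \<in> K" unfolding K_def by (auto intro: conn_trans conn_sym)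
      then show False using corner by simp
    qed
    then have "Con (?\<sigma>(r := {\<not> b})) = conn (insert (south r, far r b) (Rel ?\<tau>))"
      by (rule Con_switch[OF rE, rotated]) (auto simp: face_def)
    also have "\<dots> = Con ?\<sigma>"
      using Con_free[OF rE, of ?\<sigma> b] free[OF rbx(2)] by (metis fun_upd_triv)
    finally show ?thesis using conn by (simp add: conn_face_def)
  qed
  ultimately show ?thesis using that by blast
qed

lemma exact_face:
  assumes "A \<subseteq> B" "B \<subseteq> E" "conn_face (face A B)" and g: "g \<noteq> - V" "g \<noteq> 2 - V"
  shows "exact (face_states A B) g"
  using assms(1-3)
proof (induction "card (B - A)" arbitrary: A B rule: less_induct)
  case less
  have finB: "finite B" using less(3) finite_subset by blast
  have smaller: "exact (if b then face_states (insert r A) B else face_states A (B - {r})) g"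
    if r: "r \<in> B - A" and c: "conn_face ((face A B)(r := {b}))" for r b
  proof -
    have "B - insert r A \<subset> B - A" "B - {r} - A \<subset> B - A" using r by auto
    then have "card (B - insert r A) < card (B - A)" "card (B - {r} - A) < card (B - A)"
      using finB psubset_card_mono[of "B - A"] by blast+
    moreover have "conn_face (if b then face (insert r A) B else face A (B - {r}))"
      using c r by (simp add: face_upd split: if_splits)
    ultimately show ?thesis using less.hyps[of B "insert r A"] less.hyps[of "B - {r}" A] less.prems r
      by (cases b) auto
  qed
  show ?case
  proof (cases "A = B")
    case True
    have con: "(x, y) \<in> Con (vertex A)" if "x \<in> points D" "y \<in> points D" for x y
      using less.prems(3) that True by (simp add: conn_face_def)
    have card: "int (card A) = V - 1" using single_circle[of A] con less.prems True by simp
    obtain p where p: "p \<in> points D" using points_nonempty by auto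
    then have "circ A x = circ A p" if "x \<in> points D" for x
      using con that by (simp add: circle_of_eq_iff)
    then have "circles D A = {circ A p}" using p unfolding circles_def by blast
    \<comment> \<open>The circle contributes \<open>1\<close> or \<open>- 1\<close>, from which the
      number \<open>V - 1\<close> of 1-smoothings is subtracted: the origin of the two exceptional
      degrees.\<close>
    then have "delta (A, l) = vdeg (l (circ A p)) + 1 - V" for l using card by simp
    then have "delta (A, l) = 2 - V \<or> delta (A, l) = - V" for l by (cases "l (circ A p)") auto
    then have "c = (\<lambda>_. 0)" if "supported delta (face_states A B) g c" for c
      using that g True by (fastforce simp: supported_def face_states_def)
    then show ?thesis unfolding exact_at_def
      by (auto intro!: exI[of _ "\<lambda>_. 0"] simp: supported_def bdry_def)
  next
    case False
    show ?thesis
    proof (cases "\<exists>r\<in>B - A. \<forall>b. conn_face ((face A B)(r := {b}))")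
      case True
      then obtain r where r: "r \<in> B - A" "\<And>b. conn_face ((face A B)(r := {b}))" by blast
      show ?thesis
        using exact_face_split[of A B r g] smaller[OF r, of True] smaller[OF r, of False] r less.prems by simp
    next
      case nug: False
      obtain r b K where leaf: "leaf D A B r b K" and c: "conn_face ((face A B)(r := {\<not> b}))"
        using exists_leaf[OF less.prems(1,2) False less.prems(3)] nug by blast
      interpret leaf D A B r b K by (rule leaf)
      have "part (\<not> b) = (if \<not> b then face_states (insert r A) B else face_states A (B - {r}))"
        using r_free by (auto simp: part_def face_states_def in_part_def states_iff)
      then show ?thesis
        using exact_face_leaf smaller[of r "\<not> b"] c r_free by simp
    qed
  qed
qed

section \<open>Return to the bigraded homology\<close>

lemma exact_states:
  assumes "g \<noteq> - V" "g \<noteq> 2 - V"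
  shows "exact (states D) g"
proof -
  have "face_states {} E = states D" by (auto simp: face_states_def states_iff)
  then show ?thesis using exact_face[of "{}" E g] assms connected by (simp add: conn_face_def)
qed

lemma quantum_deg_eq: "quantum_deg D x = delta x + 2 * hom_deg D x + int (n_plus D)"
  by (cases x) simp

lemma cycle_is_boundary:
  assumes c: "c \<in> cycles D i j"
    and g: "j - 2 * i - int (n_plus D) \<noteq> - V" "j - 2 * i - int (n_plus D) \<noteq> 2 - V"
  shows "c \<in> boundaries D i j"
proof -
  let ?g = "j - 2 * i - int (n_plus D)"
  have chain: "x \<in> states D \<and> hom_deg D x = i \<and> quantum_deg D x = j" if "c x \<noteq> 0" for x
    using c that unfolding cycles_def chains_def by blast
  have diff: "differential D b y = bdry (incidence D) (states D) b y" if "y \<in> states D" for b y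
    using that by (simp add: differential_def bdry_def)
  have "supported delta (states D) ?g c"
    using chain quantum_deg_eq unfolding supported_def by fastforce
  moreover have "bdry (incidence D) (states D) c y = 0" if "y \<in> states D" for y
    using c diff[OF that, of c] by (simp add: cycles_def)
  ultimately obtain b where b: "supported delta (states D) (?g + 2) b"
    "\<And>y. y \<in> states D \<Longrightarrow> bdry (incidence D) (states D) b y = c y"
    using exact_states[OF g] unfolding exact_at_def by blast
  \<comment> \<open>\<open>b\<close> is homogeneous only for \<open>delta\<close>. As the
    differential raises \<open>hom_deg\<close> by one, only its part in degree \<open>i - 1\<close>
    meets \<open>c\<close>.\<close>
  define b' where "b' = (\<lambda>x. if hom_deg D x = i - 1 then b x else 0)"
  have hom: "hom_deg D y = hom_deg D x + 1" if nz: "incidence D x y \<noteq> 0" and x: "x \<in> states D" for x y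
  proof -
    obtain S l T t where eq: "x = (S, l)" "y = (T, t)" by (cases x; cases y) auto
    obtain r where "r \<notin> S" "T = insert r S" using nz unfolding eq by (blast elim: incidence_nonzeroE)
    moreover have "finite S" using x eq finite_subset by (auto simp: states_iff)
    ultimately show ?thesis by (simp add: eq)
  qed
  have "b' \<in> chains D (i - 1) j"
    unfolding chains_def
  proof (intro CollectI allI impI)
    fix x assume "b' x \<noteq> 0"
    then have x: "hom_deg D x = i - 1" "b x \<noteq> 0" by (auto simp: b'_def split: if_splits)
    then have "x \<in> states D" "delta x = ?g + 2" using b(1) unfolding supported_def by blast+
    then show "x \<in> states D \<and> hom_deg D x = i - 1 \<and> quantum_deg D x = j"
      using x(1) quantum_deg_eq[of x] by linarith
  qed
  moreover have "differential D b' y = c y" for y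
  proof (cases "y \<in> states D")
    case True
    have "bdry (incidence D) (states D) b' y = (if hom_deg D y = i then bdry (incidence D) (states D) b y else 0)"
    proof -
      have "incidence D x y * b' x = (if hom_deg D y = i then incidence D x y * b x else 0)"
        if "x \<in> states D" for x
        using hom[of x y] that unfolding b'_def by (cases "incidence D x y = 0") auto
      then show ?thesis unfolding bdry_def by simp
    qed
    also have "\<dots> = c y" using b(2)[OF True] chain[of y] by auto
    finally show ?thesis using diff[OF True] by simp
  next
    case False
    then show ?thesis using chain[of y] by (auto simp: differential_def)
  qed
  then have "differential D b' = c" by (rule ext)
  ultimately show ?thesis unfolding boundaries_def by blast
qed

theorem khovanov_thin:
  assumes "khovanov_homology D i j \<noteq> {khovanov_zero D i j}"
  shows "j = 2 * i + int (n_plus D) - V \<or> j = 2 * i + int (n_plus D) - V + 2"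
proof (rule ccontr)
  assume neg: "\<not> ?thesis"
  have bd: "c \<in> boundaries D i j" if "c \<in> cycles D i j" for c
    by (rule cycle_is_boundary[OF that]) (use neg in auto)
  have zero: "(\<lambda>_. 0) \<in> cycles D i j"
    by (auto simp: cycles_def chains_def differential_def)
  have "(\<lambda>x. c x - c' x) \<in> cycles D i j" if "c \<in> cycles D i j" "c' \<in> cycles D i j" for c c'
  proof -
    have "differential D (\<lambda>x. c x - c' x) y = differential D c y - differential D c' y" for y
      by (simp add: differential_def algebra_simps sum_subtractf)
    moreover have "x \<in> states D \<and> hom_deg D x = i \<and> quantum_deg D x = j" if "c x - c' x \<noteq> 0" for x
    proof -
      have "c x \<noteq> 0 \<or> c' x \<noteq> 0" using that by auto
      then show ?thesis
        using \<open>c \<in> cycles D i j\<close> \<open>c' \<in> cycles D i j\<close> unfolding cycles_def chains_def by blast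
    qed
    moreover have "differential D c = (\<lambda>_. 0)" "differential D c' = (\<lambda>_. 0)"
      using that by (simp_all add: cycles_def)
    ultimately show ?thesis unfolding cycles_def chains_def by auto
  qed
  then have "homologous D i j = cycles D i j \<times> cycles D i j"
    using bd by (auto simp: homologous_def)
  then have "khovanov_homology D i j = {khovanov_zero D i j}"
    using zero by (auto simp: khovanov_homology_def khovanov_zero_def quotient_def)
  then show False using assms by simp
qed

end


section \<open>Weaving links\<close>

text \<open>The Turaev bound is sharp, so lower bounds for the two circle numbers that add up to
  \<open>n_crossings D + 2\<close> are already equalities.\<close>

lemma (in alternating_diagram) card_circles_sum:
  "card (circles D {}) + card (circles D E) = n_crossings D + 2"
proof -
  have "ncomp (face {} E) = 1" using connected by (rule ncomp_one)
  then show ?thesis using rank_eq[of E] by (simp add: rank_def ncomp_vertex)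
qed

lemma length_filter_concat_replicate:
  "length (filter P (concat (replicate q xs))) = q * length (filter P xs)"
  by (induction q) auto

lemma length_filter_odd: "length (filter odd [1..<2 * k + 1]) = k"
  by (induction k) auto

text \<open>A discrete intermediate value theorem, which will find a height at which a given number
  of letters has been passed.\<close>

lemma attains_value:
  fixes f :: "nat \<Rightarrow> nat"
  assumes "f 0 = 0" "\<And>t. f (Suc t) \<le> Suc (f t)" "i \<le> f m"
  shows "\<exists>t\<le>m. f t = i"
  using assms(3)
proof (induction m)
  case 0
  then show ?case using assms(1) by auto
next
  case (Suc m)
  show ?case
  proof (cases "i \<le> f m")
    case True
    then show ?thesis using Suc.IH le_SucI by blast
  next
    case False
    then have "i = f (Suc m)" using Suc.prems assms(2)[of m] by simp
    then show ?thesis by blast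
  qed
qed

locale weaving_braid =
  fixes p n :: nat
  assumes p: "p \<ge> 2" and n: "n \<ge> 1"
begin

section \<open>The closed braid as a connected link diagram\<close>

abbreviation "w \<equiv> weaving_word p n"
abbreviation "W \<equiv> weaving p n"
abbreviation "N \<equiv> length (weaving_word p n)"

definition letter :: "nat \<Rightarrow> nat" where
  "letter t = fst (w ! t)"

lemma letter_range:
  assumes "t < N" shows "1 \<le> letter t" "letter t < p" "snd (w ! t) = odd (letter t)"
proof -
  have "w ! t \<in> set w" using assms by simp
  then have "w ! t \<in> (\<lambda>s. (s, odd s)) ` {1..<p}" by (auto simp: weaving_word_def split: if_splits)
  then show "1 \<le> letter t" "letter t < p" "snd (w ! t) = odd (letter t)"
    by (auto simp: letter_def)
qed

lemma length_word: "N = n * (p - 1)"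
  using length_filter_concat_replicate[of "\<lambda>_. True" n "map (\<lambda>s. (s, odd s)) [1..<p]"]
  by (simp add: weaving_word_def)

lemma card_letter:
  assumes "1 \<le> a" "a < p" shows "card {t. t < N \<and> letter t = a} = n"
proof -
  have "length (filter (\<lambda>x. fst x = a) (map (\<lambda>s. (s, odd s)) [1..<p])) = card ({x. fst x = a} \<inter> (\<lambda>s. (s, odd s)) ` {1..<p})"
    by (subst distinct_length_filter) (auto simp: distinct_map inj_on_def)
  also have "{x. fst x = a} \<inter> (\<lambda>s. (s, odd s)) ` {1..<p} = {(a, odd a)}" using assms by auto
  finally have "length (filter (\<lambda>x. fst x = a) w) = n"
    unfolding weaving_word_def length_filter_concat_replicate by simp
  then show ?thesis by (simp add: length_filter_conv_card letter_def)
qed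

lemma points_W: "points W = {1..p} \<times> {0..N}"
  by (simp add: weaving_def braid_closure_def)

lemma joins_W: "joins W = {((s, t), (s, t + 1)) | s t. s \<in> {1..p} \<and> t < N \<and> s \<noteq> letter t \<and> s \<noteq> letter t + 1} \<union>
    {((s, N), (s, 0)) | s. s \<in> {1..p}}"
  by (simp add: weaving_def braid_closure_def letter_def)

lemma n_crossings_W: "n_crossings W = N"
  by (simp add: weaving_def braid_closure_def n_crossings_def)

lemma crossing_W:
  assumes "t < N"
  shows "crossings W ! t = \<lparr>positive = odd (letter t), sw = (letter t, t), se = (letter t + 1, t),
    nw = (letter t, t + 1), ne = (letter t + 1, t + 1)\<rparr>"
  using assms letter_range(3)[OF assms] by (simp add: weaving_def braid_closure_def letter_def)

lemma n_plus_W: "n_plus W = n * length (filter odd [1..<p])"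
proof -
  have "n_plus W = length (filter (\<lambda>t. snd (w ! t)) [0..<N])"
    by (simp add: n_plus_def weaving_def braid_closure_def filter_map o_def)
  also have "\<dots> = length (filter snd (map ((!) w) [0..<N]))" by (simp only: filter_map length_map o_def)
  also have "map ((!) w) [0..<N] = w" by (rule map_nth)
  finally show ?thesis
    unfolding weaving_word_def length_filter_concat_replicate by (simp add: filter_map o_def)
qed

sublocale link_diagram W
proof
  show "finite (points W)" by (simp add: points_W)
  show "joins W \<subseteq> points W \<times> points W" by (auto simp: joins_W points_W)
  show "{sw c, se c, nw c, ne c} \<subseteq> points W" if c: "c \<in> set (crossings W)" for c
  proof -
    obtain t where t: "t < N" "c = crossings W ! t"
      using c n_crossings_W by (metis in_set_conv_nth n_crossings_def)
    then show ?thesis using letter_range[OF t(1)] by (auto simp: crossing_W points_W)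
  qed
  fix x assume "x \<in> points W"
  then obtain s t where x: "x = (s, t)" "1 \<le> s" "s \<le> p" "t \<le> N" by (auto simp: points_W)
  have delta: "(\<Sum>r<N. f r) = (if u < N then f u else 0)" if "\<And>r. r < N \<Longrightarrow> r \<noteq> u \<Longrightarrow> f r = 0"
    for f :: "nat \<Rightarrow> nat" and u
  proof -
    have "(\<Sum>r<N. f r) = (\<Sum>r<N. if r = u then f u else 0)" using that by (intro sum.cong) auto
    then show ?thesis by simp
  qed
  show "card {y. (x, y) \<in> joins W} + (\<Sum>r<n_crossings W. of_bool (sw (crossings W ! r) = x) + of_bool (se (crossings W ! r) = x)) = 1"
  proof -
    have "{y. (x, y) \<in> joins W} = (if t = N then {(s, 0)}
        else if s \<noteq> letter t \<and> s \<noteq> letter t + 1 then {(s, t + 1)} else {})"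
      using x by (auto simp: joins_W)
    moreover have "(\<Sum>r<N. of_bool (sw (crossings W ! r) = x) + of_bool (se (crossings W ! r) = x)) =
        (if t < N then of_bool (letter t = s) + of_bool (letter t + 1 = s) else 0 :: nat)"
      by (subst delta[of t]) (auto simp: crossing_W x)
    ultimately show ?thesis using x by (auto simp: n_crossings_W)
  qed
  show "card {y. (y, x) \<in> joins W} + (\<Sum>r<n_crossings W. of_bool (nw (crossings W ! r) = x) + of_bool (ne (crossings W ! r) = x)) = 1"
  proof -
    have "{y. (y, x) \<in> joins W} = (if t = 0 then {(s, N)}
        else if s \<noteq> letter (t - 1) \<and> s \<noteq> letter (t - 1) + 1 then {(s, t - 1)} else {})"
      using x by (auto simp: joins_W)
    moreover have "(\<Sum>r<N. of_bool (nw (crossings W ! r) = x) + of_bool (ne (crossings W ! r) = x)) =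
        (if t \<noteq> 0 then of_bool (letter (t - 1) = s) + of_bool (letter (t - 1) + 1 = s) else 0 :: nat)"
    proof (cases t)
      case 0
      then show ?thesis by (auto simp: crossing_W x)
    next
      case (Suc u)
      then show ?thesis using x(4) by (subst delta[of u]) (auto simp: crossing_W x)
    qed
    ultimately show ?thesis using x by (auto simp: n_crossings_W)
  qed
qed

lemma connected_W:
  assumes "x \<in> points W" "y \<in> points W"
  shows "(x, y) \<in> conn (Rel (face {} {..<n_crossings W}))"
proof -
  let ?R = "Rel (face {} {..<n_crossings W})"
  have arcs: "arcs t b \<subseteq> ?R" if "t < N" for t b
    using that by (intro arcs_Rel) (auto simp: face_def n_crossings_W)
  have jn: "joins W \<subseteq> ?R" by (auto simp: Rel_def)
  have south_far: "(south t, far t b) \<in> ?R" "(far t b, north t) \<in> ?R" if "t < N" for t b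
    using arcs[OF that, of "\<not> b"] arcs[OF that, of b] by (auto simp: arcs_def)
  have up: "((s, t), (s, t + 1)) \<in> ?R" if "s \<in> {1..p}" "t < N" for s t
  proof -
    consider "s \<noteq> letter t \<and> s \<noteq> letter t + 1" | "s = letter t" | "s = letter t + 1" by blast
    then show ?thesis
    proof cases
      case 1
      then have "((s, t), (s, t + 1)) \<in> joins W" using that by (auto simp: joins_W)
      then show ?thesis using jn by blast
    next
      case 2
      \<comment> \<open>This Boolean makes \<open>far\<close> the corner \<open>nw\<close> for
        either sign; its negation, in the next case, gives \<open>se\<close>.\<close>
      then show ?thesis using south_far(1)[OF that(2), of "odd (letter t)"] that(2)
        by (simp add: south_def far_def crossing_W)
    next
      case 3
      then show ?thesis using south_far(2)[OF that(2), of "even (letter t)"] that(2)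
        by (simp add: north_def far_def crossing_W)
    qed
  qed
  have col: "((s, 0), (s, t)) \<in> conn ?R" if "s \<in> {1..p}" "t \<le> N" for s t
    using that(2)
  proof (induction t)
    case (Suc t)
    then show ?case using conn_trans[OF _ conn_base[OF up[OF that(1), of t]]] by simp
  qed simp
  \<comment> \<open>Adjacent columns are linked at a crossing, since each letter occurs
    \<open>n \<ge> 1\<close> times.\<close>
  have row: "((1, 0), (s, 0)) \<in> conn ?R" if "1 \<le> s" "s \<le> p" for s
    using that
  proof (induction s rule: nat_induct_at_least)
    case (Suc s)
    then have s: "s < p" "1 \<le> s" by auto
    then have "card {t. t < N \<and> letter t = s} \<noteq> 0" using card_letter n by simp
    then obtain t where t: "t < N" "letter t = s" by (metis (mono_tags, lifting) card.empty empty_Collect_eq)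
    have "((s, t), (s + 1, t)) \<in> ?R"
      using south_far(1)[OF t(1), of "even (letter t)"] t by (simp add: south_def far_def crossing_W)
    then have "((s, t), (s + 1, t)) \<in> conn ?R" by (rule conn_base)
    moreover have "((s, 0), (s, t)) \<in> conn ?R" "((s + 1, 0), (s + 1, t)) \<in> conn ?R"
      using col[of s t] col[of "s + 1" t] s t by auto
    ultimately have "((s, 0), (Suc s, 0)) \<in> conn ?R" by (auto intro: conn_trans conn_sym)
    then show ?case using Suc.IH s by (auto intro: conn_trans)
  qed simp
  have "((1, 0), z) \<in> conn ?R" if zW: "z \<in> points W" for z
  proof -
    obtain s t where z: "z = (s, t)" "1 \<le> s" "s \<le> p" "t \<le> N" using zW by (auto simp: points_W)
    then show ?thesis using conn_trans[OF row[of s] col[of s t]] by simp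
  qed
  then show ?thesis using assms by (blast intro: conn_trans conn_sym)
qed

text \<open>The smoothing in which every letter \<open>a\<close> with \<open>a + e\<close> even is cut horizontally joins the
  columns in pairs \<open>2 m - e\<close>, \<open>2 m - e + 1\<close>; a circle in such a pair lies between two
  consecutive occurrences of the letter \<open>2 m - e\<close>.\<close>

definition passed :: "nat \<Rightarrow> nat \<Rightarrow> nat \<Rightarrow> nat" where
  "passed e m t = card {u. u < t \<and> u < N \<and> letter u + e = 2 * m}"

definition circle_code :: "nat \<Rightarrow> nat \<times> nat \<Rightarrow> nat \<times> nat" where
  "circle_code e = (\<lambda>(s, t). ((s + e) div 2, passed e ((s + e) div 2) t mod n))"

lemma passed_0: "passed e m 0 = 0"
  by (simp add: passed_def)

lemma passed_Suc: "passed e m (Suc t) = passed e m t + of_bool (t < N \<and> letter t + e = 2 * m)"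
proof -
  have "{u. u < Suc t \<and> u < N \<and> letter u + e = 2 * m} =
      {u. u < t \<and> u < N \<and> letter u + e = 2 * m} \<union> (if t < N \<and> letter t + e = 2 * m then {t} else {})"
    by (auto simp: less_Suc_eq)
  then show ?thesis by (simp add: passed_def)
qed

lemma passed_Suc_le: "passed e m (Suc t) \<le> Suc (passed e m t)"
  unfolding passed_Suc by (cases "t < N \<and> letter t + e = 2 * m") simp_all

lemma passed_all:
  shows "1 \<le> a \<Longrightarrow> a < p \<Longrightarrow> a + e = 2 * m \<Longrightarrow> passed e m N = n"
    and "(\<And>a. 1 \<le> a \<Longrightarrow> a < p \<Longrightarrow> a + e \<noteq> 2 * m) \<Longrightarrow> passed e m t = 0"
proof -
  assume "1 \<le> a" "a < p" "a + e = 2 * m"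
  moreover from this have "{u. u < N \<and> u < N \<and> letter u + e = 2 * m} = {u. u < N \<and> letter u = a}" by auto
  ultimately show "passed e m N = n" using card_letter[of a] by (simp add: passed_def)
next
  assume "\<And>a. 1 \<le> a \<Longrightarrow> a < p \<Longrightarrow> a + e \<noteq> 2 * m"
  then have "{u. u < t \<and> u < N \<and> letter u + e = 2 * m} = {}" using letter_range by blast
  then show "passed e m t = 0" by (simp add: passed_def)
qed

text \<open>Reduction modulo \<open>n\<close> makes the code agree along the closing arcs from
  height \<open>N\<close> to height 0: a pair of columns is cut \<open>n\<close> times, an unpaired
  outer column never.\<close>

lemma passed_N: "passed e m N mod n = 0"
  using passed_all(1)[of _ e m] passed_all(2)[of e m N] by (metis mod_0 mod_self)

text \<open>Odd letters are positive, so the all-0 resolution cuts the even letters horizontally and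
  the all-1 resolution the odd ones; \<open>e\<close> is 0 or 1 accordingly. The code changes only
  across such a cut.\<close>

lemma circle_code_rel:
  assumes e: "e = (if S = {} then 0 else 1)" and S: "S = {} \<or> S = {..<n_crossings W}"
    and xy: "(x, y) \<in> resolution_rel W S"
  shows "circle_code e x = circle_code e y"
proof -
  have cases: "(x, y) \<in> joins W \<or> (\<exists>t<N. (x, y) \<in> arcs t (t \<in> S))"
    using xy unfolding resolution_rel_eq Rel_def by (auto simp: face_def n_crossings_W)
  consider (up) s t where "x = (s, t)" "y = (s, t + 1)" "s \<noteq> letter t" "s \<noteq> letter t + 1"
    | (top) s where "x = (s, N)" "y = (s, 0)"
    | (arc) t where "t < N" "(x, y) \<in> arcs t (t \<in> S)"
    using cases by (auto simp: joins_W)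
  then show ?thesis
  proof cases
    case up
    \<comment> \<open>A strand passing beside letter \<open>t\<close> does not belong to the pair of
      columns that this letter would cut.\<close>
    have "letter t + e \<noteq> 2 * ((s + e) div 2)" using up(3,4) by presburger
    then show ?thesis by (simp add: up(1,2) circle_code_def passed_Suc)
  next
    case top
    then show ?thesis by (simp add: circle_code_def passed_N passed_0)
  next
    case arc
    have tS: "t \<in> S \<longleftrightarrow> e = 1" using e S arc(1) by (auto simp: n_crossings_W)
    have e01: "e = 0 \<or> e = 1" using e by auto
    show ?thesis
    proof (cases "even (letter t + e)")
      case True
      then have "arcs t (t \<in> S) = {((letter t, t), (letter t + 1, t)), ((letter t, t + 1), (letter t + 1, t + 1))}"
        using e01 tS arc(1) by (auto simp: arcs_def south_def north_def far_def crossing_W)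
      moreover have "(letter t + e) div 2 = (letter t + 1 + e) div 2" using True by presburger
      ultimately show ?thesis using arc(2) by (auto simp: circle_code_def)
    next
      case False
      then have "arcs t (t \<in> S) = {((letter t, t), (letter t, t + 1)), ((letter t + 1, t), (letter t + 1, t + 1))}"
        using e01 tS arc(1) by (auto simp: arcs_def south_def north_def far_def crossing_W)
      moreover have "letter t + e \<noteq> 2 * ((letter t + e) div 2)" "letter t + e \<noteq> 2 * ((letter t + 1 + e) div 2)"
        using False by presburger+
      ultimately show ?thesis using arc(2) by (auto simp: circle_code_def passed_Suc)
    qed
  qed
qed

text \<open>Each pair of columns gives \<open>n\<close> values, one between consecutive cuts. A
  column without partner gives one more: the first for \<open>e = 0\<close>, the last for
  \<open>p + e\<close> even.\<close>

lemma circle_code_image: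
  "(\<lambda>(a, i). ((a + e) div 2, i)) ` ({a \<in> {1..<p}. even (a + e)} \<times> {..<n}) \<union>
     {((a + e) div 2, 0) | a. a = p \<and> even (p + e) \<or> a = 1 \<and> e = 0} \<subseteq> circle_code e ` points W"
proof (intro subsetI, elim UnE)
  fix z assume "z \<in> (\<lambda>(a, i). ((a + e) div 2, i)) ` ({a \<in> {1..<p}. even (a + e)} \<times> {..<n})"
  then obtain a i where z: "z = ((a + e) div 2, i)" and a: "1 \<le> a" "a < p" "even (a + e)" and i: "i < n"
    by auto
  have "a + e = 2 * ((a + e) div 2)" using a by simp
  then have "i \<le> passed e ((a + e) div 2) N" using passed_all(1)[OF a(1,2)] i by simp
  then have "\<exists>t\<le>N. passed e ((a + e) div 2) t = i"
    by (rule attains_value[OF passed_0 passed_Suc_le])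
  then obtain t where t: "t \<le> N" "passed e ((a + e) div 2) t = i" by blast
  have "z = circle_code e (a, t)" using z t i by (simp add: circle_code_def)
  moreover have "(a, t) \<in> points W" using a t by (simp add: points_W)
  ultimately show "z \<in> circle_code e ` points W" by blast
next
  fix z :: "nat \<times> nat" assume "z \<in> {((a + e) div 2, 0) | a. a = p \<and> even (p + e) \<or> a = 1 \<and> e = 0}"
  then obtain a where z: "z = ((a + e) div 2, 0)" and a: "a = p \<and> even (p + e) \<or> a = 1 \<and> e = 0" by blast
  have "z = circle_code e (a, 0)" using z by (simp add: circle_code_def passed_0)
  moreover have "(a, 0) \<in> points W" using a p by (auto simp: points_W)
  ultimately show "z \<in> circle_code e ` points W" by blast
qed

lemma card_circles_ge:
  assumes e: "e = (if S = {} then 0 else 1)" and S: "S = {} \<or> S = {..<n_crossings W}"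
    and X: "X \<subseteq> circle_code e ` points W"
  shows "card X \<le> card (circles W S)"
proof -
  have "card X \<le> card (circle_code e ` points W)" using X finite_points by (intro card_mono) auto
  also have "\<dots> \<le> card (circles W S)"
    unfolding circles_eq using circle_code_rel[OF e S]
    by (intro card_comps_ge_image[OF finite_points]) (simp add: resolution_rel_eq)
  finally show ?thesis .
qed

end

text \<open>Either extreme resolution has \<open>k\<close> pairs of columns with \<open>n\<close>
  circles each and one unpaired column: the first for all-0, the last for all-1. The two bounds
  \<open>k * n + 1\<close> add up to \<open>N + 2\<close>, so they are sharp, and
  \<open>n_plus - V = - 1\<close>.\<close>

lemma weaving_odd:
  assumes "k \<ge> 1" "n \<ge> 1"
  shows "alternating_diagram (weaving (2 * k + 1) n)" "card (circles (weaving (2 * k + 1) n) {}) = k * n + 1"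
    "n_plus (weaving (2 * k + 1) n) = k * n"
proof -
  interpret weaving_braid "2 * k + 1" n by unfold_locales (use assms in auto)
  let ?W = "weaving (2 * k + 1) n"
  have N: "n_crossings ?W = 2 * k * n" unfolding n_crossings_W length_word by simp
  have "insert (0, 0) ({1..k} \<times> {..<n}) \<subseteq> circle_code 0 ` points ?W"
  proof (rule subset_trans[OF _ circle_code_image], rule subsetI)
    fix z assume "z \<in> insert (0, 0) ({1..k} \<times> {..<n})"
    then consider "z = (0, 0)" | m i where "z = (m, i)" "1 \<le> m" "m \<le> k" "i < n" by auto
    then show "z \<in> (\<lambda>(a, i). ((a + 0) div 2, i)) ` ({a \<in> {1..<2 * k + 1}. even (a + 0)} \<times> {..<n}) \<union>
       {((a + 0) div 2, 0) | a. a = 2 * k + 1 \<and> even (2 * k + 1 + 0) \<or> a = 1 \<and> (0 :: nat) = 0}"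
    proof cases
      case 2
      then show ?thesis by (intro UnI1 image_eqI[of _ _ "(2 * m, i)"]) auto
    qed auto
  qed
  then have "card (insert (0, 0) ({1..k} \<times> {..<n})) \<le> card (circles ?W {})"
    by (rule card_circles_ge[rotated 2]) simp_all
  then have V: "k * n + 1 \<le> card (circles ?W {})" by (simp add: card_insert_if)
  have "insert (k + 1, 0) ({1..k} \<times> {..<n}) \<subseteq> circle_code 1 ` points ?W"
  proof (rule subset_trans[OF _ circle_code_image], rule subsetI)
    fix z assume "z \<in> insert (k + 1, 0) ({1..k} \<times> {..<n})"
    then consider "z = (k + 1, 0)" | m i where "z = (m, i)" "1 \<le> m" "m \<le> k" "i < n" by auto
    then show "z \<in> (\<lambda>(a, i). ((a + 1) div 2, i)) ` ({a \<in> {1..<2 * k + 1}. even (a + 1)} \<times> {..<n}) \<union>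
       {((a + 1) div 2, 0) | a. a = 2 * k + 1 \<and> even (2 * k + 1 + 1) \<or> a = 1 \<and> (1 :: nat) = 0}"
    proof cases
      case 2
      then show ?thesis by (intro UnI1 image_eqI[of _ _ "(2 * m - 1, i)"]) auto
    qed auto
  qed
  moreover have "n_crossings ?W \<noteq> 0" using N assms by simp
  ultimately have "card (insert (k + 1, 0) ({1..k} \<times> {..<n})) \<le> card (circles ?W {..<n_crossings ?W})"
    by (intro card_circles_ge[of 1]) (simp_all add: lessThan_empty_iff)
  then have F: "k * n + 1 \<le> card (circles ?W {..<n_crossings ?W})" by (simp add: card_insert_if)
  interpret alternating_diagram ?W
    by unfold_locales (use connected_W V F N in auto)
  show "alternating_diagram ?W" by unfold_locales
  show "card (circles ?W {}) = k * n + 1" using card_circles_sum V F N by simp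
  show "n_plus ?W = k * n" unfolding n_plus_W length_filter_odd by simp
qed

text \<open>The all-0 resolution has \<open>k - 1\<close> pairs and both outer columns unpaired, the
  all-1 resolution has \<open>k\<close> pairs and nothing else. The bounds again add up to
  \<open>N + 2\<close>, and \<open>n_plus - V = n - 2\<close>; adding \<open>n\<close> in the count
  avoids subtraction of naturals.\<close>

lemma weaving_even:
  assumes "k \<ge> 1" "n \<ge> 1"
  shows "alternating_diagram (weaving (2 * k) n)" "card (circles (weaving (2 * k) n) {}) + n = k * n + 2"
    "n_plus (weaving (2 * k) n) = k * n"
proof -
  interpret weaving_braid "2 * k" n by unfold_locales (use assms in auto)
  let ?W = "weaving (2 * k) n"
  have N: "n_crossings ?W = n * (2 * k - 1)" unfolding n_crossings_W length_word by simp
  have "{(0, 0), (k, 0)} \<union> {1..<k} \<times> {..<n} \<subseteq> circle_code 0 ` points ?W"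
  proof (rule subset_trans[OF _ circle_code_image], rule subsetI)
    fix z assume "z \<in> {(0, 0), (k, 0)} \<union> {1..<k} \<times> {..<n}"
    then consider "z = (0, 0)" | "z = (k, 0)" | m i where "z = (m, i)" "1 \<le> m" "m < k" "i < n" by auto
    then show "z \<in> (\<lambda>(a, i). ((a + 0) div 2, i)) ` ({a \<in> {1..<2 * k}. even (a + 0)} \<times> {..<n}) \<union>
       {((a + 0) div 2, 0) | a. a = 2 * k \<and> even (2 * k + 0) \<or> a = 1 \<and> (0 :: nat) = 0}"
    proof cases
      case 1
      then show ?thesis by (intro UnI2 CollectI exI[of _ 1]) simp
    next
      case 2
      then show ?thesis by (intro UnI2 CollectI exI[of _ "2 * k"]) simp
    next
      case 3
      then show ?thesis by (intro UnI1 image_eqI[of _ _ "(2 * m, i)"]) auto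
    qed
  qed
  then have "card ({(0 :: nat, 0 :: nat), (k, 0)} \<union> {1..<k} \<times> {..<n}) \<le> card (circles ?W {})"
    by (rule card_circles_ge[rotated 2]) simp_all
  moreover have "card ({(0 :: nat, 0 :: nat), (k, 0)} \<union> {1..<k} \<times> {..<n}) = 2 + (k - 1) * n"
    using assms by (subst card_Un_disjoint) auto
  ultimately have V: "2 + (k - 1) * n \<le> card (circles ?W {})" by simp
  have "{1..k} \<times> {..<n} \<subseteq> circle_code 1 ` points ?W"
  proof (rule subset_trans[OF _ circle_code_image], rule subsetI)
    fix z assume "z \<in> {1..k} \<times> {..<n}"
    then obtain m i where "z = (m, i)" "1 \<le> m" "m \<le> k" "i < n" by auto
    then show "z \<in> (\<lambda>(a, i). ((a + 1) div 2, i)) ` ({a \<in> {1..<2 * k}. even (a + 1)} \<times> {..<n}) \<union>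
       {((a + 1) div 2, 0) | a. a = 2 * k \<and> even (2 * k + 1) \<or> a = 1 \<and> (1 :: nat) = 0}"
      by (intro UnI1 image_eqI[of _ _ "(2 * m - 1, i)"]) auto
  qed
  moreover have "n_crossings ?W \<noteq> 0" using N assms by simp
  ultimately have "card ({1..k} \<times> {..<n}) \<le> card (circles ?W {..<n_crossings ?W})"
    by (intro card_circles_ge[of 1]) (simp_all add: lessThan_empty_iff)
  then have F: "k * n \<le> card (circles ?W {..<n_crossings ?W})" by simp
  obtain k' where k': "k = Suc k'" using assms by (cases k) auto
  have "n * (2 * k - 1) = (k - 1) * n + k * n" unfolding k' by (simp add: algebra_simps)
  then have N': "n_crossings ?W = (k - 1) * n + k * n" by (rule trans[OF N])
  interpret alternating_diagram ?W
    by unfold_locales (use connected_W V F N' in auto)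
  show "alternating_diagram ?W" by unfold_locales
  show "card (circles ?W {}) + n = k * n + 2" using card_circles_sum V F N' k' by simp
  have "[1..<2 * k + 1] = [1..<2 * k] @ [2 * k]" using assms by simp
  then have "filter odd [1..<2 * k] = filter odd [1..<2 * k + 1]" by simp
  then show "n_plus ?W = k * n" unfolding n_plus_W using length_filter_odd[of k] by (simp only: mult.commute)
qed

theorem theorem2p5:
  fixes k n :: nat
  assumes "k \<ge> 1" and "n \<ge> 1"
  shows "(gcd (2 * k + 1) n = 1 \<longrightarrow>
            (\<forall>i j. khovanov_homology (weaving (2 * k + 1) n) i j
                     \<noteq> {khovanov_zero (weaving (2 * k + 1) n) i j} \<longrightarrow>
                   j = 2 * i + 1 \<or> j = 2 * i - 1)) \<and>
         (gcd (2 * k) n = 1 \<longrightarrow>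
            (\<forall>i j. khovanov_homology (weaving (2 * k) n) i j
                     \<noteq> {khovanov_zero (weaving (2 * k) n) i j} \<longrightarrow>
                   j = 2 * i + int n \<or> j = 2 * i + int n - 2))"
proof (intro conjI impI allI)
  fix i j
  let ?W = "weaving (2 * k + 1) n"
  assume "khovanov_homology ?W i j \<noteq> {khovanov_zero ?W i j}"
  then have "j = 2 * i + int (n_plus ?W) - int (card (circles ?W {})) \<or>
      j = 2 * i + int (n_plus ?W) - int (card (circles ?W {})) + 2"
    by (rule alternating_diagram.khovanov_thin[OF weaving_odd(1)[OF assms]])
  then show "j = 2 * i + 1 \<or> j = 2 * i - 1"
    unfolding weaving_odd(2,3)[OF assms] by linarith
next
  fix i j
  let ?W = "weaving (2 * k) n"
  assume "khovanov_homology ?W i j \<noteq> {khovanov_zero ?W i j}"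
  then have "j = 2 * i + int (n_plus ?W) - int (card (circles ?W {})) \<or>
      j = 2 * i + int (n_plus ?W) - int (card (circles ?W {})) + 2"
    by (rule alternating_diagram.khovanov_thin[OF weaving_even(1)[OF assms]])
  then show "j = 2 * i + int n \<or> j = 2 * i + int n - 2"
    unfolding weaving_even(3)[OF assms] using weaving_even(2)[OF assms] by linarith
qed

end
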